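(* Let $n\in\{4,5,6,7\}$. Then $$E=F=\langle d_1^{2^{n-2}}\rangle\times\prod_{2l+1\in A_0\setminus\{1\}}\langle d_{2l+1}^{-1}d_{2^{n-1}-(2l+1)}\rangle\times\prod_{k=1}^{n-3}\ \prod_{2l+1\in A_k}\langle d_{2l+1}^{-2^k}d_{2^{n-1-k}-(2l+1)}^{2^k}\rangle ,$$ equivalently $$V_1=\langle u_{\chi_1}(d_1^{2^{n-2}})\rangle\times\prod_{2l+1\in A_0\setminus\{1\}}\langle u_{\chi_1}(d_{2l+1}^{-1})\,u_{\chi_1}(d_{2^{n-1}-(2l+1)})\rangle\times\prod_{k=1}^{n-3}\ \prod_{2l+1\in A_k}\langle u_{\chi_1}(d_{2l+1}^{-2^k})\,u_{\chi_1}(d_{2^{n-1-k}-(2l+1)}^{2^k})\rangle .$$ Explicitly: (for $2^n=16$) $E=\langle d_1^4\rangle\times\langle d_3^{-1}d_5\rangle\times\langle d_1^{-2}d_3^2\rangle$; (for $2^n=32$) $E=\langle d_1^8\rangle\times\langle d_3^{-1}d_{13}\rangle\times\langle d_5^{-1}d_{11}\rangle\times\langle d_7^{-1}d_9\rangle\times\langle d_1^{-2}d_7^2\rangle\times\langle d_3^{-2}d_5^2\rangle\times\langle d_1^{-4}d_3^4\rangle$; (for $2^n=64$) $E=\langle d_1^{16}\rangle\times\prod_{l=1}^{7}\langle d_{2l+1}^{-1}d_{32-(2l+1)}\rangle\times\langle d_1^{-2}d_{15}^2\rangle\times\langle d_3^{-2}d_{13}^2\rangle\times\langle d_5^{-2}d_{11}^2\rangle\times\langle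 d_7^{-2}d_9^2\rangle\times\langle d_1^{-4}d_7^4\rangle\times\langle d_3^{-4}d_5^4\rangle\times\langle d_1^{-8}d_3^8\rangle$; (for $2^n=128$) $E=\langle d_1^{32}\rangle\times\prod_{l=1}^{15}\langle d_{2l+1}^{-1}d_{64-(2l+1)}\rangle\times\prod_{l=0}^{7}\langle d_{2l+1}^{-2}d_{32-(2l+1)}^2\rangle\times\langle d_1^{-4}d_{15}^4\rangle\times\langle d_3^{-4}d_{13}^4\rangle\times\langle d_5^{-4}d_{11}^4\rangle\times\langle d_7^{-4}d_9^4\rangle\times\langle d_1^{-8}d_7^8\rangle\times\langle d_3^{-8}d_5^8\rangle\times\langle d_1^{-16}d_3^{16}\rangle$. All products are internal direct products of groups.
   Context: Let $\alpha=e^{2\pi i/2^n}$, $\mathbf{Q}_{2^n}=\mathbf{Q}(\alpha)$, with ring of integers $\mathbf{Z}[\alpha]$ and unit group $\mathrm{Un}(\mathbf{Z}[\alpha])$. For $\rho,\sigma\in\mathbf{Z}[\alpha]$, $\rho\equiv\sigma\pmod 2$ means $\rho-\sigma\in 2\mathbf{Z}[\alpha]$. For an integer $j$ put $d_j=1+\alpha^j+\alpha^{-j}$. Let $D$ be the subgroup of $\mathrm{Un}(\mathbf{Z}[\alpha])$ generated by $d_1,d_3,d_5,\dots,d_{2^{n-1}-3}$ (it is the internal direct product of the infinite cyclic groups $\langle d_{2l+1}\rangle$, $0\le l\le 2^{n-2}-2$). Put $E=\{\lambda\in D\mid \lambda\equiv 1\pmod 2\}$. For $k\in\{0,1,\dots,n-3\}$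 let $A_k=\{1,3,5,\dots,2^{n-2-k}-1\}$ (all odd integers from $1$ to $2^{n-2-k}-1$). For $2l+1\in A_0\setminus\{1\}$ (when $k=0$) or $2l+1\in A_k$ (when $1\le k\le n-3$) put $q(k,2l+1)=d_{2l+1}^{-1}d_{2^{n-1-k}-(2l+1)}$. Put $F_0=\prod_{2l+1\in A_0\setminus\{1\}}\langle q(0,2l+1)\rangle$, $F_k=\prod_{2l+1\in A_k}\langle q(k,2l+1)^{2^k}\rangle$ for $1\le k\le n-3$, and $F=\langle d_1^{2^{n-2}}\rangle\times\prod_{k=0}^{n-3}F_k\le D$. Let $G=\langle x\rangle$ be the cyclic group of order $2^n$, $\chi_1$ the character of $G$ with $\chi_1(x)=\alpha$, and $\mathrm{V}(\mathbf{Z}G)$ the group of normalized units (units of augmentation $1$) of $\mathbf{Z}G$. For $\beta\in\mathrm{Un}(\mathbf{Z}[\alpha])$ the element $u_{\chi_1}(\beta)=\sum_{j=0}^{2^n-1}\gamma_jx^j\in\mathbf{Q}G$ is given by $\gamma_0=1+\frac{1}{2^n}\mathrm{tr}(\beta-1)$ and $\gamma_j=\frac1{2^n}\mathrm{tr}\big((\beta-1)\alpha^{-j}\big)$ for $1\le j\le 2^n-1$, where $\mathrm{tr}$ is the trace from $\mathbf{Q}_{2^n}$ to $\mathbf{Q}$; $u_{\chi_1}$ is multiplicative in $\beta$. Put $W_1=\{u_{\chi_1}(\beta)\in\mathrm{V}(\mathbf{Z}G)\mid\beta\in\mathrm{Un}(\mathbf{Z}[\alpha])\}$ and $V_1=\{u_{\chi_1}(\lambda)\in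 W_1\mid\lambda\in E\}$. *)

theory Defs
  imports
    Complex_Main
    "HOL-Library.FuncSet"
    "HOL-Algebra.Generated_Fields"
    "HOL-Algebra.QuotRing"
    "HOL-Algebra.Algebraic_Closure_Type"
begin

subsection \<open>Internal direct products of subgroups\<close>

definition cyc :: "('a, 'm) monoid_scheme \<Rightarrow> 'a \<Rightarrow> 'a set" where
  "cyc K a = generate K {a}"

definition subgroup_prod ::
  "('a, 'm) monoid_scheme \<Rightarrow> 'i set \<Rightarrow> ('i \<Rightarrow> 'a set) \<Rightarrow> 'a set" where
  "subgroup_prod K I H = generate K (\<Union>i\<in>I. H i)"

text \<open>\<open>P\<close> is a subgroup of \<open>K\<close> and is the internal direct product of the family
  \<open>(H i)\<close> with \<open>i \<in> I\<close>.  The family is indexed, so repeated factors are not identified.\<close>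

definition is_internal_direct_product ::
  "('a, 'm) monoid_scheme \<Rightarrow> 'i set \<Rightarrow> ('i \<Rightarrow> 'a set) \<Rightarrow> 'a set \<Rightarrow> bool" where
  "is_internal_direct_product K I H P \<longleftrightarrow>
     subgroup P K \<and>
     (\<forall>i\<in>I. H i \<lhd> K\<lparr>carrier := P\<rparr>) \<and>
     P = subgroup_prod K I H \<and>
     (\<forall>i\<in>I. H i \<inter> subgroup_prod K (I - {i}) H = {\<one>\<^bsub>K\<^esub>})"

text \<open>\<open>P\<close> is the internal direct product of the cyclic groups generated by the successive
  entries of a list.\<close>

definition is_direct_product_of_cyclics ::
  "('a, 'm) monoid_scheme \<Rightarrow> 'a list \<Rightarrow> 'a set \<Rightarrow> bool" where
  "is_direct_product_of_cyclics K gs P \<longleftrightarrow>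
     is_internal_direct_product K {..<length gs} (\<lambda>i. cyc K (gs ! i)) P"


subsection \<open>The cyclotomic field and its units\<close>

definition alpha :: "nat \<Rightarrow> complex" where
  "alpha n = exp (2 * of_real pi * \<i> / 2 ^ n)"

definition Zalpha :: "nat \<Rightarrow> complex ring" where
  "Zalpha n = ring_of_type_algebra\<lparr>carrier := generate_ring ring_of_type_algebra {alpha n}\<rparr>"

definition Qalpha :: "nat \<Rightarrow> complex ring" where
  "Qalpha n = ring_of_type_algebra\<lparr>carrier := generate_field ring_of_type_algebra {alpha n}\<rparr>"

definition Un_grp :: "nat \<Rightarrow> complex monoid" where
  "Un_grp n = units_of (Zalpha n)"

text \<open>Every ring automorphism of \<open>Qalpha n\<close> fixes the rationals.  Maps are taken extensional
  so that each automorphism is represented by exactly one function.\<close>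

definition Gal :: "nat \<Rightarrow> (complex \<Rightarrow> complex) set" where
  "Gal n = ring_iso (Qalpha n) (Qalpha n) \<inter> extensional (carrier (Qalpha n))"

text \<open>The trace from \<open>Qalpha n\<close>, a Galois extension of the rationals, to the rationals.\<close>

definition tr :: "nat \<Rightarrow> complex \<Rightarrow> complex" where
  "tr n b = (\<Sum>\<sigma>\<in>Gal n. \<sigma> b)"

definition cong2 :: "nat \<Rightarrow> complex \<Rightarrow> complex \<Rightarrow> bool" where
  "cong2 n r s \<longleftrightarrow> (\<exists>t\<in>carrier (Zalpha n). r - s = 2 * t)"


subsection \<open>The groups \<open>D\<close>, \<open>E\<close> and \<open>F\<close>\<close>

definition d_el :: "nat \<Rightarrow> int \<Rightarrow> complex" where
  "d_el n j = 1 + alpha n powi j + alpha n powi (- j)"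

definition D_grp :: "nat \<Rightarrow> complex set" where
  "D_grp n = generate (Un_grp n) {d_el n j | j. odd j \<and> 1 \<le> j \<and> j \<le> 2 ^ (n - 1) - 3}"

definition E_grp :: "nat \<Rightarrow> complex set" where
  "E_grp n = {b \<in> D_grp n. cong2 n b 1}"

definition A_set :: "nat \<Rightarrow> nat \<Rightarrow> int set" where
  "A_set n k = {j. odd j \<and> 1 \<le> j \<and> j \<le> 2 ^ (n - 2 - k) - 1}"

definition F_index :: "nat \<Rightarrow> nat \<Rightarrow> int set" where
  "F_index n k = (if k = 0 then A_set n 0 - {1} else A_set n k)"

definition q_el :: "nat \<Rightarrow> nat \<Rightarrow> int \<Rightarrow> complex" where
  "q_el n k j = inverse (d_el n j) * d_el n (2 ^ (n - 1 - k) - j)"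

definition Fk_grp :: "nat \<Rightarrow> nat \<Rightarrow> complex set" where
  "Fk_grp n k = subgroup_prod (Un_grp n) (F_index n k) (\<lambda>j. cyc (Un_grp n) (q_el n k j ^ 2 ^ k))"

definition F_grp :: "nat \<Rightarrow> complex set" where
  "F_grp n = generate (Un_grp n)
     (cyc (Un_grp n) (d_el n 1 ^ 2 ^ (n - 2)) \<union> subgroup_prod (Un_grp n) {0..n - 3} (Fk_grp n))"

text \<open>Index set of all cyclic factors: \<open>None\<close> stands for the factor generated by a power of
  \<open>d_el n 1\<close>, and \<open>Some (k, j)\<close> for the factor of \<open>Fk_grp n k\<close> belonging to \<open>j\<close>.\<close>

definition factor_index :: "nat \<Rightarrow> (nat \<times> int) option set" where
  "factor_index n = insert None (Some ` (SIGMA k:{0..n - 3}. F_index n k))"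

fun E_gen :: "nat \<Rightarrow> (nat \<times> int) option \<Rightarrow> complex" where
  "E_gen n None = d_el n 1 ^ 2 ^ (n - 2)"
| "E_gen n (Some (k, j)) =
     d_el n j powi (- (2 ^ k)) * d_el n (2 ^ (n - 1 - k) - j) ^ 2 ^ k"


subsection \<open>Group rings and the units \<open>u_chi1\<close>\<close>

text \<open>The group ring of a \<^emph>\<open>finite\<close> group \<open>G\<close> with coefficients in a subring \<open>S\<close>
  (below the integers or the rationals, both as subsets of the complex numbers).\<close>

definition group_ring :: "complex set \<Rightarrow> ('g, 'm) monoid_scheme \<Rightarrow> ('g \<Rightarrow> complex) ring" where
  "group_ring S G =
     \<lparr>carrier = carrier G \<rightarrow>\<^sub>E S,
      monoid.mult = (\<lambda>a b. \<lambda>g\<in>carrier G. \<Sum>h\<in>carrier G. a h * b (inv\<^bsub>G\<^esub> h \<otimes>\<^bsub>G\<^esub> g)),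
      one = (\<lambda>g\<in>carrier G. if g = \<one>\<^bsub>G\<^esub> then 1 else 0),
      zero = (\<lambda>g\<in>carrier G. 0),
      add = (\<lambda>a b. \<lambda>g\<in>carrier G. a g + b g)\<rparr>"

definition V_ZG :: "('g, 'm) monoid_scheme \<Rightarrow> ('g \<Rightarrow> complex) monoid" where
  "V_ZG G = (units_of (group_ring \<int> G))
     \<lparr>carrier := {a \<in> Units (group_ring \<int> G). (\<Sum>g\<in>carrier G. a g) = 1}\<rparr>"

definition gamma :: "nat \<Rightarrow> complex \<Rightarrow> nat \<Rightarrow> complex" where
  "gamma n b j = (if j = 0 then 1 + tr n (b - 1) / 2 ^ n
                  else tr n ((b - 1) * alpha n powi (- int j)) / 2 ^ n)"

text \<open>The element \<open>\<Sum>j<2^n. gamma n b j \<cdot> x^j\<close> of the group ring.\<close>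

definition u_chi1 :: "('g, 'm) monoid_scheme \<Rightarrow> 'g \<Rightarrow> nat \<Rightarrow> complex \<Rightarrow> ('g \<Rightarrow> complex)" where
  "u_chi1 G x n b =
     (\<lambda>g\<in>carrier G. \<Sum>j | j < 2 ^ n \<and> x [^]\<^bsub>G\<^esub> j = g. gamma n b j)"

definition W1 :: "('g, 'm) monoid_scheme \<Rightarrow> 'g \<Rightarrow> nat \<Rightarrow> ('g \<Rightarrow> complex) set" where
  "W1 G x n = {u_chi1 G x n b | b. b \<in> carrier (Un_grp n) \<and> u_chi1 G x n b \<in> carrier (V_ZG G)}"

definition V1 :: "('g, 'm) monoid_scheme \<Rightarrow> 'g \<Rightarrow> nat \<Rightarrow> ('g \<Rightarrow> complex) set" where
  "V1 G x n = {u_chi1 G x n b | b. b \<in> E_grp n \<and> u_chi1 G x n b \<in> W1 G x n}"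

text \<open>The two arguments of the product need not have integral coefficients, so the product
  is taken in the rational group ring.\<close>

fun V_gen :: "('g, 'm) monoid_scheme \<Rightarrow> 'g \<Rightarrow> nat \<Rightarrow> (nat \<times> int) option \<Rightarrow> ('g \<Rightarrow> complex)" where
  "V_gen G x n None = u_chi1 G x n (d_el n 1 ^ 2 ^ (n - 2))"
| "V_gen G x n (Some (k, j)) =
     u_chi1 G x n (d_el n j powi (- (2 ^ k)))
       \<otimes>\<^bsub>group_ring \<rat> G\<^esub> u_chi1 G x n (d_el n (2 ^ (n - 1 - k) - j) ^ 2 ^ k)"

end

theory Submission
  imports Defs "HOL-Number_Theory.Pocklington" "HOL-Library.Z2"
begin

text \<open>
  \<^bold>\<open>Why \<open>E = F\<close>.\<close>  The elements \<open>d\<^sub>j = 1 + \<alpha>\<^sup>j + \<alpha>\<^sup>-\<^sup>j\<close> are polynomials in \<open>\<tau> = \<alpha> + 1/\<alpha>\<close>, namely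
  \<open>1 + D\<^sub>j(\<tau>)\<close> with the Dickson polynomial \<open>D\<^sub>j\<close>, and a polynomial in \<open>\<tau>\<close> is divisible by 2 in
  \<open>\<int>[\<alpha>]\<close> only if its reduction modulo 2 is divisible by \<open>t\<^bsup>H\<^esup>\<close> with \<open>H = 2\<^bsup>n-2\<^esup>\<close>
  (\<open>congX_of_even2\<close>).  So \<open>E\<close> is described by relations between the series \<open>1 + D\<^sub>j(t)\<close> over the
  field with two elements, modulo \<open>t\<^sup>H\<close>.  The reflection \<open>D\<^sub>b \<equiv> D\<^bsub>2H-b\<^esub>\<close> accounts for
  the generators with \<open>k = 0\<close> and leaves a relation between the series with odd \<open>b < H\<close>.  Its
  exponents are all even (\<open>even_exponents\<close>): the logarithmic derivative \<open>t d/dt\<close> sends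
  \<open>1 + D\<^sub>b\<close> to \<open>z\<^sub>b = D\<^sub>b / (1 + D\<^sub>b)\<close> and kills squares, and the \<open>z\<^sub>b\<close> with odd \<open>b < H\<close> are linearly
  independent modulo \<open>t\<^sup>H\<close>.  For the latter, the \<open>z\<^sub>b\<close> are the conjugates of \<open>z\<^sub>1\<close> under the substitution
  \<open>\<sigma>: t \<mapsto> D\<^sub>3(t) = t + t\<^sup>3\<close>, because the powers of 3 run through the odd residues modulo \<open>2\<^sup>m\<close> up to
  sign, and \<open>\<sigma> - 1\<close> raises an odd order of vanishing by exactly 2.  Since the exponents are even
  and squaring is injective in characteristic 2, a square root of the relation holds modulo
  \<open>t\<^bsup>H/2\<^esup>\<close>, where the same argument applies with the generators for \<open>k = 1\<close>, and so on
  (\<open>relation_descent\<close>).  The converse inclusion rests on \<open>d\<^sub>j\<^bsup>2^k\<^esup> \<equiv> d\<^bsub>2^k j\<^esub>\<close> modulo 2.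

  \<^bold>\<open>Why the products are direct.\<close>  The generators are triangular in the \<open>d\<^sub>j\<close>, so it suffices that the
  \<open>d\<^sub>j\<close> are multiplicatively independent (\<open>d_el_independent\<close>).  The real numbers \<open>ln \<bar>d\<^sub>j\<bar>\<close> form one
  orbit under the cyclic Galois group of the real subfield, and the exponents of a relation, read as
  an element of the group ring, annihilate this orbit.  Descending through the tower of real
  subfields, the norms of the \<open>d\<^sub>j\<close> are again of this form, and what remains at each step is a
  negacyclic sequence on which \<open>\<int>[X]/(X\<^sup>m + 1)\<close> acts; this ring embeds into a field, so a nonzero
  element can annihilate only the zero sequence.  Hence the exponents are constant, and they vanish
  because one of the conjugates is not among the generators of \<open>D\<close>.

  \<^bold>\<open>The group ring.\<close>  On \<open>u(\<beta>)\<close> the character \<open>x \<mapsto> \<alpha>\<^sup>m\<close> takes the value \<open>\<sigma>\<^sub>m(\<beta>)\<close> for odd \<open>m\<close> and 1 for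
  even \<open>m\<close>.  By Fourier inversion \<open>u\<close> is multiplicative and injective, and it maps \<open>E\<close> into the
  normalized units with integral coefficients, so the decomposition of \<open>E\<close> is carried over to \<open>V\<^sub>1\<close>.
  All of this holds for every \<open>n \<ge> 3\<close>.
\<close>

section \<open>Integer polynomials and the minimal polynomial of \<open>\<alpha>\<close>\<close>

text \<open>Values are taken in the complex numbers and, for reduction modulo 2, at the indeterminate of
  the power series over the field with two elements.\<close>
definition ieval :: "int poly \<Rightarrow> 'a::comm_ring_1 \<Rightarrow> 'a" where
  "ieval p z = poly (map_poly of_int p) z"

lemma ieval_pCons [simp]: "ieval (pCons a p) z = of_int a + z * ieval p z"
  by (simp add: ieval_def map_poly_pCons)

lemma ieval_0 [simp]: "ieval 0 z = 0"
  by (simp add: ieval_def)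

lemma ieval_1 [simp]: "ieval 1 z = 1"
  by (simp add: ieval_def)

lemma ieval_add [simp]: "ieval (p + q) z = ieval p z + ieval q z"
proof -
  have "map_poly of_int (p + q) = (map_poly of_int p + map_poly of_int q :: 'a poly)"
    by (intro poly_eqI) (simp add: coeff_map_poly)
  then show ?thesis by (simp add: ieval_def)
qed

lemma ieval_smult [simp]: "ieval (smult c p) z = of_int c * ieval p z"
  by (simp add: ieval_def map_poly_smult)

lemma ieval_minus [simp]: "ieval (- p) z = - ieval p z"
  using ieval_smult[of "-1" p z] by simp

lemma ieval_diff [simp]: "ieval (p - q) z = ieval p z - ieval q z"
  using ieval_add[of p "- q" z] by simp

lemma ieval_mult [simp]: "ieval (p * q) z = ieval p z * ieval q z"
  by (induction p) (simp_all add: algebra_simps)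

lemma ieval_power [simp]: "ieval (p ^ k) z = ieval p z ^ k"
  by (induction k) simp_all

lemma ieval_monom [simp]: "ieval (monom c k) z = of_int c * z ^ k"
  by (simp add: ieval_def map_poly_monom poly_monom)

lemma ieval_of_int [simp]: "ieval (of_int c) z = of_int c"
  by (simp add: of_int_poly)

lemma ieval_numeral [simp]: "ieval (numeral c) z = numeral c"
  using ieval_of_int[of "numeral c" z] by simp

lemma ieval_pcompose [simp]: "ieval (p \<circ>\<^sub>p q) z = ieval p (ieval q z)"
  by (induction p) (simp_all add: pcompose_pCons)

lemma ieval_sum [simp]: "ieval (sum f A) z = (\<Sum>x\<in>A. ieval (f x) z)"
  by (induction A rule: infinite_finite_induct) simp_all

lemma ieval_prod [simp]: "ieval (prod f A) z = (\<Prod>x\<in>A. ieval (f x) z)"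
  by (induction A rule: infinite_finite_induct) simp_all

lemma ieval_int [simp]: "ieval p (c::int) = poly p c"
  by (simp add: ieval_def)

lemma ieval_of_int_arg: "ieval p (of_int c) = of_int (poly p c)"
  by (induction p) simp_all

lemma ieval_altdef: "ieval p z = (\<Sum>i\<le>degree p. of_int (coeff p i) * z ^ i)"
proof -
  have "p = (\<Sum>i\<le>degree p. monom (coeff p i) i)"
    by (simp add: poly_as_sum_of_monoms)
  then have "ieval p z = ieval (\<Sum>i\<le>degree p. monom (coeff p i) i) z"
    by simp
  then show ?thesis by (simp del: poly_as_sum_of_monoms)
qed

text \<open>The cyclotomic polynomial of order \<open>2\<^bsup>k+1\<^esup>\<close>.\<close>
definition Phi :: "nat \<Rightarrow> int poly" where
  "Phi k = monom 1 (2 ^ k) + 1"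

lemma ieval_Phi [simp]: "ieval (Phi k) z = z ^ 2 ^ k + 1"
  by (simp add: Phi_def)

lemma degree_Phi [simp]: "degree (Phi k) = 2 ^ k"
  unfolding Phi_def by (subst degree_add_eq_left) (simp_all add: degree_monom_eq)

lemma lead_coeff_Phi [simp]: "coeff (Phi k) (2 ^ k) = 1"
  by (simp add: Phi_def)

lemma Phi_nonzero [simp]: "Phi k \<noteq> 0"
  using lead_coeff_Phi[of k] by force

lemma even_odd_parts:
  fixes f :: "int poly"
  shows "\<exists>A B. f = A \<circ>\<^sub>p monom 1 2 + monom 1 1 * (B \<circ>\<^sub>p monom 1 2)"
proof (induction f)
  case 0
  show ?case by (rule exI[of _ 0], rule exI[of _ 0]) simp
next
  case (pCons a p)
  then obtain A B where p: "p = A \<circ>\<^sub>p monom 1 2 + monom 1 1 * (B \<circ>\<^sub>p monom 1 2)" by blast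
  have "pCons a p = [:a:] + monom 1 1 * p"
    by (simp add: monom_altdef)
  also have "\<dots> = pCons a B \<circ>\<^sub>p monom 1 2 + monom 1 1 * (A \<circ>\<^sub>p monom 1 2)"
    unfolding p by (simp add: pcompose_pCons monom_altdef algebra_simps power2_eq_square)
  finally show ?case by blast
qed

text \<open>The product of the conjugates \<open>f(\<zeta>)\<close> over the roots of \<open>Phi k\<close>, computed by the tower
  \<open>f(X) f(- X) = f\<^sub>1(X\<^sup>2)\<close>.  Modulo 2 squaring is additive, so \<open>f\<^sub>1(1)\<close> and \<open>f(1)\<close> have the
  same parity and the norm has the parity of \<open>f(1)\<close>.\<close>
lemma norm_cofactor:
  fixes f :: "int poly"
  shows "\<exists>g r. Phi k dvd f * g - [:r:] \<and> even (r - poly f 1) \<and>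
    (r = 0 \<longrightarrow> (\<exists>z::complex. z ^ 2 ^ k = -1 \<and> ieval f z = 0))"
proof (induction k arbitrary: f)
  case 0
  have "[:- (-1), 1:] dvd f - [:poly f (-1):]"
    by (subst poly_eq_0_iff_dvd[symmetric]) simp
  then have d: "Phi 0 dvd f * 1 - [:poly f (-1):]"
    by (simp add: Phi_def monom_altdef one_pCons)
  have "even (poly f (-1) - poly f 1)"
  proof (induction f)
    case (pCons a p)
    then have "even (- (poly p (-1) - poly p 1) - 2 * poly p 1)" by simp
    then show ?case by (simp add: algebra_simps)
  qed simp
  moreover have "poly f (-1) = 0 \<longrightarrow> (\<exists>z::complex. z ^ 2 ^ 0 = -1 \<and> ieval f z = 0)"
    using ieval_of_int_arg[of f "-1", where 'a=complex] by auto
  ultimately show ?case using d by blast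
next
  case (Suc k)
  obtain A B where f: "f = A \<circ>\<^sub>p monom 1 2 + monom 1 1 * (B \<circ>\<^sub>p monom 1 2)"
    using even_odd_parts by blast
  define f' where "f' = A \<circ>\<^sub>p monom 1 2 - monom 1 1 * (B \<circ>\<^sub>p monom 1 2)"
  define f1 where "f1 = A ^ 2 - monom 1 1 * B ^ 2"
  have X2: "monom 1 1 \<circ>\<^sub>p monom 1 2 = (monom 1 1 :: int poly) ^ 2"
    by (simp add: monom_altdef pcompose_pCons)
  have prod: "f * f' = f1 \<circ>\<^sub>p monom 1 2"
    unfolding f f'_def f1_def
    by (simp only: pcompose_diff pcompose_mult power2_eq_square X2) (simp add: algebra_simps)
  obtain g r where gr: "Phi k dvd f1 * g - [:r:]" "even (r - poly f1 1)"
    "r = 0 \<longrightarrow> (\<exists>z::complex. z ^ 2 ^ k = -1 \<and> ieval f1 z = 0)"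
    using Suc.IH by metis
  then obtain q where q: "f1 * g - [:r:] = Phi k * q" by (auto elim: dvdE)
  have mp: "monom 1 m \<circ>\<^sub>p monom 1 2 = (monom 1 (2 * m) :: int poly)" for m
  proof -
    have "monom 1 m \<circ>\<^sub>p monom 1 2 = (monom 1 2 :: int poly) ^ m"
      by (induction m) (simp_all add: monom_Suc pcompose_pCons pcompose_1)
    then show ?thesis by (simp add: monom_power)
  qed
  have Phi2: "Phi k \<circ>\<^sub>p monom 1 2 = Phi (Suc k)"
    by (simp add: Phi_def pcompose_add pcompose_1 mp)
  have "(f1 * g - [:r:]) \<circ>\<^sub>p monom 1 2 = Phi (Suc k) * (q \<circ>\<^sub>p monom 1 2)"
    by (simp only: q pcompose_mult Phi2)
  then have 1: "Phi (Suc k) dvd f * (f' * (g \<circ>\<^sub>p monom 1 2)) - [:r:]"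
    by (simp add: pcompose_diff pcompose_mult prod[symmetric] mult.assoc pcompose_const)
  have "even (poly f1 1 - poly f 1)"
    unfolding f1_def f by (simp add: poly_pcompose poly_monom power2_eq_square)
  with gr(2) have 2: "even (r - poly f 1)" by simp
  have 3: "r = 0 \<longrightarrow> (\<exists>z::complex. z ^ 2 ^ Suc k = -1 \<and> ieval f z = 0)"
  proof
    assume "r = 0"
    then obtain z :: complex where z: "z ^ 2 ^ k = -1" "ieval f1 z = 0" using gr(3) by blast
    define w where "w = csqrt z"
    have w: "w ^ 2 = z" by (simp add: w_def)
    have "ieval f1 z = ieval (f * f') w" by (simp add: prod w)
    then have "ieval f w * ieval f' w = 0" using z by simp
    moreover have "ieval f' w = ieval f (- w)" by (simp add: f f'_def)
    ultimately have "ieval f w = 0 \<or> ieval f (- w) = 0" by simp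
    moreover have "w ^ 2 ^ Suc k = -1" "(- w) ^ 2 ^ Suc k = -1"
      using z w by (simp_all add: power_mult)
    ultimately show "\<exists>z::complex. z ^ 2 ^ Suc k = -1 \<and> ieval f z = 0" by blast
  qed
  show ?case using 1 2 3 by blast
qed

lemma root_imp_even:
  fixes z :: complex
  assumes "z ^ 2 ^ k = -1" "ieval f z = 0"
  shows "even (poly f 1)"
proof -
  obtain g r where gr: "Phi k dvd f * g - [:r:]" "even (r - poly f 1)"
    using norm_cofactor by metis
  then obtain q where q: "f * g - [:r:] = Phi k * q" by (auto elim: dvdE)
  have "ieval (f * g - [:r:]) z = ieval (Phi k * q) z" by (simp only: q)
  then have "r = 0" using assms by simp
  with gr show ?thesis by simp
qed

text \<open>An Eisenstein argument through values at 1: if \<open>Phi k = p * g\<close> with both factors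
  nonconstant, then both have a root of \<open>Phi k\<close>, so \<open>p(1)\<close> and \<open>g(1)\<close> are even, although
  their product is 2.\<close>
lemma Phi_dvd_if_root:
  fixes z :: complex
  assumes z: "z ^ 2 ^ k = -1" "ieval f z = 0"
  shows "Phi k dvd f"
proof -
  have "\<exists>p. p \<noteq> 0 \<and> ieval p z = 0"
    using z by (intro exI[of _ "Phi k"]) simp
  then obtain p0 where p0: "p0 \<noteq> 0 \<and> ieval p0 z = 0"
      and p0min: "\<And>q. q \<noteq> 0 \<and> ieval q z = 0 \<Longrightarrow> degree p0 \<le> degree q"
    using exists_least_iff[of "\<lambda>n. \<exists>p. p \<noteq> 0 \<and> ieval p z = 0 \<and> degree p = n"]
    by (metis not_less)
  define p where "p = primitive_part p0"
  have p_nz: "p \<noteq> 0" using p0 by (simp add: p_def)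
  have cp: "content p = 1" using p0 by (simp add: p_def)
  have "ieval p0 z = of_int (content p0) * ieval p z"
    by (metis content_times_primitive_part ieval_smult p_def)
  moreover have "content p0 \<noteq> 0" using p0 by simp
  ultimately have pz: "ieval p z = 0" using p0 by (metis mult_eq_0_iff of_int_eq_0_iff)
  have pmin: "degree p \<le> degree q" if "q \<noteq> 0" "ieval q z = 0" for q
    using p0min[of q] that by (simp add: p_def)
  obtain c g where c: "c \<noteq> 0" and cg: "smult c (Phi k) = p * g"
  proof -
    obtain q r where qr: "pseudo_divmod (Phi k) p = (q, r)" by force
    let ?c = "coeff p (degree p) ^ (Suc (degree (Phi k)) - degree p)"
    note pd = pseudo_divmod[OF p_nz qr]
    have "ieval (smult ?c (Phi k)) z = ieval (p * q + r) z" by (simp only: pd(1))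
    then have "ieval r z = 0" using z pz by simp
    with pd(2) pmin[of r] have "r = 0" using leD by blast
    with pd(1) have "smult ?c (Phi k) = p * q" by simp
    moreover have "?c \<noteq> 0" using p_nz by simp
    ultimately show thesis using that by blast
  qed
  have content_Phi: "content (Phi k) = 1"
  proof -
    have "content (Phi k) dvd coeff (Phi k) (2 ^ k)" by (rule content_dvd_coeff)
    then have "is_unit (content (Phi k))" by simp
    then show ?thesis using normalize_content[of "Phi k"] is_unit_normalize by metis
  qed
  have "content (smult c (Phi k)) = content (p * g)" by (simp only: cg)
  then have "content g = \<bar>c\<bar>" by (simp add: content_mult cp content_Phi)
  then have "[:c:] dvd g" by (simp add: const_poly_dvd_iff_dvd_content)
  then obtain h where "g = [:c:] * h" by (auto elim: dvdE)
  then have h: "g = smult c h" by simp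
  have Ph: "Phi k = p * h"
  proof -
    have "smult c (Phi k - p * h) = 0" unfolding smult_diff_right cg h by simp
    then show ?thesis using c by (simp only: smult_eq_0_iff) simp
  qed
  have ev: "even (poly p 1)" using root_imp_even[OF z(1) pz] .
  have deg: "degree h = 0"
  proof (rule ccontr)
    assume "degree h \<noteq> 0"
    then have "degree (map_poly complex_of_int h) \<noteq> 0" by (simp add: degree_map_poly)
    then have "\<not> constant (poly (map_poly complex_of_int h))"
      by (simp add: constant_degree)
    then obtain w :: complex where w: "ieval h w = 0"
      unfolding ieval_def using fundamental_theorem_of_algebra by blast
    have "ieval (Phi k) w = 0" unfolding Ph using w by simp
    then have "w ^ 2 ^ k = -1" by (simp add: eq_neg_iff_add_eq_0)
    with w have "even (poly h 1)" using root_imp_even by blast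
    with ev have "2 * 2 dvd poly p 1 * poly h 1" by (intro mult_dvd_mono)
    then have "4 dvd poly (Phi k) 1" unfolding Ph by simp
    then show False by (simp add: Phi_def poly_monom)
  qed
  have dp: "degree p = 2 ^ k"
  proof -
    have "degree (Phi k) = degree p + degree h" unfolding Ph
      using p_nz by (metis Phi_nonzero Ph degree_mult_eq mult_not_zero)
    then show ?thesis using deg by simp
  qed
  obtain q r where qr: "pseudo_divmod f (Phi k) = (q, r)" by force
  note pd = pseudo_divmod[OF Phi_nonzero qr]
  have f: "f = Phi k * q + r" using pd(1) by simp
  have "ieval f z = ieval (Phi k * q + r) z" by (simp only: f)
  then have "ieval r z = 0" using z by simp
  with pd(2) pmin[of r] dp have "r = 0" using leD by fastforce
  with f show ?thesis by simp
qed

text \<open>An element of \<open>\<int>[X]/(Phi k)\<close> that is not zero divides its norm, a nonzero integer.\<close>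
lemma cofactor_nonzero:
  fixes f :: "int poly"
  assumes "\<not> Phi k dvd f"
  obtains g r where "Phi k dvd f * g - [:r:]" "r \<noteq> 0"
  using norm_cofactor[of k f] Phi_dvd_if_root assms by metis

lemma Phi_dvd_imp_zero:
  assumes "Phi k dvd f" "degree f < 2 ^ k"
  shows "f = 0"
  using assms dvd_imp_degree_le[of "Phi k" f] by force

lemma Phi_dvd_imp_conjugate_zero:
  fixes z :: complex
  assumes "Phi k dvd f" "z ^ 2 ^ k = -1"
  shows "ieval f z = 0"
  using assms by (auto elim!: dvdE)

section \<open>Powers of 3 modulo powers of 2\<close>

definition odds :: "nat \<Rightarrow> nat set" where
  "odds m = {b. odd b \<and> b < 2 ^ (m - 1)}"

lemma finite_odds [simp]: "finite (odds m)"
  by (rule finite_subset[of _ "{..<2 ^ (m - 1)}"]) (auto simp: odds_def)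

lemma card_odds:
  assumes "m \<ge> 2"
  shows "card (odds m) = 2 ^ (m - 2)"
proof -
  have "bij_betw (\<lambda>i. 2 * i + 1) {..<2 ^ (m - 2)} (odds m)"
  proof (rule bij_betwI[where g = "\<lambda>b. b div 2"])
    have *: "(2::nat) ^ (m - 1) = 2 * 2 ^ (m - 2)"
    proof -
      have "m - 1 = Suc (m - 2)" using assms by simp
      then show ?thesis by simp
    qed
    show "(\<lambda>i. 2 * i + 1) \<in> {..<2 ^ (m - 2)} \<rightarrow> odds m"
      unfolding odds_def * by auto
    show "(\<lambda>b. b div 2) \<in> odds m \<rightarrow> {..<2 ^ (m - 2)}"
      unfolding odds_def * by auto
  qed (auto simp: odds_def)
  then show ?thesis by (metis bij_betw_same_card card_lessThan)
qed

text \<open>The representative of \<open>\<plusminus>3\<^sup>i\<close> modulo \<open>2\<^sup>m\<close> in the lower half.\<close>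
definition rep3 :: "nat \<Rightarrow> nat \<Rightarrow> nat" where
  "rep3 m i = (let r = 3 ^ i mod 2 ^ m in if r < 2 ^ (m - 1) then r else 2 ^ m - r)"

lemma rep3_cong:
  obtains s q :: int where "s \<in> {1, -1}" "int (rep3 m i) = s * 3 ^ i + q * 2 ^ m"
proof -
  define r where "r = (3::nat) ^ i mod 2 ^ m"
  have "int r = 3 ^ i mod 2 ^ m" by (simp add: r_def zmod_int)
  then have r: "int r = 3 ^ i - (3 ^ i div 2 ^ m) * 2 ^ m"
    by (simp add: minus_div_mult_eq_mod)
  have le: "r \<le> 2 ^ m" by (simp add: r_def less_imp_le)
  show thesis
  proof (cases "r < 2 ^ (m - 1)")
    case True
    then have "int (rep3 m i) = 1 * 3 ^ i + (- (3 ^ i div 2 ^ m)) * 2 ^ m"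
      using r by (simp add: rep3_def Let_def flip: r_def)
    then show thesis using that by blast
  next
    case False
    then have "int (rep3 m i) = 2 ^ m - int r"
      using le by (simp add: rep3_def Let_def of_nat_diff flip: r_def)
    then have "int (rep3 m i) = (-1) * 3 ^ i + (3 ^ i div 2 ^ m + 1) * 2 ^ m"
      using r by (simp add: algebra_simps)
    then show thesis using that by blast
  qed
qed

lemma rep3_in_odds:
  assumes "m \<ge> 2"
  shows "rep3 m i \<in> odds m"
proof -
  obtain s q :: int where sq: "s \<in> {1, -1}" "int (rep3 m i) = s * 3 ^ i + q * 2 ^ m"
    by (rule rep3_cong)
  have "even ((2::int) ^ m)" using assms by simp
  then have "odd (int (rep3 m i))" using sq by auto
  then have o: "odd (rep3 m i)" by simp
  have m: "(2::nat) ^ m = 2 * 2 ^ (m - 1)"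
    using assms by (metis One_nat_def Suc_pred' Suc_1 less_le_trans lessI power_Suc zero_less_Suc)
  have "rep3 m i \<le> 2 ^ (m - 1)"
    using m by (auto simp: rep3_def Let_def)
  moreover have "even ((2::nat) ^ (m - 1))" using assms by simp
  ultimately show ?thesis using o unfolding odds_def
    by (auto simp: le_less)
qed

text \<open>The order of 3 modulo \<open>2\<^sup>m\<close> is \<open>2\<^bsup>m-2\<^esup>\<close>, and the powers of 3 are 1 or 3 modulo 8.\<close>
lemma three_pow_not_pm1:
  assumes "m \<ge> 3" "0 < r" "r < 2 ^ (m - 2)"
  shows "\<not> [(3::int) ^ r = 1] (mod 2 ^ m)" "\<not> [(3::int) ^ r = -1] (mod 2 ^ m)"
proof -
  have ord: "ord (2 ^ m) (3::nat) = 2 ^ (m - 2)"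
    by (rule ord_twopow_3_5) (use assms in auto)
  show "\<not> [(3::int) ^ r = 1] (mod 2 ^ m)"
  proof
    assume "[(3::int) ^ r = 1] (mod 2 ^ m)"
    then have "[int (3 ^ r) = int 1] (mod int (2 ^ m))" by simp
    then have "[3 ^ r = (1::nat)] (mod 2 ^ m)" by (simp only: cong_int_iff)
    then have "ord (2 ^ m) (3::nat) dvd r" by (simp only: ord_divides)
    then show False using ord assms by (auto dest: dvd_imp_le)
  qed
  show "\<not> [(3::int) ^ r = -1] (mod 2 ^ m)"
  proof
    assume "[(3::int) ^ r = -1] (mod 2 ^ m)"
    then have "[(3::int) ^ r = -1] (mod 2 ^ 3)"
      using assms(1) by (meson cong_dvd_modulus le_imp_power_dvd)
    then have c: "(3::int) ^ r mod 8 = 7" by (simp add: cong_def)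
    have "(3::int) ^ k mod 8 = 1 \<or> (3::int) ^ k mod 8 = 3" for k
    proof (induction k)
      case (Suc k)
      have "(3::int) ^ Suc k mod 8 = 3 * (3 ^ k mod 8) mod 8" by (simp add: mod_mult_right_eq)
      then show ?case using Suc by auto
    qed simp
    from this[of r] c show False by linarith
  qed
qed

lemma rep3_inj:
  assumes "m \<ge> 2" "i < 2 ^ (m - 2)" "j < 2 ^ (m - 2)" "rep3 m i = rep3 m j"
  shows "i = j"
proof (cases "m = 2")
  case True
  then show ?thesis using assms by simp
next
  case False
  then have m3: "m \<ge> 3" using assms by simp
  have main: "\<not> i < j" if "i < 2 ^ (m - 2)" "j < 2 ^ (m - 2)" "rep3 m i = rep3 m j" for i j
  proof
    assume ij: "i < j"
    obtain s q :: int where sq: "s \<in> {1, -1}" "int (rep3 m i) = s * 3 ^ i + q * 2 ^ m"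
      by (rule rep3_cong)
    obtain s' q' :: int where sq': "s' \<in> {1, -1}" "int (rep3 m j) = s' * 3 ^ j + q' * 2 ^ m"
      by (rule rep3_cong)
    have "3 ^ i * (s' * 3 ^ (j - i) - s) = 2 ^ m * (q - q')"
    proof -
      have "s' * 3 ^ j - s * 3 ^ i = 2 ^ m * (q - q')"
        using sq sq' that by (simp add: algebra_simps)
      moreover have "(3::int) ^ j = 3 ^ i * 3 ^ (j - i)" using ij by (simp flip: power_add)
      ultimately show ?thesis by (simp add: algebra_simps)
    qed
    then have "2 ^ m dvd 3 ^ i * (s' * 3 ^ (j - i) - s)" by simp
    moreover have "coprime ((2::int) ^ m) (3 ^ i)" by simp
    ultimately have d: "2 ^ m dvd s' * 3 ^ (j - i) - s"
      using coprime_dvd_mult_right_iff by blast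
    have "2 ^ m dvd 3 ^ (j - i) - s' * s"
    proof -
      have "3 ^ (j - i) - s' * s = s' * (s' * 3 ^ (j - i) - s)" using sq' by auto
      then show ?thesis using d by simp
    qed
    then have "[(3::int) ^ (j - i) = s' * s] (mod 2 ^ m)" by (simp add: cong_iff_dvd_diff)
    then have "[(3::int) ^ (j - i) = 1] (mod 2 ^ m) \<or> [(3::int) ^ (j - i) = -1] (mod 2 ^ m)"
      using sq sq' by auto
    then show False using three_pow_not_pm1[OF m3, of "j - i"] ij that by auto
  qed
  show ?thesis using main[of i j] main[of j i] assms by simp
qed

lemma bij_betw_rep3:
  assumes "m \<ge> 2"
  shows "bij_betw (rep3 m) {..<2 ^ (m - 2)} (odds m)"
proof -
  have inj: "inj_on (rep3 m) {..<2 ^ (m - 2)}"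
    using rep3_inj assms by (auto intro: inj_onI)
  have "rep3 m ` {..<2 ^ (m - 2)} \<subseteq> odds m" using rep3_in_odds assms by auto
  moreover have "card (rep3 m ` {..<2 ^ (m - 2)}) = card (odds m)"
    using inj assms by (simp add: card_image card_odds)
  ultimately have "rep3 m ` {..<2 ^ (m - 2)} = odds m" by (intro card_subset_eq) auto
  with inj show ?thesis by (simp add: bij_betw_def)
qed

lemma three_pow_half:
  assumes "n \<ge> 4"
  obtains q :: int where "3 ^ 2 ^ (n - 3) = 1 + 2 ^ (n - 1) + q * 2 ^ n"
proof -
  have "\<exists>q::int. 3 ^ 2 ^ (n - 3) = 1 + 2 ^ (n - 1) + q * 2 ^ n"
    using assms
  proof (induction n rule: nat_induct_at_least)
    case base
    show ?case by (rule exI[of _ 0]) simp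
  next
    case (Suc n)
    then obtain q :: int where q: "3 ^ 2 ^ (n - 3) = 1 + 2 ^ (n - 1) + q * 2 ^ n" by blast
    have e: "2 ^ (Suc n - 3) = 2 ^ (n - 3) * (2::nat)"
    proof -
      have "Suc n - 3 = Suc (n - 3)" using Suc.hyps by simp
      then show ?thesis by simp
    qed
    define p where "p = (2::int) ^ (n - 2)"
    have p: "(2::int) ^ (n - 1) = 2 * p" "(2::int) ^ n = 4 * p" "(2::int) ^ Suc n = 8 * p"
    proof -
      obtain k where "n = k + 2" using Suc.hyps that[of "n - 2"] by simp
      then show "(2::int) ^ (n - 1) = 2 * p" "(2::int) ^ n = 4 * p" "(2::int) ^ Suc n = 8 * p"
        by (simp_all add: p_def)
    qed
    have "even p" using Suc.hyps by (simp add: p_def)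
    then obtain p' where p': "p = 2 * p'" by blast
    have "(3::int) ^ 2 ^ (Suc n - 3) = (1 + 2 * p + q * (4 * p))\<^sup>2"
      unfolding e power_mult q p ..
    also have "\<dots> = 1 + 4 * p + (q + p' * (1 + 2 * q)^2) * (8 * p)"
      by (simp add: p' power2_eq_square algebra_simps)
    finally have "(3::int) ^ 2 ^ (Suc n - 3) = 1 + 2 ^ (Suc n - 1) + (q + p' * (1 + 2 * q)^2) * 2 ^ Suc n"
      using p by simp
    then show ?case by blast
  qed
  then show thesis using that by blast
qed

section \<open>The real units \<open>d\<^sub>j\<close>\<close>

lemma alpha_neq_0 [simp]: "alpha n \<noteq> 0"
  by (simp add: alpha_def)

lemma alpha_pow_int: "alpha n ^ k = exp (2 * of_real pi * \<i> * of_nat k / 2 ^ n)"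
  by (simp add: alpha_def exp_of_nat_mult[symmetric] field_simps)

lemma alpha_pow_full [simp]: "alpha n ^ 2 ^ n = 1"
  by (simp add: alpha_pow_int mult.commute)

lemma alpha_pow_half:
  assumes "n \<ge> 1"
  shows "alpha n ^ 2 ^ (n - 1) = -1"
proof -
  have "(2::complex) ^ n = 2 * 2 ^ (n - 1)"
    using assms by (metis One_nat_def Suc_pred less_le_trans power_Suc zero_less_one)
  then have "alpha n ^ 2 ^ (n - 1) = exp (of_real pi * \<i>)"
    by (simp add: alpha_pow_int)
  then show ?thesis by simp
qed

lemma alpha_square:
  assumes "n \<ge> 1"
  shows "alpha n ^ 2 = alpha (n - 1)"
proof -
  have "(2::complex) ^ n = 2 * 2 ^ (n - 1)"
    using assms by (metis One_nat_def Suc_pred less_le_trans power_Suc zero_less_one)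
  then show ?thesis by (simp only: alpha_pow_int) (simp add: alpha_def algebra_simps)
qed

lemma alpha_powi_period: "alpha n powi (j + q * 2 ^ n) = alpha n powi j"
proof -
  have "alpha n powi (q * 2 ^ n) = (alpha n powi (int (2 ^ n))) powi q"
    by (metis mult.commute of_nat_numeral of_nat_power power_int_mult)
  also have "\<dots> = 1" by (simp only: power_int_of_nat alpha_pow_full power_int_1_left)
  finally show ?thesis by (simp add: power_int_add)
qed

lemma alpha_powi_half:
  assumes "n \<ge> 1"
  shows "alpha n powi (j + 2 ^ (n - 1)) = - (alpha n powi j)"
proof -
  have "alpha n powi (2 ^ (n - 1)) = alpha n powi (int (2 ^ (n - 1)))" by simp
  also have "\<dots> = -1" by (simp only: power_int_of_nat alpha_pow_half[OF assms])
  finally show ?thesis by (simp add: power_int_add)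
qed

lemma d_el_minus [simp]: "d_el n (- j) = d_el n j"
  by (simp add: d_el_def)

lemma d_el_period: "d_el n (j + q * 2 ^ n) = d_el n j"
  using alpha_powi_period[of n j q] alpha_powi_period[of n "-j" "-q"]
  by (simp add: d_el_def)

lemma d_el_cong:
  assumes "s \<in> {1, -1}" "j' = s * j + q * 2 ^ n"
  shows "d_el n j' = d_el n j"
  using assms d_el_period[of n j q] d_el_period[of n "-j" q] by auto

lemma d_el_half_shift:
  assumes "n \<ge> 1"
  shows "d_el n (j + 2 ^ (n - 1)) = 1 - (alpha n powi j + alpha n powi (- j))"
proof -
  have "alpha n powi (- (j + 2 ^ (n - 1))) = - (alpha n powi (- j))"
    using alpha_powi_half[OF assms, of "- j - 2 ^ (n - 1)"] by (simp add: algebra_simps)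
  then show ?thesis using alpha_powi_half[OF assms, of j] by (simp add: d_el_def)
qed

text \<open>A zero of \<open>1 + w + 1/w\<close> is a primitive third root of unity, and 3 is prime to \<open>2\<^sup>n\<close>.\<close>
lemma one_plus_root_plus_inverse_nonzero:
  fixes w :: complex
  assumes "w ^ 2 ^ n = 1" "w \<noteq> 0"
  shows "1 + w + inverse w \<noteq> 0"
proof
  assume "1 + w + inverse w = 0"
  then have "w * (1 + w + inverse w) = 0" by simp
  then have "w ^ 2 + w + 1 = 0" using assms(2)
    by (simp add: algebra_simps power2_eq_square)
  then have *: "w ^ 2 = - w - 1" by (simp add: eq_neg_iff_add_eq_0 algebra_simps)
  have c: "w ^ 3 = 1"
  proof -
    have "w ^ 3 = w * w ^ 2" by (simp add: power3_eq_cube power2_eq_square)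
    also have "\<dots> = w * (- w - 1)" by (simp only: *)
    also have "\<dots> = - (w ^ 2) - w" by (simp add: algebra_simps power2_eq_square)
    also have "\<dots> = - (- w - 1) - w" by (simp only: *)
    finally show ?thesis by simp
  qed
  have "coprime (3::nat) (2 ^ n)" by simp
  then obtain x y :: nat where xy: "3 * x = 2 ^ n * y + 1"
  proof (cases "n = 0")
    case True
    then show thesis using that[of 1 2] by simp
  next
    case False
    then show thesis using coprime_bezout_strong[of 3 "2 ^ n"] that by fastforce
  qed
  have "w ^ (3 * x) = 1" by (simp add: power_mult c)
  moreover have "w ^ (2 ^ n * y + 1) = w" by (simp add: power_add power_mult assms)
  ultimately have "w = 1" using xy by simp
  then show False using * by simp
qed

lemma d_el_nonzero [simp]: "d_el n j \<noteq> 0"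
proof -
  have "(alpha n powi j) ^ 2 ^ n = (alpha n ^ 2 ^ n) powi j"
    by (metis mult.commute power_int_mult power_int_of_nat)
  then have "(alpha n powi j) ^ 2 ^ n = 1" by simp
  from one_plus_root_plus_inverse_nonzero[OF this] show ?thesis
    by (simp add: d_el_def power_int_minus)
qed

lemma d_el_double: "d_el n j * (1 - (alpha n powi j + alpha n powi (- j))) = - d_el n (2 * j)"
proof -
  define w where "w = alpha n powi j"
  define v where "v = alpha n powi (- j)"
  have wv: "w * v = 1" by (simp add: w_def v_def power_int_minus)
  have "alpha n powi (2 * j) = w * w" "alpha n powi (- (2 * j)) = v * v"
    by (simp_all add: w_def v_def flip: power_int_add)
  then show ?thesis
    using wv unfolding d_el_def w_def[symmetric] v_def[symmetric] by (simp add: algebra_simps)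
qed

text \<open>Together with the preceding identity this says that the norm of \<open>d\<^sub>j\<close> to the next real
  subfield of the tower is \<open>- d\<^sub>j\<close> of that subfield.\<close>
lemma d_el_lower:
  assumes "n \<ge> 1"
  shows "d_el n (2 * j) = d_el (n - 1) j"
  by (simp add: d_el_def power_int_mult[of _ 2] alpha_square[OF assms] flip: mult_minus_right)

text \<open>The logarithm at the conjugate of \<open>d\<^sub>1\<close> under the \<open>i\<close>-th power of \<open>\<alpha> \<mapsto> \<alpha>\<^sup>3\<close>, which generates the
  Galois group of the real subfield.\<close>
definition log_unit :: "nat \<Rightarrow> nat \<Rightarrow> real" where
  "log_unit n i = ln (cmod (d_el n (3 ^ i)))"

text \<open>Modulo \<open>2\<^sup>n\<close> the power of 3 to half a period is \<open>1 + 2\<^bsup>n-1\<^esup>\<close> up to sign, so the shift replaces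
  \<open>\<alpha>\<close> by \<open>- \<alpha>\<close> up to inversion.\<close>
lemma d_el_half_period:
  assumes "n \<ge> 3"
  shows "d_el n (3 ^ (i + 2 ^ (n - 3))) = 1 - (alpha n powi (3 ^ i) + alpha n powi (- (3 ^ i)))"
proof -
  obtain p where p: "(3::int) ^ i = 2 * p + 1"
    by (metis oddE odd_numeral even_power)
  have two: "(2::int) ^ n = 2 * 2 ^ (n - 1)"
    using assms by (metis One_nat_def Suc_pred gr0I not_numeral_le_zero power_Suc)
  have "\<exists>s q. s \<in> {1, -1::int} \<and> 3 ^ (i + 2 ^ (n - 3)) = s * (3 ^ i + 2 ^ (n - 1)) + q * 2 ^ n"
  proof (cases "n = 3")
    case True
    have "3 ^ (i + 2 ^ (n - 3)) = (-1) * (3 ^ i + 2 ^ (n - 1)) + (p + 1) * (2::int) ^ n"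
      using True p by simp
    then show ?thesis by blast
  next
    case False
    then have "n \<ge> 4" using assms by simp
    then obtain q :: int where q: "3 ^ 2 ^ (n - 3) = 1 + 2 ^ (n - 1) + q * 2 ^ n"
      by (rule three_pow_half)
    have "3 ^ (i + 2 ^ (n - 3)) = 3 ^ i * (1 + 2 ^ (n - 1) + q * (2::int) ^ n)"
      by (simp add: power_add q)
    also have "\<dots> = 1 * (3 ^ i + 2 ^ (n - 1)) + (p + 3 ^ i * q) * 2 ^ n"
      by (simp add: p two algebra_simps)
    finally show ?thesis by blast
  qed
  then obtain s q where "s \<in> {1, -1::int}" "3 ^ (i + 2 ^ (n - 3)) = s * (3 ^ i + 2 ^ (n - 1)) + q * (2::int) ^ n"
    by blast
  then have "d_el n (3 ^ (i + 2 ^ (n - 3))) = d_el n (3 ^ i + 2 ^ (n - 1))" by (rule d_el_cong)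
  also have "\<dots> = 1 - (alpha n powi (3 ^ i) + alpha n powi (- (3 ^ i)))"
    by (rule d_el_half_shift) (use assms in simp)
  finally show ?thesis .
qed

lemma log_unit_norm:
  assumes "n \<ge> 3"
  shows "log_unit n i + log_unit n (i + 2 ^ (n - 3)) = log_unit (n - 1) i"
proof -
  have "d_el n (3 ^ i) * d_el n (3 ^ (i + 2 ^ (n - 3))) = - d_el (n - 1) (3 ^ i)"
    unfolding d_el_half_period[OF assms] d_el_double using assms by (simp add: d_el_lower)
  then have "cmod (d_el n (3 ^ i)) * cmod (d_el n (3 ^ (i + 2 ^ (n - 3)))) = cmod (d_el (n - 1) (3 ^ i))"
    by (metis norm_minus_cancel norm_mult)
  moreover have "cmod (d_el n (3 ^ i)) > 0" "cmod (d_el n (3 ^ (i + 2 ^ (n - 3)))) > 0"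
    by simp_all
  ultimately show ?thesis
    unfolding log_unit_def by (metis ln_mult_pos)
qed

lemma log_unit_period:
  assumes "n \<ge> 2"
  shows "log_unit n (i + 2 ^ (n - 2)) = log_unit n i"
  using assms
proof (induction n arbitrary: i rule: nat_induct_at_least)
  case base
  have "d_el 2 (3 ^ (i + 2 ^ (2 - 2))) = d_el 2 (3 ^ i)"
  proof (rule d_el_cong)
    show "3 ^ (i + 2 ^ (2 - 2)) = (-1) * 3 ^ i + 3 ^ i * (2::int) ^ 2" by simp
  qed simp
  then show ?case by (simp add: log_unit_def)
next
  case (Suc n)
  have 3: "3 \<le> Suc n" using Suc.hyps by simp
  have "Suc n - 2 = Suc (Suc n - 3)" using Suc.hyps by simp
  then have "i + 2 ^ (Suc n - 2) = (i + 2 ^ (Suc n - 3)) + 2 ^ (Suc n - 3)" by simp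
  moreover have "Suc n - 3 = n - 2" by simp
  then have "log_unit n (i + 2 ^ (Suc n - 3)) = log_unit n i"
    using Suc.IH[of i] by simp
  ultimately show ?case
    using log_unit_norm[OF 3, of i] log_unit_norm[OF 3, of "i + 2 ^ (Suc n - 3)"]
    by (simp add: add.assoc)
qed

text \<open>The two units are \<open>1 + 2 c\<close> and \<open>1 - 2 c\<close> with \<open>c = cos (2 \<pi> / 2\<^sup>n) > 0\<close>.\<close>
lemma log_unit_neq:
  assumes "n \<ge> 3"
  shows "log_unit n 0 \<noteq> log_unit n (2 ^ (n - 3))"
proof
  assume eq: "log_unit n 0 = log_unit n (2 ^ (n - 3))"
  define c where "c = cos (2 * pi / 2 ^ n)"
  have a: "alpha n = cis (2 * pi / 2 ^ n)"
    by (simp add: alpha_def cis_conv_exp mult.commute)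
  have s: "alpha n powi 1 + alpha n powi (- 1) = of_real (2 * c)"
    by (simp add: a power_int_minus cis_inverse c_def complex_eq_iff)
  have "(2::real) ^ 3 \<le> 2 ^ n" using assms by (intro power_increasing) auto
  then have "2 * pi / 2 ^ n < pi / 2" by (simp add: field_simps)
  moreover have "2 * pi / 2 ^ n > 0" by simp
  ultimately have c: "c > 0" unfolding c_def by (intro cos_gt_zero) auto
  have d0: "d_el n 1 = of_real (1 + 2 * c)" using s by (simp add: d_el_def add.assoc)
  have "d_el n (3 ^ (0 + 2 ^ (n - 3))) = 1 - (alpha n powi (3 ^ 0) + alpha n powi (- (3 ^ 0)))"
    by (rule d_el_half_period[OF assms])
  then have d1: "d_el n (3 ^ 2 ^ (n - 3)) = of_real (1 - 2 * c)" using s by simp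
  have "cmod (d_el n 1) > 0" "cmod (d_el n (3 ^ 2 ^ (n - 3))) > 0" by simp_all
  with eq have "cmod (d_el n 1) = cmod (d_el n (3 ^ 2 ^ (n - 3)))"
    by (simp add: log_unit_def)
  then have "\<bar>1 + 2 * c\<bar> = \<bar>1 - 2 * c\<bar>" unfolding d0 d1 by (simp only: norm_of_real)
  then show False using c by linarith
qed

section \<open>Multiplicative independence of the units \<open>d\<^sub>j\<close>\<close>

text \<open>Polynomials act on sequences through the shift; this is the entry at 0 of \<open>p(shift) y\<close>.\<close>
definition seq_eval :: "(nat \<Rightarrow> real) \<Rightarrow> int poly \<Rightarrow> real" where
  "seq_eval y p = (\<Sum>i\<le>degree p. of_int (coeff p i) * y i)"

lemma seq_eval_altdef:
  assumes "degree p \<le> N"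
  shows "seq_eval y p = (\<Sum>i\<le>N. of_int (coeff p i) * y i)"
  unfolding seq_eval_def
  by (rule sum.mono_neutral_left) (use assms in \<open>auto simp: coeff_eq_0\<close>)

lemma seq_eval_add [simp]: "seq_eval y (p + q) = seq_eval y p + seq_eval y q"
proof -
  define N where "N = max (degree p) (degree q)"
  have "degree (p + q) \<le> N" by (simp add: N_def degree_add_le_max)
  then show ?thesis
    by (simp add: seq_eval_altdef[of _ N] N_def algebra_simps sum.distrib)
qed

lemma seq_eval_0 [simp]: "seq_eval y 0 = 0"
  by (simp add: seq_eval_def)

lemma seq_eval_sum [simp]: "seq_eval y (sum f A) = (\<Sum>x\<in>A. seq_eval y (f x))"
  by (induction A rule: infinite_finite_induct) simp_all

lemma seq_eval_monom [simp]: "seq_eval y (monom c k) = of_int c * y k"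
proof -
  have "seq_eval y (monom c k) = (\<Sum>i\<le>k. of_int (coeff (monom c k) i) * y i)"
    by (rule seq_eval_altdef) (rule degree_monom_le)
  also have "\<dots> = (\<Sum>i\<le>k. if i = k then of_int c * y k else 0)"
    by (intro sum.cong) auto
  finally show ?thesis by simp
qed

lemma seq_eval_mult_monom:
  "seq_eval y (p * monom c s) = of_int c * (\<Sum>i\<le>degree p. of_int (coeff p i) * y (i + s))"
proof -
  have "p * monom c s = (\<Sum>i\<le>degree p. monom (coeff p i) i) * monom c s"
    by (simp add: poly_as_sum_of_monoms)
  also have "\<dots> = (\<Sum>i\<le>degree p. monom (coeff p i * c) (i + s))"
    by (simp add: sum_distrib_right mult_monom)
  finally show ?thesis
    by (simp add: sum_distrib_left algebra_simps)
qed

lemma seq_eval_mult_eq_0: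
  assumes "\<And>s. (\<Sum>i\<le>degree p. of_int (coeff p i) * y (i + s)) = 0"
  shows "seq_eval y (p * q) = 0"
proof -
  have "p * q = p * (\<Sum>i\<le>degree q. monom (coeff q i) i)"
    by (simp add: poly_as_sum_of_monoms)
  then show ?thesis
    by (simp only: sum_distrib_left seq_eval_sum seq_eval_mult_monom assms) simp
qed

text \<open>The shift acts on negacyclic sequences through \<open>\<int>[X]/(X\<^sup>m + 1)\<close> with \<open>m = 2\<^sup>k\<close>, an
  order of a field, in which a nonzero element divides a nonzero integer.  So no nonzero
  element annihilates a nonzero sequence.\<close>
lemma negacyclic_annihilator:
  fixes e :: "nat \<Rightarrow> int" and y :: "nat \<Rightarrow> real"
  assumes nega: "\<And>i. y (i + 2 ^ k) = - y i"
    and ann: "\<And>s. (\<Sum>i<2 ^ k. of_int (e i) * y (i + s)) = 0"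
    and y0: "y 0 \<noteq> 0" and i: "i < 2 ^ k"
  shows "e i = 0"
proof (rule ccontr)
  assume ei: "e i \<noteq> 0"
  define f where "f = (\<Sum>i<2 ^ k. monom (e i) i)"
  have cf: "coeff f j = (if j < 2 ^ k then e j else 0)" for j
    by (simp add: f_def coeff_sum)
  have "degree f \<le> 2 ^ k - 1"
    by (rule degree_le) (auto simp: cf)
  then have df: "degree f < 2 ^ k"
    by (rule le_less_trans) simp
  have "f \<noteq> 0" using cf[of i] ei i by auto
  then have "\<not> Phi k dvd f" using df Phi_dvd_imp_zero by blast
  then obtain g r where gr: "Phi k dvd f * g - [:r:]" "r \<noteq> 0"
    by (rule cofactor_nonzero)
  then obtain q where "f * g - [:r:] = Phi k * q" by (auto elim: dvdE)
  then have q: "f * g = monom r 0 + Phi k * q" by (simp add: algebra_simps monom_0)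
  have sf: "(\<Sum>i\<le>degree f. of_int (coeff f i) * y (i + s)) = 0" for s
  proof -
    have "(\<Sum>i\<le>degree f. of_int (coeff f i) * y (i + s)) = (\<Sum>i<2 ^ k. of_int (coeff f i) * y (i + s))"
      by (rule sum.mono_neutral_left) (use df in \<open>auto simp: coeff_eq_0\<close>)
    also have "\<dots> = (\<Sum>i<2 ^ k. of_int (e i) * y (i + s))"
      by (intro sum.cong) (auto simp: cf)
    finally show ?thesis by (simp add: ann)
  qed
  have sP: "(\<Sum>i\<le>degree (Phi k). of_int (coeff (Phi k) i) * y (i + s)) = 0" for s
  proof -
    have "seq_eval y (Phi k * monom 1 s) = seq_eval y (monom 1 (2 ^ k + s) + monom 1 s)"
      by (simp add: Phi_def algebra_simps mult_monom)
    also have "\<dots> = 0" using nega[of s] by (simp add: add.commute)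
    finally show ?thesis by (simp only: seq_eval_mult_monom)
  qed
  have "seq_eval y (f * g) = seq_eval y (monom r 0) + seq_eval y (Phi k * q)"
    by (simp only: q seq_eval_add)
  then have "of_int r * y 0 = 0"
    using seq_eval_mult_eq_0[OF sf] seq_eval_mult_eq_0[OF sP] by simp
  then show False using gr y0 by simp
qed

text \<open>Induction over the tower of real subfields.  Sums over half periods of \<open>c\<close> give a relation
  one level below, because the norm of \<open>d\<^sub>j\<close> is \<open>- d\<^sub>j\<close> there; differences over half periods
  annihilate a negacyclic sequence that does not vanish.\<close>
lemma log_unit_relation_const:
  fixes c :: "nat \<Rightarrow> int"
  assumes "n \<ge> 2" "\<And>s. (\<Sum>i<2 ^ (n - 2). of_int (c i) * log_unit n (i + s)) = 0"
    and "i < 2 ^ (n - 2)"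
  shows "c i = c 0"
  using assms
proof (induction n arbitrary: c i rule: nat_induct_at_least)
  case base
  then show ?case by simp
next
  case (Suc n)
  define m where "m = (2::nat) ^ (n - 2)"
  have n3: "Suc n \<ge> 3" using Suc.hyps by simp
  have sn: "Suc n - 3 = n - 2" by simp
  have two: "(2::nat) ^ (Suc n - 2) = m + m"
  proof -
    have "Suc n - 2 = Suc (n - 2)" using Suc.hyps by simp
    then show ?thesis by (simp add: m_def)
  qed
  let ?x = "log_unit (Suc n)"
  have split: "(\<Sum>i<m + m. f i) = (\<Sum>i<m. f i) + (\<Sum>i<m. f (i + m))" for f :: "nat \<Rightarrow> real"
  proof -
    have "(\<Sum>i<m + k. f i) = (\<Sum>i<m. f i) + (\<Sum>i<k. f (i + m))" for k
      by (induction k) (simp_all add: add.commute)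
    then show ?thesis .
  qed
  have norm: "?x j + ?x (j + m) = log_unit n j" for j
    using log_unit_norm[OF n3, of j] by (simp add: sn m_def)
  have per: "?x (j + m + m) = ?x j" for j
    using log_unit_period[of "Suc n" j] Suc.hyps two by (simp add: add.assoc)
  have rel: "(\<Sum>i<m. of_int (c i) * ?x (i + s) + of_int (c (i + m)) * ?x (i + m + s)) = 0" for s
    using Suc.prems(1)[of s] unfolding two split by (simp add: sum.distrib)
  have rel': "(\<Sum>i<m. of_int (c i) * ?x (i + m + s) + of_int (c (i + m)) * ?x (i + s)) = 0" for s
  proof -
    have "(\<Sum>i<m. of_int (c i) * ?x (i + m + s) + of_int (c (i + m)) * ?x (i + s))
       = (\<Sum>i<m. of_int (c i) * ?x (i + (s + m)) + of_int (c (i + m)) * ?x (i + m + (s + m)))"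
    proof (intro sum.cong refl)
      fix i
      have "?x (i + m + (s + m)) = ?x (i + s)" using per[of "i + s"] by (simp add: algebra_simps)
      then show "of_int (c i) * ?x (i + m + s) + of_int (c (i + m)) * ?x (i + s)
        = of_int (c i) * ?x (i + (s + m)) + of_int (c (i + m)) * ?x (i + m + (s + m))"
        by (simp add: algebra_simps)
    qed
    then show ?thesis using rel[of "s + m"] by simp
  qed
  have plus: "c j + c (j + m) = c 0 + c (0 + m)" if "j < m" for j
  proof (rule Suc.IH[of "\<lambda>i. c i + c (i + m)", folded m_def])
    fix s
    have "(\<Sum>i<m. of_int (c i + c (i + m)) * log_unit n (i + s))
      = (\<Sum>i<m. of_int (c i) * ?x (i + s) + of_int (c (i + m)) * ?x (i + m + s))
      + (\<Sum>i<m. of_int (c i) * ?x (i + m + s) + of_int (c (i + m)) * ?x (i + s))"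
      unfolding sum.distrib[symmetric]
    proof (intro sum.cong refl)
      fix i
      show "of_int (c i + c (i + m)) * log_unit n (i + s) =
         of_int (c i) * ?x (i + s) + of_int (c (i + m)) * ?x (i + m + s) +
         (of_int (c i) * ?x (i + m + s) + of_int (c (i + m)) * ?x (i + s))"
        by (simp add: norm[symmetric] algebra_simps)
    qed
    then show "(\<Sum>i<m. of_int (c i + c (i + m)) * log_unit n (i + s)) = 0"
      by (simp only: rel rel')
  qed (use that in auto)
  have minus: "c j - c (j + m) = 0" if "j < m" for j
  proof (rule negacyclic_annihilator[where y = "\<lambda>i. ?x i - ?x (i + m)" and k = "n - 2"
        and e = "\<lambda>i. c i - c (i + m)", folded m_def])
    show "?x (i + m) - ?x (i + m + m) = - (?x i - ?x (i + m))" for i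
      by (simp add: per)
    fix s
    have "(\<Sum>i<m. of_int (c i - c (i + m)) * (?x (i + s) - ?x (i + s + m)))
      = (\<Sum>i<m. of_int (c i) * ?x (i + s) + of_int (c (i + m)) * ?x (i + m + s))
      - (\<Sum>i<m. of_int (c i) * ?x (i + m + s) + of_int (c (i + m)) * ?x (i + s))"
      unfolding sum_subtractf[symmetric]
      by (intro sum.cong refl) (simp add: algebra_simps)
    then show "(\<Sum>i<m. of_int (c i - c (i + m)) * (?x (i + s) - ?x (i + s + m))) = 0"
      by (simp only: rel rel')
  next
    show "?x 0 - ?x (0 + m) \<noteq> 0"
      using log_unit_neq[OF n3] by (simp add: sn m_def)
  qed (use that in auto)
  have half: "c j = c 0 \<and> c (j + m) = c 0" if "j < m" for j
  proof -
    have "0 < m" using that by simp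
    then show ?thesis using plus[OF that] minus[OF that] minus[of 0] by simp
  qed
  have "i < m + m" using Suc.prems(2) two by simp
  then show ?case
    using half[of i] half[of "i - m"] by (cases "i < m") auto
qed

subsection \<open>Dickson polynomials\<close>

text \<open>\<open>dick b\<close> is the polynomial with \<open>dick b (z + 1/z) = z\<^sup>b + 1/z\<^sup>b\<close>.\<close>
fun dick :: "nat \<Rightarrow> int poly" where
  "dick 0 = 2"
| "dick (Suc 0) = monom 1 1"
| "dick (Suc (Suc b)) = monom 1 1 * dick (Suc b) - dick b"

lemma ieval_dick_unit:
  assumes "z * w = (1::'a::comm_ring_1)"
  shows "ieval (dick b) (z + w) = z ^ b + w ^ b"
proof (induction b rule: dick.induct)
  case (3 b)
  have "(z + w) * (z ^ Suc b + w ^ Suc b) = z ^ Suc (Suc b) + w ^ Suc (Suc b) + (z * w) * (z ^ b + w ^ b)"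
    by (simp add: algebra_simps)
  then have "(z + w) * (z ^ Suc b + w ^ Suc b) - (z ^ b + w ^ b) = z ^ Suc (Suc b) + w ^ Suc (Suc b)"
    using assms by simp
  then show ?case using 3 by simp
qed simp_all

definition tau :: "nat \<Rightarrow> complex" where
  "tau n = alpha n + inverse (alpha n)"

lemma ieval_dick_powi:
  fixes z :: complex
  assumes "z \<noteq> 0"
  shows "ieval (dick b) (z + inverse z) = z powi int b + z powi (- int b)"
  using ieval_dick_unit[of z "inverse z" b] assms
  by (simp add: power_int_minus power_inverse)

lemma d_el_dick: "d_el n (int t * int b) = 1 + ieval (dick b) (alpha n ^ t + inverse (alpha n ^ t))"
proof -
  have "alpha n powi (int t * int b) = (alpha n ^ t) powi int b"
    "alpha n powi (- (int t * int b)) = (alpha n ^ t) powi (- int b)"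
    by (simp_all only: power_int_mult power_int_of_nat flip: mult_minus_right)
  then show ?thesis
    by (simp add: d_el_def ieval_dick_powi del: power_int_of_nat)
qed

lemma d_el_tau: "d_el n (int b) = 1 + ieval (dick b) (tau n)"
  using d_el_dick[of n 1 b] by (simp add: tau_def)

lemma root_pow_inverse:
  fixes z :: complex
  assumes "z ^ 2 ^ n = 1"
  shows "z ^ (2 ^ n - 1) = inverse z"
proof -
  have "z * z ^ (2 ^ n - 1) = z ^ 2 ^ n"
    by (metis power_minus_mult mult.commute zero_less_numeral zero_less_power)
  then show ?thesis using assms by (metis inverse_unique)
qed

text \<open>With \<open>1/\<alpha>\<close> written as a power of \<open>\<alpha>\<close>, \<open>f(\<tau>)\<close> becomes a polynomial in \<open>\<alpha>\<close>, hence divisible by the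
  minimal polynomial, of which \<open>\<alpha>\<^sup>t\<close> is a root as well.\<close>
lemma relation_conjugate:
  assumes "n \<ge> 1" "odd t" "ieval f (tau n) = 0"
  shows "ieval f (alpha n ^ t + inverse (alpha n ^ t)) = 0"
proof -
  define p where "p = f \<circ>\<^sub>p (monom 1 1 + monom 1 (2 ^ n - 1))"
  have p: "ieval p z = ieval f (z + inverse z)" if "z ^ 2 ^ n = 1" for z :: complex
    using root_pow_inverse[OF that] by (simp add: p_def)
  have "ieval p (alpha n) = 0" using p[of "alpha n"] assms(3) by (simp add: tau_def)
  then have "Phi (n - 1) dvd p"
    using Phi_dvd_if_root alpha_pow_half[OF assms(1)] by blast
  moreover have "(alpha n ^ t) ^ 2 ^ (n - 1) = -1"
  proof -
    have "(alpha n ^ t) ^ 2 ^ (n - 1) = (alpha n ^ 2 ^ (n - 1)) ^ t"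
      by (simp flip: power_mult add: mult.commute)
    then show ?thesis using alpha_pow_half[OF assms(1)] assms(2) by simp
  qed
  ultimately have "ieval p (alpha n ^ t) = 0" by (rule Phi_dvd_imp_conjugate_zero)
  moreover have "(alpha n ^ t) ^ 2 ^ n = 1"
    by (metis alpha_pow_full mult.commute power_mult power_one)
  ultimately show ?thesis using p by simp
qed

text \<open>Relations with integer exponents are turned into equations between polynomial expressions.\<close>
lemma prod_powi_split:
  fixes x :: "'a \<Rightarrow> 'b::field"
  assumes "\<And>j. j \<in> J \<Longrightarrow> x j \<noteq> 0"
  shows "(\<Prod>j\<in>J. x j powi a j) * (\<Prod>j\<in>J. x j ^ nat (- a j)) = (\<Prod>j\<in>J. x j ^ nat (a j))"
  unfolding prod.distrib[symmetric]
proof (intro prod.cong refl)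
  fix j assume "j \<in> J"
  then show "x j powi a j * x j ^ nat (- a j) = x j ^ nat (a j)"
    using assms by (cases "a j \<ge> 0") (simp_all add: power_int_def power_inverse)
qed

lemma prod_powi_eq_1_iff:
  fixes x :: "'a \<Rightarrow> 'b::field"
  assumes "finite J" "\<And>j. j \<in> J \<Longrightarrow> x j \<noteq> 0"
  shows "(\<Prod>j\<in>J. x j powi a j) = 1 \<longleftrightarrow> (\<Prod>j\<in>J. x j ^ nat (a j)) = (\<Prod>j\<in>J. x j ^ nat (- a j))"
proof -
  have cancel: "p = 1 \<longleftrightarrow> r = q" if "q \<noteq> 0" "p * q = r" for p q r :: 'b
    using that by auto
  have "(\<Prod>j\<in>J. x j ^ nat (- a j)) \<noteq> 0"
    using assms by (simp add: prod_zero_iff)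
  then show ?thesis by (rule cancel) (rule prod_powi_split[OF assms(2)])
qed

lemma d_el_relation_conjugate:
  fixes a :: "nat \<Rightarrow> int"
  assumes n: "n \<ge> 1" and J: "finite J" and t: "odd t"
    and rel: "(\<Prod>j\<in>J. d_el n (int j) powi a j) = 1"
  shows "(\<Prod>j\<in>J. d_el n (int t * int j) powi a j) = 1"
proof -
  define P where "P = (\<Prod>j\<in>J. (1 + dick j) ^ nat (a j))"
  define Q where "Q = (\<Prod>j\<in>J. (1 + dick j) ^ nat (- a j))"
  have "ieval (P - Q) (tau n) = 0"
    using rel J by (simp add: prod_powi_eq_1_iff P_def Q_def d_el_tau[symmetric])
  then have "ieval (P - Q) (alpha n ^ t + inverse (alpha n ^ t)) = 0"
    by (rule relation_conjugate[OF n t])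
  then show ?thesis
    using J by (simp add: prod_powi_eq_1_iff P_def Q_def d_el_dick[symmetric])
qed

text \<open>The indices of the generators of \<open>D\<close>.\<close>
definition d_index :: "nat \<Rightarrow> nat set" where
  "d_index n = {b. odd b \<and> b + 3 \<le> 2 ^ (n - 1)}"

lemma finite_d_index [simp]: "finite (d_index n)"
  by (rule finite_subset[of _ "{..2 ^ (n - 1)}"]) (auto simp: d_index_def)

text \<open>The unit \<open>d\<^sub>b\<close> with the largest index is left out: it is determined up to sign by the
  others, because the product of all of them is \<open>\<plusminus>1\<close>.\<close>
lemma odds_eq_insert:
  assumes n: "n \<ge> 2"
  shows "odds n = insert (2 ^ (n - 1) - 1) (d_index n)" "2 ^ (n - 1) - 1 \<notin> d_index n"
    "2 ^ (n - 1) - 1 \<in> odds n"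
proof -
  define top where "top = (2::nat) ^ (n - 1) - 1"
  have ev: "even ((2::nat) ^ (n - 1))" "(2::nat) ^ (n - 1) \<ge> 2"
    using n power_increasing[of 1 "n - 1" "2::nat"] by simp_all
  have top: "top \<in> odds n" "top \<notin> d_index n" using ev by (auto simp: top_def odds_def d_index_def)
  have odds: "odds n = insert top (d_index n)"
  proof -
    have "b = top \<or> b + 3 \<le> 2 ^ (n - 1)" if "odd b" "b < 2 ^ (n - 1)" for b
    proof -
      have "odd top" using top by (simp add: odds_def)
      then have "b + 1 \<noteq> top" using that by auto
      moreover have "odd (b + 2)" using that by simp
      then have "b + 2 \<noteq> 2 ^ (n - 1)" using ev(1) by metis
      ultimately show ?thesis using that by (auto simp: top_def)
    qed
    then show ?thesis using top by (auto simp: odds_def d_index_def)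
  qed
  show "odds n = insert (2 ^ (n - 1) - 1) (d_index n)" "2 ^ (n - 1) - 1 \<notin> d_index n"
    "2 ^ (n - 1) - 1 \<in> odds n"
    using odds top by (simp_all add: top_def)
qed

text \<open>Conjugating a relation by \<open>\<alpha> \<mapsto> \<alpha>\<^bsup>3^s\<^esup>\<close> gives all shifts of the corresponding relation between
  the logarithms, so the exponents are constant, and the exponent of the missing unit is 0.\<close>
theorem d_el_independent:
  fixes a :: "nat \<Rightarrow> int"
  assumes n: "n \<ge> 2" and rel: "(\<Prod>j\<in>d_index n. d_el n (int j) powi a j) = 1"
    and j: "j \<in> d_index n"
  shows "a j = 0"
proof -
  define top where "top = (2::nat) ^ (n - 1) - 1"
  note top = odds_eq_insert[OF n, folded top_def]
  define a' where "a' = a(top := 0)"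
  have rel': "(\<Prod>j\<in>odds n. d_el n (int j) powi a' j) = 1"
  proof -
    have "(\<Prod>j\<in>d_index n. d_el n (int j) powi a' j) = (\<Prod>j\<in>d_index n. d_el n (int j) powi a j)"
      using top by (intro prod.cong) (auto simp: a'_def)
    then show ?thesis using rel top by (simp add: top(1) a'_def)
  qed
  define c where "c i = a' (rep3 n i)" for i
  have "(\<Sum>i<2 ^ (n - 2). of_int (c i) * log_unit n (i + s)) = 0" for s
  proof -
    have "(\<Prod>j\<in>odds n. d_el n (int (3 ^ s) * int j) powi a' j) = 1"
      by (rule d_el_relation_conjugate) (use n rel' in simp_all)
    then have "(\<Prod>j\<in>odds n. cmod (d_el n (3 ^ s * int j)) powi a' j) = 1"
      by (simp add: prod_norm flip: norm_power_int)
    then have "ln (\<Prod>j\<in>odds n. cmod (d_el n (3 ^ s * int j)) powi a' j) = 0" by simp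
    then have "0 = (\<Sum>j\<in>odds n. ln (cmod (d_el n (3 ^ s * int j)) powi a' j))"
      by (subst (asm) ln_prod) (simp_all)
    also have "\<dots> = (\<Sum>j\<in>odds n. of_int (a' j) * ln (cmod (d_el n (3 ^ s * int j))))"
    proof (intro sum.cong refl)
      fix j
      have "ln (x powi k) = of_int k * ln x" if "x > 0" for x :: real and k
        using that by (metis ln_powr less_eq_real_def less_irrefl powr_real_of_int')
      then show "ln (cmod (d_el n (3 ^ s * int j)) powi a' j) = of_int (a' j) * ln (cmod (d_el n (3 ^ s * int j)))"
        by simp
    qed
    also have "\<dots> = (\<Sum>i<2 ^ (n - 2). of_int (a' (rep3 n i)) * ln (cmod (d_el n (3 ^ s * int (rep3 n i)))))"
      using sum.reindex_bij_betw[OF bij_betw_rep3[OF n]] by (rule sym)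
    also have "\<dots> = (\<Sum>i<2 ^ (n - 2). of_int (c i) * log_unit n (i + s))"
    proof (intro sum.cong refl)
      fix i
      obtain e q :: int where eq: "e \<in> {1, -1}" "int (rep3 n i) = e * 3 ^ i + q * 2 ^ n"
        by (rule rep3_cong)
      have "d_el n (3 ^ s * int (rep3 n i)) = d_el n (3 ^ (i + s))"
        by (rule d_el_cong[OF eq(1), of _ _ "3 ^ s * q"]) (simp add: eq power_add algebra_simps)
      then show "of_int (a' (rep3 n i)) * ln (cmod (d_el n (3 ^ s * int (rep3 n i)))) = of_int (c i) * log_unit n (i + s)"
        by (simp add: c_def log_unit_def)
    qed
    finally show ?thesis by simp
  qed
  from log_unit_relation_const[OF n this] have const: "c i = c 0" if "i < 2 ^ (n - 2)" for i
    using that by blast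
  have "a' b = c 0" if "b \<in> odds n" for b
  proof -
    from that bij_betw_rep3[OF n] obtain i where "i < 2 ^ (n - 2)" "b = rep3 n i"
      by (auto simp: bij_betw_def)
    then show ?thesis using const[of i] by (simp add: c_def)
  qed
  from this[of j] this[of top] j top have "a' j = 0" by (auto simp: a'_def)
  then show ?thesis using j top by (auto simp: a'_def split: if_splits)
qed

section \<open>Dickson polynomials over the field with two elements\<close>

lemma bit_fps_double [simp]: "f + f = (0 :: bit fps)"
proof (rule fps_ext)
  fix n
  show "(f + f) $ n = 0 $ n"
    unfolding fps_add_nth by (cases "f $ n") simp_all
qed

lemma bit_fps_minus: "f - g = (f + g :: bit fps)"
  by (rule fps_ext) simp

lemma bit_fps_two [simp]: "2 = (0 :: bit fps)"
  by (metis bit_fps_double one_add_one)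

lemma X_power_dvd_iff: "fps_X ^ N dvd f \<longleftrightarrow> (\<forall>i<N. f $ i = (0::'a::comm_ring_1))"
proof
  assume "fps_X ^ N dvd f"
  then show "\<forall>i<N. f $ i = 0" by (auto elim!: dvdE simp: fps_X_power_mult_nth)
next
  assume *: "\<forall>i<N. f $ i = 0"
  have "f = fps_X ^ N * Abs_fps (\<lambda>i. f $ (i + N))"
    by (rule fps_ext) (use * in \<open>simp add: fps_X_power_mult_nth\<close>)
  then show "fps_X ^ N dvd f" by (rule dvdI)
qed

text \<open>Power series rather than polynomials, so that the reductions of the units can be inverted
  before truncation.\<close>
definition congX :: "nat \<Rightarrow> bit fps \<Rightarrow> bit fps \<Rightarrow> bool" where
  "congX N f g \<longleftrightarrow> fps_X ^ N dvd f - g"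

lemma congX_refl [simp]: "congX N f f"
  by (simp add: congX_def)

lemma congX_sym: "congX N f g \<Longrightarrow> congX N g f"
  by (simp add: congX_def bit_fps_minus add.commute)

lemma congX_trans [trans]: "congX N f g \<Longrightarrow> congX N g h \<Longrightarrow> congX N f h"
  unfolding congX_def using dvd_add[of "fps_X ^ N" "f - g" "g - h"] by simp

lemma congX_mult: "congX N f g \<Longrightarrow> congX N f' g' \<Longrightarrow> congX N (f * f') (g * g')"
proof -
  assume "congX N f g" "congX N f' g'"
  then have "fps_X ^ N dvd f * (f' - g') + (f - g) * g'" by (simp add: congX_def)
  then show ?thesis by (simp add: congX_def algebra_simps)
qed

lemma congX_add: "congX N f g \<Longrightarrow> congX N f' g' \<Longrightarrow> congX N (f + f') (g + g')"
  unfolding congX_def using dvd_add[of "fps_X ^ N" "f - g" "f' - g'"] by (simp add: algebra_simps)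

lemma congX_power: "congX N f g \<Longrightarrow> congX N (f ^ k) (g ^ k)"
  by (induction k) (simp_all add: congX_mult)

lemma congX_prod: "(\<And>x. x \<in> A \<Longrightarrow> congX N (f x) (g x)) \<Longrightarrow> congX N (prod f A) (prod g A)"
  by (induction A rule: infinite_finite_induct) (simp_all add: congX_mult)

lemma congX_sum: "(\<And>x. x \<in> A \<Longrightarrow> congX N (f x) (g x)) \<Longrightarrow> congX N (sum f A) (sum g A)"
  by (induction A rule: infinite_finite_induct) (simp_all add: congX_add)

lemma congX_inverse:
  assumes "congX N f g" "f $ 0 = 1" "g $ 0 = 1"
  shows "congX N (inverse f) (inverse g)"
proof -
  have f: "f * inverse f = 1" and g: "g * inverse g = 1"
    using assms by (simp_all add: inverse_mult_eq_1')
  have "inverse f - inverse g = (g * inverse g) * inverse f - (f * inverse f) * inverse g"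
    by (simp add: f g)
  also have "\<dots> = inverse f * inverse g * (g - f)" by (simp add: algebra_simps)
  finally show ?thesis using congX_sym[OF assms(1)] by (simp add: congX_def)
qed

text \<open>In characteristic 2, \<open>f\<^sup>2 - 1 = (f - 1)\<^sup>2\<close>.\<close>
lemma congX_sqrt:
  assumes "congX (2 * N) (f ^ 2) 1"
  shows "congX N f 1"
proof (cases "f = 1")
  case False
  have sq: "f ^ 2 - 1 = (f - 1) * (f - 1)"
    by (simp add: bit_fps_minus algebra_simps power2_eq_square)

  have nz: "f - 1 \<noteq> 0" using False by simp
  have "\<forall>i<2 * N. (f ^ 2 - 1) $ i = 0" using assms by (simp add: congX_def X_power_dvd_iff)
  moreover have "f ^ 2 - 1 \<noteq> 0" using sq nz by simp
  ultimately have "2 * N \<le> subdegree (f ^ 2 - 1)" by (intro subdegree_geI) auto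
  also have "\<dots> = 2 * subdegree (f - 1)" unfolding sq using nz by simp
  finally have "N \<le> subdegree (f - 1)" by simp
  then have "\<forall>i<N. (f - 1) $ i = 0"
    using nth_less_subdegree_zero[of _ "f - 1"] by (meson less_le_trans)
  then show ?thesis by (simp only: congX_def X_power_dvd_iff)
qed simp

lemma dick_mult:
  assumes "q \<le> p"
  shows "dick p * dick q = dick (p + q) + dick (p - q)"
  using assms
proof (induction q rule: dick.induct)
  case 1
  show ?case by simp
next
  case 2
  then obtain p' where "p = Suc p'" by (cases p) auto
  then show ?case by simp
next
  case (3 q)
  define r where "r = p - Suc (Suc q)"
  have p: "p = Suc (Suc (r + q))" using 3 by (simp add: r_def)
  have e: "p - Suc q = Suc r" "p - q = Suc (Suc r)" "p - Suc (Suc q) = r" using p by simp_all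
  have "dick p * dick (Suc (Suc q)) = monom 1 1 * (dick p * dick (Suc q)) - dick p * dick q"
    by (simp add: algebra_simps)
  also have "\<dots> = monom 1 1 * (dick (p + Suc q) + dick (Suc r)) - (dick (p + q) + dick (Suc (Suc r)))"
    using 3 by (simp add: e)
  also have "\<dots> = dick (p + Suc (Suc q)) + dick r"
    by (simp add: algebra_simps)
  finally show ?case by (simp only: e)
qed

text \<open>The reductions of \<open>dick b\<close> and of \<open>d\<^sub>b\<close> as series in \<open>t\<close>, which stands for \<open>\<tau>\<close>.\<close>
definition Dk :: "nat \<Rightarrow> bit fps" where
  "Dk b = ieval (dick b) fps_X"

definition uk :: "nat \<Rightarrow> bit fps" where
  "uk b = 1 + Dk b"

lemma Dk_0 [simp]: "Dk 0 = 0"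
  by (simp add: Dk_def)

lemma Dk_1 [simp]: "Dk (Suc 0) = fps_X"
  by (simp add: Dk_def)

lemma Dk_Suc_Suc: "Dk (Suc (Suc b)) = fps_X * Dk (Suc b) + Dk b"
  by (simp add: Dk_def bit_fps_minus)

lemma Dk_mult: "q \<le> p \<Longrightarrow> Dk p * Dk q = Dk (p + q) + Dk (p - q)"
  unfolding Dk_def by (simp only: ieval_mult[symmetric] dick_mult ieval_add)

lemma Dk_double: "Dk (2 * m) = Dk m ^ 2"
  using Dk_mult[of m m] by (simp add: power2_eq_square mult_2)

lemma Dk_pow2: "Dk (2 ^ k * q) = Dk q ^ 2 ^ k"
proof (induction k)
  case (Suc k)
  have "Dk (2 ^ Suc k * q) = Dk (2 ^ k * q) ^ 2" by (simp add: Dk_double mult.assoc)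
  then show ?case using Suc by (simp flip: power_mult add: mult.commute)
qed simp

lemma Dk_nth_0 [simp]: "Dk b $ 0 = 0"
  by (induction b rule: dick.induct) (simp_all add: Dk_Suc_Suc)

lemma Dk_nth_1: "Dk b $ Suc 0 = of_nat b"
proof (induction b rule: dick.induct)
  case (3 b)
  then show ?case by (simp add: Dk_Suc_Suc fps_X_mult_nth)
qed simp_all

lemma uk_nth_0 [simp]: "uk b $ 0 = 1"
  by (simp add: uk_def)

lemma Dk_three: "Dk 3 = fps_X + fps_X ^ 3"
  by (simp add: numeral_3_eq_3 Dk_Suc_Suc algebra_simps power_Suc)

text \<open>The substitution \<open>t \<mapsto> t + t\<^sup>3\<close> is the reduction of \<open>\<alpha> \<mapsto> \<alpha>\<^sup>3\<close>.\<close>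
lemma Dk_compose_three: "Dk b oo Dk 3 = Dk (3 * b)"
proof (induction b rule: dick.induct)
  case 2
  show ?case by simp
next
  case (3 b)
  have "Dk (Suc (Suc b)) oo Dk 3 = Dk 3 * Dk (3 * Suc b) + Dk (3 * b)"
    using 3 by (simp add: Dk_Suc_Suc fps_compose_add_distrib fps_compose_mult_distrib)
  also have "Dk 3 * Dk (3 * Suc b) = Dk (3 * Suc b) * Dk 3" by (rule mult.commute)
  also have "\<dots> = Dk (3 * Suc b + 3) + Dk (3 * Suc b - 3)" by (rule Dk_mult) simp
  finally show ?case by (simp add: algebra_simps)
qed simp

lemma X_deriv_Dk: "fps_X * fps_deriv (Dk b) = of_nat b * Dk b"
proof (induction b rule: dick.induct)
  case (3 b)
  have "fps_X * fps_deriv (Dk (Suc (Suc b))) =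
    fps_X * (fps_X * fps_deriv (Dk (Suc b))) + fps_X * Dk (Suc b) + fps_X * fps_deriv (Dk b)"
    by (simp add: Dk_Suc_Suc algebra_simps)
  also have "\<dots> = of_nat b * (fps_X * Dk (Suc b) + Dk b) + (fps_X * Dk (Suc b) + fps_X * Dk (Suc b))"
    unfolding 3 by (simp add: algebra_simps del: bit_fps_double)
  also have "\<dots> = of_nat (Suc (Suc b)) * Dk (Suc (Suc b))"
    by (simp add: Dk_Suc_Suc algebra_simps)
  finally show ?case .
qed simp_all

text \<open>\<open>Dk b + Dk p\<close> is the product of the series with indices \<open>(b + p)/2\<close> and \<open>(b - p)/2\<close>.  One of
  these indices is a multiple of \<open>2\<^bsup>m-1\<^esup>\<close>, so that series is a \<open>2\<^bsup>m-1\<^esup>\<close>-th power of a series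
  without constant term.\<close>
lemma Dk_cong:
  fixes s q :: int
  assumes "odd p" "odd b" "s \<in> {1, -1}" "int b = s * int p + q * 2 ^ m" "m \<ge> 1"
  shows "congX (2 ^ (m - 1)) (Dk b) (Dk p)"
proof -
  have main: "congX (2 ^ (m - 1)) (Dk b) (Dk p)"
    if "odd p" "odd b" "s \<in> {1, -1}" "int b = s * int p + q * 2 ^ m" "p \<le> b"
    for p b and s q :: int
  proof -
    define x where "x = (b + p) div 2"
    define y where "y = (b - p) div 2"
    have xy: "b = x + y" "p = x - y" "y \<le> x" "2 * x = b + p" "2 * y = b - p"
      using that by (auto simp: x_def y_def elim!: oddE)
    have prod: "Dk b + Dk p = Dk x * Dk y" using Dk_mult[OF xy(3)] xy by simp
    have two: "(2::int) ^ m = 2 * 2 ^ (m - 1)"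
      using assms(5) by (metis One_nat_def Suc_pred less_le_trans power_Suc zero_less_one)
    have dv: "fps_X ^ 2 ^ (m - 1) dvd Dk z" if "int z = q * 2 ^ (m - 1)" for z
    proof -
      have "2 ^ (m - 1) dvd z" using that by (metis dvd_triv_right int_dvd_int_iff of_nat_numeral of_nat_power)
      then obtain w where "z = 2 ^ (m - 1) * w" by (auto elim: dvdE)
      then have z: "Dk z = Dk w ^ 2 ^ (m - 1)" by (simp add: Dk_pow2)
      have "fps_X ^ 1 dvd Dk w" by (simp only: X_power_dvd_iff) simp
      then show ?thesis unfolding z by (intro dvd_power_same) simp
    qed
    have "int y = q * 2 ^ (m - 1) \<or> int x = q * 2 ^ (m - 1)"
    proof (cases "s = 1")
      case True
      then have "int (2 * y) = q * 2 ^ m" using that xy(5) by (simp add: of_nat_diff)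
      then show ?thesis by (simp add: two)
    next
      case False
      then have "s = -1" using that by simp
      then have "int (2 * x) = q * 2 ^ m" unfolding xy(4) using that by simp
      then show ?thesis by (simp add: two)
    qed
    then have "fps_X ^ 2 ^ (m - 1) dvd Dk x * Dk y" using dv by auto
    then show ?thesis by (simp add: congX_def bit_fps_minus prod)
  qed
  show ?thesis
  proof (cases "p \<le> b")
    case True
    with main assms show ?thesis by blast
  next
    case False
    have "s * s = 1" using assms(3) by auto
    moreover have "int p = (s * s) * int p + (s * q) * 2 ^ m + (- (s * q)) * 2 ^ m" using calculation by simp
    ultimately have "int p = s * int b + (- (s * q)) * 2 ^ m" unfolding assms(4) by (simp add: algebra_simps)
    then show ?thesis using main[of b p s "- (s * q)"] assms False congX_sym by simp
  qed
qed

text \<open>The substitution \<open>t \<mapsto> t + t\<^sup>3\<close> minus the identity raises an odd order of vanishing by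
  exactly 2, since \<open>t\<^sup>v (1 + t\<^sup>2)\<^sup>v = t\<^sup>v + v t\<^bsup>v+2\<^esup> + \<dots>\<close>.\<close>
lemma compose_three_order:
  fixes f :: "bit fps"
  assumes v: "odd v" and low: "\<forall>i<v. f $ i = 0" and lead: "f $ v = 1"
  shows "\<forall>i<v + 2. (f + (f oo Dk 3)) $ i = 0" "(f + (f oo Dk 3)) $ (v + 2) = 1"
proof -
  have "fps_X ^ v dvd f" using low by (simp add: X_power_dvd_iff)
  then obtain h where f: "f = fps_X ^ v * h" by (auto elim: dvdE)
  have h0: "h $ 0 = 1" using lead by (simp add: f fps_X_power_mult_nth)
  obtain w where w: "v = 2 * w + 1" using v by (auto elim: oddE)
  have "(1 + fps_X ^ 2) ^ v = (1 + fps_X ^ 2) * (((1 + fps_X ^ 2) ^ 2) ^ w :: bit fps)"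
    by (simp add: w power_mult)
  moreover have "(1 + fps_X ^ 2) ^ 2 = (1 + fps_X ^ 4 :: bit fps)"
    by (simp add: power2_eq_square algebra_simps numeral_eq_Suc)
  ultimately have pv: "(1 + fps_X ^ 2) ^ v = (1 + fps_X ^ 2) * ((1 + fps_X ^ 4 :: bit fps) ^ w)" by simp
  have "fps_X ^ 4 dvd (1 + fps_X ^ 4 :: bit fps) ^ w - 1"
  proof -
    have "(1 + fps_X ^ 4 :: bit fps) - 1 dvd (1 + fps_X ^ 4) ^ w - 1 ^ w"
      by (metis dvd_triv_left power_diff_sumr2)
    then show ?thesis by simp
  qed
  then obtain s :: "bit fps" where "(1 + fps_X ^ 4) ^ w - 1 = fps_X ^ 4 * s" by (auto elim: dvdE)
  then have s: "(1 + fps_X ^ 4) ^ w = 1 + fps_X ^ 4 * s" by (simp add: algebra_simps)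
  have hd: "fps_X ^ 3 dvd (h oo Dk 3) - h"
  proof -
    have D: "Dk 3 $ 0 = 0" "Dk 3 $ 1 = 1" "Dk 3 $ 2 = 0" "(Dk 3 ^ 2) $ 1 = 0" "(Dk 3 ^ 2) $ 2 = 1"
      unfolding Dk_three by (simp_all add: fps_mult_nth numeral_eq_Suc)
    have "((h oo Dk 3) - h) $ i = 0" if "i < 3" for i
    proof -
      consider "i = 0" | "i = 1" | "i = 2" using \<open>i < 3\<close> by linarith
      then show ?thesis
      proof cases
        case 3
        have "(h oo Dk 3) $ 2 = h $ 0 * (Dk 3 ^ 0) $ 2 + h $ 1 * (Dk 3 ^ 1) $ 2 + h $ 2 * (Dk 3 ^ 2) $ 2"
          by (simp only: fps_compose_nth numeral_2_eq_2 One_nat_def sum.atLeast0_atMost_Suc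
              atLeastAtMost_singleton sum.insert[OF finite.emptyI] empty_iff not_False_eq_True sum.empty add_0_right)
        then show ?thesis using 3 D by simp
      next
        case 2
        have "(h oo Dk 3) $ 1 = h $ 0 * (Dk 3 ^ 0) $ 1 + h $ 1 * (Dk 3 ^ 1) $ 1"
          by (simp only: fps_compose_nth One_nat_def sum.atLeast0_atMost_Suc
              atLeastAtMost_singleton sum.insert[OF finite.emptyI] empty_iff not_False_eq_True sum.empty add_0_right)
        then show ?thesis using 2 D by simp
      qed simp
    qed
    then show ?thesis by (simp only: X_power_dvd_iff) blast
  qed
  then obtain r where "(h oo Dk 3) - h = fps_X ^ 3 * r" by (auto elim: dvdE)
  then have r: "h oo Dk 3 = h + fps_X ^ 3 * r" by (simp add: algebra_simps)
  have "f oo Dk 3 = (fps_X ^ v oo Dk 3) * (h oo Dk 3)"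
    unfolding f by (rule fps_compose_mult_distrib) simp
  also have "fps_X ^ v oo Dk 3 = (Dk 3) ^ v" by (simp add: fps_compose_power[symmetric])
  also have "Dk 3 ^ v = fps_X ^ v * (1 + fps_X ^ 2) ^ v"
    unfolding Dk_three power_mult_distrib[symmetric] by (simp add: algebra_simps numeral_eq_Suc)
  finally have "f oo Dk 3 = fps_X ^ v * ((1 + fps_X ^ 2) * (1 + fps_X ^ 4 * s) * (h + fps_X ^ 3 * r))"
    by (simp add: pv s r mult.assoc)
  also have "(1 + fps_X ^ 2) * (1 + fps_X ^ 4 * s) * (h + fps_X ^ 3 * r)
    = h + fps_X ^ 2 * (h + fps_X * (r + fps_X ^ 2 * r + (1 + fps_X ^ 2) * fps_X * s * (h + fps_X ^ 3 * r)))"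
    by (simp add: algebra_simps numeral_eq_Suc)
  finally obtain g where g: "f oo Dk 3 = fps_X ^ v * (h + fps_X ^ 2 * (h + fps_X * g))" by blast
  have "f + (f oo Dk 3) = f + fps_X ^ v * (h + fps_X ^ 2 * (h + fps_X * g))"
    by (simp only: g)
  also have "\<dots> = f + (fps_X ^ v * h + fps_X ^ (v + 2) * (h + fps_X * g))"
    by (simp only: distrib_left power_add mult.assoc)
  also have "\<dots> = f + (f + fps_X ^ (v + 2) * (h + fps_X * g))"
    by (simp only: f)
  also have "\<dots> = (f + f) + fps_X ^ (v + 2) * (h + fps_X * g)"
    by (simp only: add.assoc)
  finally have "f + (f oo Dk 3) = fps_X ^ (v + 2) * (h + fps_X * g)" by simp
  then show "\<forall>i<v + 2. (f + (f oo Dk 3)) $ i = 0" "(f + (f oo Dk 3)) $ (v + 2) = 1"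
    using h0 by (simp_all only: fps_X_power_mult_nth) simp_all
qed

text \<open>For odd \<open>b\<close> this is the logarithmic derivative of \<open>uk b\<close> with respect to \<open>t d/dt\<close>.\<close>
definition zk :: "nat \<Rightarrow> bit fps" where
  "zk b = Dk b * inverse (uk b)"

lemma zk_compose_three: "zk b oo Dk 3 = zk (3 * b)"
proof -
  have "uk b oo Dk 3 = uk (3 * b)"
    by (simp add: uk_def fps_compose_add_distrib Dk_compose_three)
  then show ?thesis
    by (simp add: zk_def fps_compose_mult_distrib Dk_compose_three fps_inverse_compose)
qed

lemma zk_nth_0 [simp]: "zk b $ 0 = 0"
  by (simp add: zk_def)

lemma zk_nth_1: "odd b \<Longrightarrow> zk b $ 1 = 1"
  by (auto simp: zk_def fps_mult_nth Dk_nth_1 elim!: oddE)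

text \<open>An \<open>F\<^sub>2\<close>-combination of the \<open>zk (3\<^sup>i)\<close> is an element of the group ring of \<open>\<langle>\<sigma>\<rangle>\<close>, \<open>\<sigma>\<close> the
  substitution \<open>t \<mapsto> t + t\<^sup>3\<close>, applied to \<open>zk 1\<close>.  Each factor \<open>\<sigma> - 1\<close> raises the order by 2, and
  what remains after splitting off all of them has order 1.\<close>
lemma zk_combination_order:
  fixes c :: "nat \<Rightarrow> bit"
  assumes "\<exists>i<K. c i \<noteq> 0"
  shows "\<exists>v. odd v \<and> v < 2 * K \<and> (\<forall>i<v. (\<Sum>i<K. fps_const (c i) * zk (3 ^ i)) $ i = 0)
    \<and> (\<Sum>i<K. fps_const (c i) * zk (3 ^ i)) $ v = 1"
  using assms
proof (induction K arbitrary: c)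
  case (Suc K)
  \<comment> \<open>the coefficients of the quotient by \<open>\<sigma> - 1\<close>; the division is exact if their last sum is 0\<close>
  define c' where "c' i = (\<Sum>j\<le>i. c j)" for i
  show ?case
  proof (cases "c' K = 0")
    case False
    then have 1: "c' K = 1" by simp
    have z1: "zk (3 ^ i) $ 1 = 1" for i by (rule zk_nth_1) simp
    have "(\<Sum>i<Suc K. fps_const (c i) * zk (3 ^ i)) $ 1 = (\<Sum>i<Suc K. c i)"
      by (simp only: fps_sum_nth fps_mult_left_const_nth z1 mult_1_right)
    also have "\<dots> = 1" using 1 by (simp only: c'_def lessThan_Suc_atMost)
    finally have "(\<Sum>i<Suc K. fps_const (c i) * zk (3 ^ i)) $ 1 = 1" .
    moreover have "(\<Sum>i<Suc K. fps_const (c i) * zk (3 ^ i)) $ i = 0" if "i < 1" for i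
      using that by (simp add: fps_sum_nth)
    ultimately show ?thesis by (intro exI[of _ 1]) auto
  next
    case True
    have abel: "(\<Sum>i<Suc k. fps_const (c i) * zk (3 ^ i)) =
      (\<Sum>i<k. fps_const (c' i) * (zk (3 ^ i) + zk (3 ^ Suc i))) + fps_const (c' k) * zk (3 ^ k)" for k
    proof (induction k)
      case (Suc k)
      have "c (Suc k) = c' k + c' (Suc k)"
      proof -
        have "x + (x + y) = y" for x y :: bit by (cases x; cases y) simp_all
        then show ?thesis by (simp add: c'_def)
      qed
      then have F: "fps_const (c (Suc k)) = fps_const (c' k) + fps_const (c' (Suc k))" by simp
      have "(\<Sum>i<Suc (Suc k). fps_const (c i) * zk (3 ^ i)) =
        (\<Sum>i<Suc k. fps_const (c i) * zk (3 ^ i)) + fps_const (c (Suc k)) * zk (3 ^ Suc k)"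
        by (rule sum.lessThan_Suc)
      also have "\<dots> = (\<Sum>i<k. fps_const (c' i) * (zk (3 ^ i) + zk (3 ^ Suc i))) + fps_const (c' k) * zk (3 ^ k)
        + (fps_const (c' k) + fps_const (c' (Suc k))) * zk (3 ^ Suc k)"
        unfolding Suc F ..
      also have "\<dots> = (\<Sum>i<Suc k. fps_const (c' i) * (zk (3 ^ i) + zk (3 ^ Suc i)))
        + fps_const (c' (Suc k)) * zk (3 ^ Suc k)"
        by (simp only: sum.lessThan_Suc distrib_left distrib_right add.assoc)
      finally show ?case .
    qed (simp add: c'_def)
    have ex: "\<exists>i<K. c' i \<noteq> 0"
    proof (rule ccontr)
      assume "\<not> (\<exists>i<K. c' i \<noteq> 0)"
      then have z: "c' i = 0" if "i \<le> K" for i using that True by (cases "i = K") auto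
      have "c i = 0" if "i \<le> K" for i
      proof (cases i)
        case 0
        then show ?thesis using z[of 0] by (simp add: c'_def)
      next
        case (Suc j)
        then show ?thesis using z[of i] z[of j] that by (simp add: c'_def)
      qed
      then show False using Suc.prems by auto
    qed
    define f where "f = (\<Sum>i<K. fps_const (c' i) * zk (3 ^ i))"
    obtain v where v: "odd v" "v < 2 * K" "\<forall>i<v. f $ i = 0" "f $ v = 1"
      using Suc.IH[OF ex] unfolding f_def by blast
    have "f oo Dk 3 = (\<Sum>i<K. fps_const (c' i) * zk (3 ^ Suc i))"
      by (simp add: f_def fps_compose_sum_distrib fps_compose_mult_distrib zk_compose_three)
    then have "(\<Sum>i<Suc K. fps_const (c i) * zk (3 ^ i)) = f + (f oo Dk 3)"
      using abel[of K] True by (simp add: f_def algebra_simps sum.distrib)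
    then show ?thesis
      using compose_three_order[OF v(1,3,4)] v(1,2) by (intro exI[of _ "v + 2"]) auto
  qed
qed simp

lemma X_deriv_prod_uk:
  assumes "finite T" "\<And>b. b \<in> T \<Longrightarrow> odd b"
  shows "fps_X * fps_deriv (\<Prod>b\<in>T. uk b) = (\<Prod>b\<in>T. uk b) * (\<Sum>b\<in>T. zk b)"
  using assms
proof (induction T rule: finite_induct)
  case (insert b T)
  have "of_nat b = (1 :: bit fps)" using insert.prems[of b] by (auto elim!: oddE)
  then have Db: "fps_X * fps_deriv (uk b) = Dk b" by (simp add: uk_def X_deriv_Dk)
  have ub: "uk b * zk b = Dk b"
    using inverse_mult_eq_1'[of "uk b"] by (simp add: zk_def mult.left_commute)
  have "fps_X * fps_deriv (\<Prod>b\<in>insert b T. uk b)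
    = uk b * (fps_X * fps_deriv (\<Prod>b\<in>T. uk b)) + (fps_X * fps_deriv (uk b)) * (\<Prod>b\<in>T. uk b)"
    using insert.hyps by (simp add: algebra_simps)
  also have "\<dots> = uk b * ((\<Prod>b\<in>T. uk b) * (\<Sum>b\<in>T. zk b)) + uk b * zk b * (\<Prod>b\<in>T. uk b)"
    using insert.IH insert.prems by (simp add: Db ub)
  also have "\<dots> = (\<Prod>b\<in>insert b T. uk b) * (\<Sum>b\<in>insert b T. zk b)"
    using insert.hyps by (simp add: algebra_simps)
  finally show ?case .
qed simp

lemma X_power_dvd_X_deriv:
  assumes "fps_X ^ N dvd (f :: bit fps)"
  shows "fps_X ^ N dvd fps_X * fps_deriv f"
  using assms by (auto simp: X_power_dvd_iff fps_X_mult_nth)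

text \<open>The logarithmic derivative sends \<open>uk b\<close> to \<open>zk b\<close> and kills squares, so the \<open>zk b\<close> with odd
  exponent sum to 0.  Replacing \<open>b\<close> by a power of 3 contradicts the order computed above.\<close>
lemma even_exponents:
  assumes m: "m \<ge> 2" and c: "congX (2 ^ (m - 1)) (\<Prod>b\<in>odds m. uk b ^ a b) 1"
    and b: "b \<in> odds m"
  shows "even (a b)"
proof (rule ccontr)
  assume ab: "odd (a b)"
  define N where "N = (2::nat) ^ (m - 1)"
  define T where "T = {b \<in> odds m. odd (a b)}"
  define g where "g = (\<Prod>b\<in>T. uk b)"
  define nu where "nu = (\<Prod>b\<in>odds m. uk b ^ (a b div 2))"
  define w where "w = inverse nu"
  have fT: "finite T" "\<And>b. b \<in> T \<Longrightarrow> odd b" by (auto simp: T_def odds_def)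
  have nth0: "(\<Prod>x\<in>A. uk x ^ k x) $ 0 = 1" for A and k :: "nat \<Rightarrow> nat"
    by (induction A rule: infinite_finite_induct) (simp_all add: fps_power_zeroth)
  have g0: "g $ 0 = 1" using nth0[of "\<lambda>_. 1" T] by (simp add: g_def)
  have nu0: "nu $ 0 = 1" by (simp add: nu_def nth0)
  have wnu: "nu * w = 1" by (simp add: w_def inverse_mult_eq_1' nu0)
  have "(\<Prod>b\<in>odds m. uk b ^ a b) = (\<Prod>b\<in>odds m. (if odd (a b) then uk b else 1) * (uk b ^ (a b div 2)) ^ 2)"
    by (intro prod.cong refl) (auto simp: mult.commute simp flip: power_mult elim!: oddE)
  also have "\<dots> = g * nu ^ 2"
    by (simp add: prod.distrib g_def nu_def T_def prod.inter_filter prod_power_distrib)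
  finally have split: "(\<Prod>b\<in>odds m. uk b ^ a b) = g * nu ^ 2" .
  have "congX N ((g * nu ^ 2) * w ^ 2) (1 * w ^ 2)"
    using c unfolding split N_def[symmetric] by (rule congX_mult) simp
  moreover have "(g * nu ^ 2) * w ^ 2 = g" using wnu
    by (simp add: power_mult_distrib[symmetric] mult.assoc)
  ultimately have "fps_X ^ N dvd g - w ^ 2" by (simp add: congX_def)
  then have "fps_X ^ N dvd fps_X * fps_deriv (g - w ^ 2)" by (rule X_power_dvd_X_deriv)
  moreover have "fps_deriv (w ^ 2) = 0"
  proof -
    have "fps_deriv (w ^ 2) = w * fps_deriv w + w * fps_deriv w"
      by (simp add: power2_eq_square mult.commute del: bit_fps_double)
    then show ?thesis by simp
  qed
  ultimately have "fps_X ^ N dvd g * (\<Sum>b\<in>T. zk b)"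
    using X_deriv_prod_uk[OF fT] by (simp add: g_def)
  then have "fps_X ^ N dvd inverse g * (g * (\<Sum>b\<in>T. zk b))" by (rule dvd_mult)
  moreover have "inverse g * (g * (\<Sum>b\<in>T. zk b)) = (\<Sum>b\<in>T. zk b)"
    using inverse_mult_eq_1[of g] g0 by (simp add: mult.assoc[symmetric])
  ultimately have dv: "congX N (\<Sum>b\<in>T. zk b) 0" by (simp add: congX_def)
  define ch where "ch i = (if rep3 m i \<in> T then 1 else 0 :: bit)" for i
  have "(\<Sum>b\<in>T. zk b) = (\<Sum>b\<in>odds m. if b \<in> T then zk b else 0)"
    by (rule sum.mono_neutral_cong_left) (auto simp: T_def)
  also have "\<dots> = (\<Sum>i<2 ^ (m - 2). if rep3 m i \<in> T then zk (rep3 m i) else 0)"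
    using sum.reindex_bij_betw[OF bij_betw_rep3[OF m]] by (rule sym)
  also have "\<dots> = (\<Sum>i<2 ^ (m - 2). fps_const (ch i) * zk (rep3 m i))"
    by (intro sum.cong refl) (auto simp: ch_def)
  finally have eq: "(\<Sum>b\<in>T. zk b) = (\<Sum>i<2 ^ (m - 2). fps_const (ch i) * zk (rep3 m i))" .
  have "congX N (zk (rep3 m i)) (zk (3 ^ i))" for i
  proof -
    obtain s q :: int where sq: "s \<in> {1, -1}" "int (rep3 m i) = s * 3 ^ i + q * 2 ^ m"
      by (rule rep3_cong)
    have "congX N (Dk (rep3 m i)) (Dk (3 ^ i))"
      unfolding N_def by (rule Dk_cong) (use sq rep3_in_odds[OF m, of i] m in \<open>auto simp: odds_def\<close>)
    moreover from this have "congX N (uk (rep3 m i)) (uk (3 ^ i))"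
      unfolding uk_def by (intro congX_add) auto
    then have "congX N (inverse (uk (rep3 m i))) (inverse (uk (3 ^ i)))"
      by (rule congX_inverse) auto
    ultimately show ?thesis unfolding zk_def by (rule congX_mult)
  qed
  then have "congX N (\<Sum>i<2 ^ (m - 2). fps_const (ch i) * zk (rep3 m i))
      (\<Sum>i<2 ^ (m - 2). fps_const (ch i) * zk (3 ^ i))"
    by (intro congX_sum congX_mult) auto
  with dv eq have "congX N (\<Sum>i<2 ^ (m - 2). fps_const (ch i) * zk (3 ^ i)) 0"
    using congX_sym congX_trans by metis
  then have zero: "(\<Sum>i<2 ^ (m - 2). fps_const (ch i) * zk (3 ^ i)) $ j = 0" if "j < N" for j
    using that by (simp add: congX_def X_power_dvd_iff)
  have "\<exists>i<2 ^ (m - 2). ch i \<noteq> 0"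
  proof -
    from b bij_betw_rep3[OF m] obtain i where "i < 2 ^ (m - 2)" "b = rep3 m i"
      by (auto simp: bij_betw_def)
    then show ?thesis using ab b by (intro exI[of _ i]) (simp add: ch_def T_def)
  qed
  from zk_combination_order[OF this] obtain v where
    v: "v < 2 * 2 ^ (m - 2)" "(\<Sum>i<2 ^ (m - 2). fps_const (ch i) * zk (3 ^ i)) $ v = 1"
    by blast
  have "N = 2 * 2 ^ (m - 2)"
  proof -
    have "m - 1 = Suc (m - 2)" using m by simp
    then show ?thesis by (simp add: N_def)
  qed
  with v zero[of v] show False by simp
qed

section \<open>The group of units of \<open>\<int>[\<alpha>]\<close>\<close>

definition ZA :: "nat \<Rightarrow> complex set" where
  "ZA n = range (\<lambda>p. ieval p (alpha n))"

lemma ZA_add [intro]: "x \<in> ZA n \<Longrightarrow> y \<in> ZA n \<Longrightarrow> x + y \<in> ZA n"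
  unfolding ZA_def by (auto simp flip: ieval_add)

lemma ZA_mult [intro]: "x \<in> ZA n \<Longrightarrow> y \<in> ZA n \<Longrightarrow> x * y \<in> ZA n"
  unfolding ZA_def by (auto simp flip: ieval_mult)

lemma ZA_uminus [intro]: "x \<in> ZA n \<Longrightarrow> - x \<in> ZA n"
  unfolding ZA_def by (auto simp flip: ieval_minus)

lemma ZA_diff [intro]: "x \<in> ZA n \<Longrightarrow> y \<in> ZA n \<Longrightarrow> x - y \<in> ZA n"
  unfolding ZA_def by (auto simp flip: ieval_diff)

lemma ZA_of_int [simp, intro]: "of_int c \<in> ZA n"
  unfolding ZA_def by (metis ieval_of_int rangeI)

lemma ZA_1 [simp, intro]: "1 \<in> ZA n"
  using ZA_of_int[of 1 n] by simp

lemma ZA_0 [simp, intro]: "0 \<in> ZA n"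
  using ZA_of_int[of 0 n] by simp

lemma ZA_alpha [simp, intro]: "alpha n \<in> ZA n"
  unfolding ZA_def by (rule image_eqI[of _ _ "monom 1 1"]) simp_all

lemma ZA_power [intro]: "x \<in> ZA n \<Longrightarrow> x ^ k \<in> ZA n"
  by (induction k) auto

lemma ZA_sum [intro]: "(\<And>x. x \<in> A \<Longrightarrow> f x \<in> ZA n) \<Longrightarrow> sum f A \<in> ZA n"
  by (induction A rule: infinite_finite_induct) auto

lemma ZA_ieval [intro]: "x \<in> ZA n \<Longrightarrow> ieval p x \<in> ZA n"
  by (induction p) auto

lemma ZA_inverse_alpha [simp, intro]: "inverse (alpha n) \<in> ZA n"
  by (simp add: ZA_power flip: root_pow_inverse[OF alpha_pow_full])

lemma ZA_alpha_powi [simp, intro]: "alpha n powi j \<in> ZA n"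
  by (auto simp: power_int_def)

lemma ZA_tau [simp, intro]: "tau n \<in> ZA n"
  by (auto simp: tau_def)

lemma ZA_d_el [simp, intro]: "d_el n j \<in> ZA n"
  by (auto simp: d_el_def)

lemma Zalpha_simps [simp]:
  "x \<otimes>\<^bsub>Zalpha n\<^esub> y = x * y" "\<one>\<^bsub>Zalpha n\<^esub> = 1"
  by (simp_all add: Zalpha_def ring_of_type_algebra_def)

lemma type_algebra_a_inv [simp]: "\<ominus>\<^bsub>ring_of_type_algebra\<^esub> x = - (x :: complex)"
proof -
  interpret R: ring "ring_of_type_algebra :: complex ring" by rule
  show ?thesis
    by (rule R.minus_equality) (simp_all add: ring_of_type_algebra_def)
qed

lemma of_int_closed:
  fixes G :: "complex set"
  assumes "1 \<in> G" "\<And>x. x \<in> G \<Longrightarrow> - x \<in> G" "\<And>x y. x \<in> G \<Longrightarrow> y \<in> G \<Longrightarrow> x + y \<in> G"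
  shows "of_int c \<in> G"
proof -
  have "0 \<in> G" using assms(3)[OF assms(1) assms(2)[OF assms(1)]] by simp
  then have nat: "of_nat k \<in> G" for k by (induction k) (auto intro: assms)
  show ?thesis
    using nat[of "nat c"] assms(2)[OF nat[of "nat (- c)"]] by (cases "c \<ge> 0") simp_all
qed

lemma ieval_closed:
  fixes G :: "complex set"
  assumes "1 \<in> G" "\<And>x. x \<in> G \<Longrightarrow> - x \<in> G" "\<And>x y. x \<in> G \<Longrightarrow> y \<in> G \<Longrightarrow> x + y \<in> G"
    and "\<And>x y. x \<in> G \<Longrightarrow> y \<in> G \<Longrightarrow> x * y \<in> G" "z \<in> G"
  shows "ieval p z \<in> G"
proof (induction p)
  case 0
  show ?case using of_int_closed[of G 0] assms by simp
next
  case (pCons c p)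
  then show ?case using of_int_closed[of G c] assms by simp
qed

lemma carrier_Zalpha: "carrier (Zalpha n) = ZA n"
proof -
  let ?R = "ring_of_type_algebra :: complex ring"
  define G where "G = generate_ring ?R {alpha n}"
  have "x \<in> ZA n" if "x \<in> G" for x
    using that unfolding G_def
  proof (induction rule: generate_ring.induct)
    case (a_inv h)
    then show ?case unfolding type_algebra_a_inv by blast
  qed (auto simp: ring_of_type_algebra_def)
  moreover have "ieval p (alpha n) \<in> G" for p
  proof (rule ieval_closed)
    show "1 \<in> G" using generate_ring.one[of ?R "{alpha n}"]
      by (simp add: G_def ring_of_type_algebra_def)
    show "- x \<in> G" if "x \<in> G" for x
      using generate_ring.a_inv[of x ?R "{alpha n}"] that by (simp add: G_def)
    show "x + y \<in> G" "x * y \<in> G" if "x \<in> G" "y \<in> G" for x y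
      using generate_ring.eng_add[of x ?R "{alpha n}" y] generate_ring.eng_mult[of x ?R "{alpha n}" y] that
      by (simp_all add: G_def ring_of_type_algebra_def)
    show "alpha n \<in> G" using generate_ring.incl[of "alpha n" "{alpha n}" ?R]
      by (simp add: G_def)
  qed
  ultimately show ?thesis by (auto simp: ZA_def Zalpha_def G_def)
qed

definition unitsA :: "nat \<Rightarrow> complex set" where
  "unitsA n = {x \<in> ZA n. x \<noteq> 0 \<and> inverse x \<in> ZA n}"

lemma Un_grp_simps [simp]:
  "x \<otimes>\<^bsub>Un_grp n\<^esub> y = x * y" "\<one>\<^bsub>Un_grp n\<^esub> = 1"
  by (simp_all add: Un_grp_def units_of_def)

lemma carrier_Un_grp: "carrier (Un_grp n) = unitsA n"
proof -
  have "(\<exists>y\<in>ZA n. y * x = 1 \<and> x * y = 1) \<longleftrightarrow> x \<noteq> 0 \<and> inverse x \<in> ZA n" for x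
  proof
    assume "\<exists>y\<in>ZA n. y * x = 1 \<and> x * y = 1"
    then obtain y where "y \<in> ZA n" "x * y = 1" by blast
    moreover from this have "inverse x = y" by (intro inverse_unique)
    ultimately show "x \<noteq> 0 \<and> inverse x \<in> ZA n" by auto
  next
    assume "x \<noteq> 0 \<and> inverse x \<in> ZA n"
    then show "\<exists>y\<in>ZA n. y * x = 1 \<and> x * y = 1" by (intro bexI[of _ "inverse x"]) auto
  qed
  then show ?thesis
    by (simp add: Un_grp_def units_of_def Units_def carrier_Zalpha unitsA_def)
qed

lemma comm_group_Un_grp: "comm_group (Un_grp n)"
proof (rule comm_groupI)
  show "\<exists>y\<in>carrier (Un_grp n). y \<otimes>\<^bsub>Un_grp n\<^esub> x = \<one>\<^bsub>Un_grp n\<^esub>" if "x \<in> carrier (Un_grp n)" for x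
    using that by (intro bexI[of _ "inverse x"]) (auto simp: carrier_Un_grp unitsA_def)
qed (auto simp: carrier_Un_grp unitsA_def mult_ac)

lemma group_Un_grp: "group (Un_grp n)"
  using comm_group_Un_grp by (rule comm_group.axioms)

lemma inv_Un_grp: "x \<in> unitsA n \<Longrightarrow> inv\<^bsub>Un_grp n\<^esub> x = inverse x"
  by (rule group.inv_equality[OF group_Un_grp]) (auto simp: carrier_Un_grp unitsA_def)

lemma subgroup_Un_grpI:
  assumes "S \<subseteq> unitsA n" "1 \<in> S" "\<And>x y. x \<in> S \<Longrightarrow> y \<in> S \<Longrightarrow> x * y \<in> S"
    and "\<And>x. x \<in> S \<Longrightarrow> inverse x \<in> S"
  shows "subgroup S (Un_grp n)"
  by (rule subgroup.intro) (use assms in \<open>auto simp: carrier_Un_grp inv_Un_grp subset_iff\<close>)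

lemma subgroup_Un_grpD:
  assumes "subgroup S (Un_grp n)"
  shows "S \<subseteq> unitsA n" "1 \<in> S" "x \<in> S \<Longrightarrow> y \<in> S \<Longrightarrow> x * y \<in> S" "x \<in> S \<Longrightarrow> inverse x \<in> S"
proof -
  show sub: "S \<subseteq> unitsA n" using subgroup.subset[OF assms] by (simp add: carrier_Un_grp)
  show "1 \<in> S" using subgroup.one_closed[OF assms] by simp
  show "x \<in> S \<Longrightarrow> y \<in> S \<Longrightarrow> x * y \<in> S" using subgroup.m_closed[OF assms] by simp
  show "x \<in> S \<Longrightarrow> inverse x \<in> S"
    using subgroup.m_inv_closed[OF assms] inv_Un_grp sub by (metis subsetD)
qed

lemma subgroup_Un_grp_power:
  assumes "subgroup S (Un_grp n)" "x \<in> S"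
  shows "x ^ k \<in> S"
  by (induction k) (use assms subgroup_Un_grpD in auto)

lemma subgroup_Un_grp_powi:
  assumes "subgroup S (Un_grp n)" "x \<in> S"
  shows "x powi k \<in> S"
  using subgroup_Un_grp_power[OF assms] subgroup_Un_grp_power[OF assms(1) subgroup_Un_grpD(4)[OF assms]]
  by (simp add: power_int_def)

lemma subgroup_Un_grp_prod:
  assumes "subgroup S (Un_grp n)" "\<And>i. i \<in> I \<Longrightarrow> f i \<in> S"
  shows "(\<Prod>i\<in>I. f i) \<in> S"
  using assms(2) by (induction I rule: infinite_finite_induct) (use assms(1) subgroup_Un_grpD in auto)

lemma generate_Un_grp_eq:
  assumes I: "finite I" and b: "b ` I \<subseteq> unitsA n"
  shows "generate (Un_grp n) (b ` I) = {(\<Prod>i\<in>I. b i powi e i) | e. True}"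
proof -
  interpret K: comm_group "Un_grp n" by (rule comm_group_Un_grp)
  have units: "subgroup (unitsA n) (Un_grp n)"
    using K.subgroup_self by (simp add: carrier_Un_grp)
  have nz: "b i \<noteq> 0" if "i \<in> I" for i using b that by (auto simp: unitsA_def)
  have sub: "subgroup {(\<Prod>i\<in>I. b i powi e i) | e. True} (Un_grp n)" (is "subgroup ?S _")
  proof (rule subgroup_Un_grpI)
    show "?S \<subseteq> unitsA n"
      using b by (auto intro!: subgroup_Un_grp_prod[OF units] subgroup_Un_grp_powi[OF units])
    show "1 \<in> ?S" by (auto intro!: exI[of _ "\<lambda>_. 0"])
    fix x assume "x \<in> ?S"
    then obtain e where x: "x = (\<Prod>i\<in>I. b i powi e i)" by blast
    show "inverse x \<in> ?S" unfolding x
      by (auto intro!: exI[of _ "\<lambda>i. - e i"] simp: prod_inversef[symmetric] power_int_minus comp_def)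
    fix y assume "y \<in> ?S"
    then obtain e' where y: "y = (\<Prod>i\<in>I. b i powi e' i)" by blast
    have "x * y = (\<Prod>i\<in>I. b i powi (e i + e' i))"
      unfolding x y prod.distrib[symmetric] by (intro prod.cong) (auto simp: nz power_int_add)
    then show "x * y \<in> ?S" by (intro CollectI exI[of _ "\<lambda>i. e i + e' i"] conjI TrueI)
  qed
  show ?thesis
  proof
    show "generate (Un_grp n) (b ` I) \<subseteq> ?S"
    proof (rule K.generate_subgroup_incl[OF _ sub], rule subsetI)
      fix x assume "x \<in> b ` I"
      then obtain i where i: "i \<in> I" "x = b i" by blast
      have "(\<Prod>j\<in>I. b j powi (if j = i then 1 else 0)) = (\<Prod>j\<in>I. if j = i then b j else 1)"
        by (intro prod.cong) auto
      also have "\<dots> = x" using i I by simp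
      finally show "x \<in> ?S" by (auto intro!: exI[of _ "\<lambda>j. if j = i then 1 else 0"])
    qed
    have gen: "subgroup (generate (Un_grp n) (b ` I)) (Un_grp n)"
      using b by (intro K.generate_is_subgroup) (simp add: carrier_Un_grp)
    show "?S \<subseteq> generate (Un_grp n) (b ` I)"
      using generate.incl[of _ "b ` I" "Un_grp n"]
      by (auto intro!: subgroup_Un_grp_prod[OF gen] subgroup_Un_grp_powi[OF gen])
  qed
qed

section \<open>Internal direct products of cyclic groups\<close>

lemma (in group) generate_UN_cyc:
  assumes "g ` I \<subseteq> carrier G"
  shows "generate G (\<Union>i\<in>I. cyc G (g i)) = generate G (g ` I)"
proof
  have sub: "subgroup (generate G (g ` I)) G" using assms by (rule generate_is_subgroup)
  have "generate G {g i} \<subseteq> generate G (g ` I)" if "i \<in> I" for i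
    using that by (intro generate_subgroup_incl[OF _ sub]) (auto intro: generate.incl)
  then show "generate G (\<Union>i\<in>I. cyc G (g i)) \<subseteq> generate G (g ` I)"
    by (intro generate_subgroup_incl[OF _ sub]) (auto simp: cyc_def)
  have "g ` I \<subseteq> (\<Union>i\<in>I. cyc G (g i))" by (auto simp: cyc_def intro: generate.incl)
  then show "generate G (g ` I) \<subseteq> generate G (\<Union>i\<in>I. cyc G (g i))"
    by (rule mono_generate)
qed

lemma (in comm_group) internal_direct_product_of_cyclics:
  assumes g: "g ` I \<subseteq> carrier G"
    and indep: "\<And>i z. i \<in> I \<Longrightarrow> z \<in> cyc G (g i) \<Longrightarrow> z \<in> generate G (g ` (I - {i})) \<Longrightarrow> z = \<one>"
  shows "is_internal_direct_product G I (\<lambda>i. cyc G (g i)) (generate G (g ` I))"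
proof -
  let ?P = "generate G (g ` I)"
  have sub: "subgroup ?P G" using g by (rule generate_is_subgroup)
  have normal: "cyc G (g i) \<lhd> G\<lparr>carrier := ?P\<rparr>" if i: "i \<in> I" for i
  proof -
    have c: "subgroup (cyc G (g i)) G"
      unfolding cyc_def using g i by (intro generate_is_subgroup) auto
    moreover have "cyc G (g i) \<subseteq> ?P"
      unfolding cyc_def using i by (intro mono_generate) auto
    ultimately have "subgroup (cyc G (g i)) (G\<lparr>carrier := ?P\<rparr>)"
      using sub by (intro subgroup_incl)
    moreover have "comm_group (G\<lparr>carrier := ?P\<rparr>)"
    proof (rule group.group_comm_groupI)
      show "group (G\<lparr>carrier := ?P\<rparr>)" using sub by (rule subgroup_imp_group)
    qed (use subgroup.subset[OF sub] in \<open>auto intro!: m_comm\<close>)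
    ultimately show ?thesis by (metis comm_group.normal_iff_subgroup)
  qed
  have inter: "cyc G (g i) \<inter> subgroup_prod G (I - {i}) (\<lambda>i. cyc G (g i)) = {\<one>}" if i: "i \<in> I" for i
  proof -
    have "g ` (I - {i}) \<subseteq> carrier G" using g by auto
    then have eq: "subgroup_prod G (I - {i}) (\<lambda>i. cyc G (g i)) = generate G (g ` (I - {i}))"
      unfolding subgroup_prod_def by (rule generate_UN_cyc)
    show ?thesis unfolding eq using indep[OF i] by (auto simp: cyc_def intro: generate.one)
  qed
  show ?thesis
    unfolding is_internal_direct_product_def using sub normal inter
    by (simp add: subgroup_prod_def generate_UN_cyc[OF g])
qed

lemma internal_direct_product_reindex:
  assumes P: "is_internal_direct_product K I H P" and h: "bij_betw h J I"
    and eq: "\<And>j. j \<in> J \<Longrightarrow> H' j = H (h j)"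
  shows "is_internal_direct_product K J H' P"
proof -
  have img: "h ` J = I" and inj: "inj_on h J" using h by (auto simp: bij_betw_def)
  have diff: "h ` (J - {j}) = I - {h j}" if "j \<in> J" for j
    using that img inj by (auto dest: inj_onD)
  have "(\<Union>j'\<in>J - {j}. H' j') = (\<Union>i\<in>I - {h j}. H i)" if "j \<in> J" for j
    unfolding diff[OF that, symmetric] using eq by simp
  moreover have "(\<Union>j\<in>J. H' j) = (\<Union>i\<in>I. H i)" unfolding img[symmetric] using eq by simp
  moreover have "h j \<in> I" if "j \<in> J" for j using img that by blast
  ultimately show ?thesis
    using P eq unfolding is_internal_direct_product_def subgroup_prod_def by metis
qed

text \<open>An element common to the factor \<open>i\<close> and the product of the others gives a relation in which
  \<open>g i\<close> has the negated exponent.\<close>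
lemma internal_direct_product_Un_grp:
  fixes g :: "'i \<Rightarrow> complex"
  assumes I: "finite I" and g: "g ` I \<subseteq> unitsA n"
    and indep: "\<And>(e :: 'i \<Rightarrow> int) i. (\<Prod>i\<in>I. g i powi e i) = 1 \<Longrightarrow> i \<in> I \<Longrightarrow> e i = 0"
  shows "is_internal_direct_product (Un_grp n) I (\<lambda>i. cyc (Un_grp n) (g i)) (generate (Un_grp n) (g ` I))"
proof (rule comm_group.internal_direct_product_of_cyclics[OF comm_group_Un_grp])
  fix i z assume i: "i \<in> I" and z1: "z \<in> cyc (Un_grp n) (g i)"
    and z2: "z \<in> generate (Un_grp n) (g ` (I - {i}))"
  have nz: "g j \<noteq> 0" if "j \<in> I" for j using g that by (auto simp: unitsA_def)
  have "generate (Un_grp n) (g ` {i}) = {(\<Prod>j\<in>{i}. g j powi e j) | e. True}"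
    by (rule generate_Un_grp_eq) (use g i in auto)
  with z1 obtain c :: int where c: "z = g i powi c" by (auto simp: cyc_def)
  have "generate (Un_grp n) (g ` (I - {i})) = {(\<Prod>j\<in>I - {i}. g j powi e j) | e. True}"
    by (rule generate_Un_grp_eq) (use I g in auto)
  with z2 obtain e where e: "z = (\<Prod>j\<in>I - {i}. g j powi e j)" by auto
  have "(\<Prod>j\<in>I. g j powi (e(i := - c)) j) = g i powi (- c) * (\<Prod>j\<in>I - {i}. g j powi e j)"
    using I i by (subst prod.remove[of I i]) (auto intro!: prod.cong)
  also have "\<dots> = 1" using c e nz[OF i] by (simp flip: power_int_add)
  finally have "(e(i := - c)) i = 0" by (rule indep) (rule i)
  then show "z = \<one>\<^bsub>Un_grp n\<^esub>" using c by simp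
qed (use g in \<open>simp add: carrier_Un_grp\<close>)

section \<open>Congruences modulo 2 in \<open>\<int>[\<alpha>]\<close>\<close>

definition even2 :: "nat \<Rightarrow> complex \<Rightarrow> bool" where
  "even2 n x \<longleftrightarrow> (\<exists>t\<in>ZA n. x = 2 * t)"

lemma even2I: "t \<in> ZA n \<Longrightarrow> x = 2 * t \<Longrightarrow> even2 n x"
  by (auto simp: even2_def)

lemma even2_0 [simp]: "even2 n 0"
  by (rule even2I[of 0]) auto

lemma even2_add: "even2 n x \<Longrightarrow> even2 n y \<Longrightarrow> even2 n (x + y)"
  unfolding even2_def by (metis ZA_add distrib_left)

lemma even2_diff: "even2 n x \<Longrightarrow> even2 n y \<Longrightarrow> even2 n (x - y)"
  unfolding even2_def by (metis ZA_diff right_diff_distrib)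

lemma even2_mult: "even2 n x \<Longrightarrow> y \<in> ZA n \<Longrightarrow> even2 n (y * x)"
  unfolding even2_def by (metis ZA_mult mult.left_commute)

lemma even2_mult_minus_1:
  assumes "even2 n (x - 1)" "even2 n (y - 1)" "x \<in> ZA n"
  shows "even2 n (x * y - 1)"
  using even2_add[OF even2_mult[OF assms(2,3)] assms(1)] by (simp add: algebra_simps)

lemma even2_square_diff:
  assumes "even2 n (x - y)" "x \<in> ZA n" "y \<in> ZA n"
  shows "even2 n (x ^ 2 - y ^ 2)"
  using even2_mult[OF assms(1), of "x + y"] assms(2,3)
  by (simp add: power2_eq_square algebra_simps ZA_add)

text \<open>Squaring is additive modulo 2.\<close>
lemma d_el_power_even2: "even2 n (d_el n j ^ 2 ^ k - d_el n (2 ^ k * j))"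
proof (induction k)
  case (Suc k)
  have dbl: "even2 n (d_el n i ^ 2 - d_el n (2 * i))" for i
  proof (rule even2I)
    have "alpha n powi i * alpha n powi (- i) = 1" by (simp add: power_int_minus)
    moreover have "alpha n powi (2 * i) = alpha n powi i * alpha n powi i"
      "alpha n powi (- (2 * i)) = alpha n powi (- i) * alpha n powi (- i)"
      by (simp_all flip: power_int_add)
    ultimately show "d_el n i ^ 2 - d_el n (2 * i) = 2 * d_el n i"
      by (simp add: d_el_def power2_eq_square algebra_simps)
  qed simp
  have "even2 n ((d_el n j ^ 2 ^ k) ^ 2 - d_el n (2 ^ k * j) ^ 2)"
    by (rule even2_square_diff[OF Suc]) auto
  from even2_add[OF this dbl[of "2 ^ k * j"]] show ?case
    by (simp flip: power_mult add: mult.commute mult.left_commute)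
qed simp

lemma d_el_reflect_even2:
  assumes "n \<ge> 1"
  shows "even2 n (d_el n (2 ^ (n - 1) - j) - d_el n j)"
proof (rule even2I)
  have "d_el n (2 ^ (n - 1) - j) = 1 - (alpha n powi (- j) + alpha n powi j)"
    using d_el_half_shift[OF assms, of "- j"] by (simp add: algebra_simps)
  then show "d_el n (2 ^ (n - 1) - j) - d_el n j = 2 * (- (alpha n powi (- j) + alpha n powi j))"
    by (simp add: d_el_def)
qed auto

lemma d_el_quarter:
  assumes "n \<ge> 2" "odd j"
  shows "d_el n (2 ^ (n - 2) * j) = 1"
proof -
  define w where "w = alpha n powi (2 ^ (n - 2) * j)"
  have two: "2 ^ (n - 2) * j + 2 ^ (n - 2) * j = int (2 ^ (n - 1)) * j"
  proof -
    have "n - 1 = Suc (n - 2)" using assms by simp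
    then show ?thesis by simp
  qed
  have "w * w = alpha n powi (int (2 ^ (n - 1)) * j)"
    unfolding two[symmetric] w_def by (subst power_int_add) simp_all
  also have "\<dots> = (alpha n ^ 2 ^ (n - 1)) powi j"
    by (simp only: power_int_mult power_int_of_nat)
  also have "\<dots> = (-1) powi j" using assms by (subst alpha_pow_half) simp_all
  also have "\<dots> = -1" using assms by simp
  finally have "w * (- w) = 1" by simp
  then have "inverse w = - w" by (rule inverse_unique)
  then show ?thesis
    by (simp add: d_el_def power_int_minus flip: w_def)
qed

lemma d_el_power_top_even2:
  assumes "n \<ge> 2" "odd j"
  shows "even2 n (d_el n j ^ 2 ^ (n - 2) - 1)"
  using d_el_power_even2[of n j "n - 2"] d_el_quarter[OF assms] by simp

text \<open>Modulo 2, \<open>\<tau>\<^bsup>2^k\<^esup>\<close> is \<open>\<alpha>\<^bsup>2^k\<^esup> + \<alpha>\<^bsup>-2^k\<^esup>\<close>, and for \<open>k = n - 2\<close> these are opposite fourth roots of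
  unity.\<close>
lemma tau_power_even2:
  assumes "n \<ge> 2"
  shows "even2 n (tau n ^ 2 ^ (n - 2))"
proof -
  define A B where "A = alpha n" and "B = inverse (alpha n)"
  have AB: "A ^ k * B ^ k = 1" for k
    by (simp add: A_def B_def flip: power_mult_distrib)
  have main: "even2 n (tau n ^ 2 ^ k - (A ^ 2 ^ k + B ^ 2 ^ k))" for k
  proof (induction k)
    case 0
    show ?case by (simp add: tau_def A_def B_def)
  next
    case (Suc k)
    define u where "u = A ^ 2 ^ k + B ^ 2 ^ k"
    have u: "u \<in> ZA n" by (auto simp: u_def A_def B_def)
    have "even2 n ((tau n ^ 2 ^ k) ^ 2 - u ^ 2)"
      by (rule even2_square_diff) (use Suc u in \<open>auto simp: u_def\<close>)
    moreover have "u ^ 2 = A ^ 2 ^ Suc k + B ^ 2 ^ Suc k + 2 * 1"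
      using AB[of "2 ^ k"] by (simp add: u_def power2_eq_square algebra_simps power_add[symmetric] mult_2)
    moreover have "even2 n (2 * 1)" by (rule even2I[of 1]) auto
    moreover have "(tau n ^ 2 ^ k) ^ 2 = tau n ^ 2 ^ Suc k"
      by (simp flip: power_mult add: mult.commute)
    ultimately have "even2 n (tau n ^ 2 ^ Suc k - (A ^ 2 ^ Suc k + B ^ 2 ^ Suc k + 2 * 1) + 2 * 1)"
      by (metis even2_add)
    moreover have "x - (y + z) + z = x - y" for x y z :: complex by simp
    ultimately show ?case by metis
  qed
  have "A ^ 2 ^ (n - 2) + B ^ 2 ^ (n - 2) = 0"
  proof -
    have "n - 1 = Suc (n - 2)" using assms by simp
    then have "A ^ 2 ^ (n - 2) * A ^ 2 ^ (n - 2) = -1"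
      using alpha_pow_half[of n] assms by (simp add: A_def mult_2 flip: power_add)
    then have "A ^ 2 ^ (n - 2) * (- (A ^ 2 ^ (n - 2))) = 1" by simp
    then have "inverse (A ^ 2 ^ (n - 2)) = - (A ^ 2 ^ (n - 2))" by (rule inverse_unique)
    then show ?thesis by (simp add: A_def B_def power_inverse)
  qed
  then show ?thesis using main[of "n - 2"] by simp
qed

lemma ieval_fps_X_nth: "(ieval f fps_X :: bit fps) $ i = of_int (coeff f i)"
proof (induction f arbitrary: i)
  case (pCons a f)
  have "(of_int a :: bit fps) = fps_const (of_int a)" by (simp add: fps_of_int)
  then show ?case using pCons by (cases i) (simp_all add: fps_X_mult_nth coeff_pCons)
qed simp

text \<open>Multiplied by a power of \<open>\<alpha>\<close>, a polynomial in \<open>\<tau>\<close> of degree below \<open>2\<^bsup>n-2\<^esup>\<close> becomes a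
  polynomial in \<open>\<alpha>\<close> of degree below \<open>2\<^bsup>n-1\<^esup>\<close>, and if the value is divisible by 2, so are all
  coefficients of the latter.  The higher terms are even by themselves.\<close>
lemma congX_of_even2:
  assumes n: "n \<ge> 2" and ev: "even2 n (ieval f (tau n))"
  shows "congX (2 ^ (n - 2)) (ieval f fps_X) 0"
proof -
  define e where "e = (2::nat) ^ (n - 2)"
  have e2: "2 ^ (n - 1) = 2 * e"
  proof -
    have "n - 1 = Suc (n - 2)" using n by simp
    then show ?thesis by (simp add: e_def)
  qed
  have e0: "e > 0" by (simp add: e_def)
  define c where "c i = coeff f i" for i
  define low where "low = (\<Sum>i<e. monom (c i) i)"
  have f: "f = low + monom 1 e * poly_shift e f"
    by (rule poly_eqI) (auto simp: low_def c_def coeff_sum coeff_monom_mult coeff_poly_shift)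
  have "even2 n (ieval f (tau n) - ieval (poly_shift e f) (tau n) * tau n ^ e)"
    using tau_power_even2[OF n] by (intro even2_diff ev even2_mult) (auto simp: e_def)
  moreover have "ieval f (tau n) = ieval low (tau n) + tau n ^ e * ieval (poly_shift e f) (tau n)"
    using arg_cong[OF f, of "\<lambda>p. ieval p (tau n)"] by simp
  ultimately have evlow: "even2 n (ieval low (tau n))" by (simp add: algebra_simps)
  \<comment> \<open>\<open>\<alpha>\<^bsup>e-1\<^esup> \<tau>\<^sup>i\<close> as a polynomial in \<open>\<alpha>\<close>; note that \<open>Phi 1 = X\<^sup>2 + 1\<close>\<close>
  define q where "q i = monom 1 (e - 1 - i) * Phi 1 ^ i" for i
  define p where "p = (\<Sum>i<e. smult (c i) (q i))"
  have "ieval p (alpha n) = alpha n ^ (e - 1) * ieval low (tau n)"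
  proof -
    have "ieval (q i) (alpha n) = alpha n ^ (e - 1) * tau n ^ i" if "i < e" for i
    proof -
      have "alpha n ^ (e - 1) * tau n ^ i = alpha n ^ (e - 1 - i) * (alpha n ^ i * tau n ^ i)"
        using that by (simp add: mult.assoc[symmetric] flip: power_add)
      also have "alpha n ^ i * tau n ^ i = (alpha n ^ 2 + 1) ^ i"
        by (simp add: tau_def power_mult_distrib[symmetric] power2_eq_square algebra_simps)
      finally show ?thesis by (simp add: q_def)
    qed
    then show ?thesis
      by (simp add: p_def low_def sum_distrib_left mult.left_commute)
  qed
  with evlow have "even2 n (ieval p (alpha n))" by (auto intro: even2_mult)
  then obtain r where r: "ieval p (alpha n) = 2 * ieval r (alpha n)"
    by (auto simp: even2_def ZA_def)
  obtain q1 r1 where qr: "pseudo_divmod r (Phi (n - 1)) = (q1, r1)" by force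
  note pd = pseudo_divmod[OF Phi_nonzero qr]
  have rr: "r = Phi (n - 1) * q1 + r1" using pd(1) by simp
  have r1: "r1 = 0 \<or> degree r1 < 2 * e" using pd(2) e2 by simp
  have "ieval (p - smult 2 r1) (alpha n) = 0"
  proof -
    have "alpha n ^ 2 ^ (n - Suc 0) = -1" using alpha_pow_half[of n] n by simp
    then show ?thesis using r by (simp add: rr)
  qed
  then have dv: "Phi (n - 1) dvd p - smult 2 r1"
    using Phi_dvd_if_root alpha_pow_half n by (metis One_nat_def Suc_1 Suc_leD)
  have "degree p \<le> 2 * e - 2"
    unfolding p_def
  proof (rule degree_sum_le)
    fix i assume "i \<in> {..<e}"
    then have i: "i < e" by simp
    have "degree (q i) \<le> (e - 1 - i) + 2 * i"
      unfolding q_def by (rule order_trans[OF degree_mult_le], rule add_mono)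
        (auto simp: degree_monom_eq intro: order_trans[OF degree_power_le])
    then show "degree (smult (c i) (q i)) \<le> 2 * e - 2"
      using i degree_smult_le[of "c i" "q i"] by linarith
  qed simp
  then have "degree p < 2 * e" using e0 by linarith
  moreover have "degree (smult 2 r1) < 2 * e" using r1 e0 by auto
  ultimately have "degree (p - smult 2 r1) < 2 ^ (n - 1)"
    unfolding e2 by (rule degree_diff_less)
  with dv have "p - smult 2 r1 = 0" by (rule Phi_dvd_imp_zero)
  then have p2: "p = smult 2 r1" by simp
  have cq: "coeff (q i) (e - 1 + i') = (if i' = i then 1 else 0)" if "i < e" "i \<le> i'" for i i'
  proof -
    have "e - 1 + i' - (e - 1 - i) = i + i'" "\<not> e - 1 + i' < e - 1 - i" using that by simp_all
    then have "coeff (q i) (e - 1 + i') = coeff (Phi 1 ^ i) (i + i')"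
      by (simp add: q_def coeff_monom_mult)
    moreover have "degree (Phi 1 ^ i) = 2 * i" by (simp add: degree_power_eq)
    moreover have "lead_coeff (Phi 1 ^ i) = 1" using lead_coeff_Phi[of 1] by (simp add: lead_coeff_power)
    ultimately show ?thesis using that by (auto simp: coeff_eq_0 mult_2)
  qed
  have even: "even (c i)" if "i < e" for i
  proof (rule ccontr)
    assume "odd (c i)"
    \<comment> \<open>the coefficient of \<open>X\<^bsup>e-1+M\<^esup>\<close> of \<open>p\<close> is \<open>c M\<close> plus even terms, for the largest \<open>M\<close> with \<open>c M\<close> odd\<close>
    define A where "A = {i. i < e \<and> odd (c i)}"
    have A: "finite A" "i \<in> A" using that \<open>odd (c i)\<close> by (auto simp: A_def)
    define M where "M = Max A"
    have "M \<in> A" unfolding M_def using A by (intro Max_in) auto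
    then have M: "M < e" "odd (c M)" by (auto simp: A_def)
    have evc: "even (c j)" if "M < j" "j < e" for j
    proof (rule ccontr)
      assume "odd (c j)"
      then have "j \<in> A" using that by (simp add: A_def)
      then have "j \<le> M" unfolding M_def using A by simp
      with that show False by simp
    qed
    have "coeff p (e - 1 + M) = (\<Sum>j<e. c j * coeff (q j) (e - 1 + M))"
      by (simp add: p_def coeff_sum)
    also have "\<dots> = c M * coeff (q M) (e - 1 + M) + (\<Sum>j\<in>{..<e} - {M}. c j * coeff (q j) (e - 1 + M))"
      using M by (simp add: sum.remove)
    finally have "coeff p (e - 1 + M) = c M + (\<Sum>j\<in>{..<e} - {M}. c j * coeff (q j) (e - 1 + M))"
      using cq[of M M] M by simp
    moreover have "even (\<Sum>j\<in>{..<e} - {M}. c j * coeff (q j) (e - 1 + M))"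
    proof (rule dvd_sum)
      fix j assume "j \<in> {..<e} - {M}"
      then show "even (c j * coeff (q j) (e - 1 + M))"
        using evc[of j] cq[of j M] by (cases "j < M") auto
    qed
    moreover have "even (coeff p (e - 1 + M))" by (simp add: p2)
    ultimately show False using M(2) by simp
  qed
  have "(of_int x :: bit) = 0" if "even x" for x using that by (auto elim!: evenE)
  then show ?thesis
    using even by (simp add: congX_def X_power_dvd_iff ieval_fps_X_nth e_def[symmetric] c_def)
qed

text \<open>With \<open>w = \<alpha>\<^sup>j\<close> the inverse of \<open>1 + w + 1/w\<close> is \<open>w (w - 1)/(w\<^sup>3 - 1)\<close>.  As \<open>w = (w\<^sup>3)\<^sup>s\<close> for some
  \<open>s\<close>, the quotient is a geometric sum in \<open>w\<^sup>3\<close>.\<close>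
lemma d_el_unit:
  assumes n: "n \<ge> 1" and j: "odd j"
  shows "d_el n j \<in> unitsA n"
proof -
  define w where "w = alpha n powi j"
  define v where "v = alpha n powi (- j)"
  have wv: "w * v = 1" by (simp add: w_def v_def power_int_minus)
  have w0: "w \<noteq> 0" by (simp add: w_def)
  have half: "w ^ 2 ^ (n - 1) = -1"
  proof -
    have "w ^ 2 ^ (n - 1) = (alpha n ^ 2 ^ (n - 1)) powi j"
      by (metis mult.commute power_int_mult power_int_of_nat w_def)
    then show ?thesis using j alpha_pow_half[OF n] by simp
  qed
  have w1: "w \<noteq> 1" using half by auto
  have full: "w ^ 2 ^ n = 1"
  proof -
    have "(2::nat) ^ n = 2 ^ (n - 1) * 2" using n by (metis power_minus_mult less_le_trans zero_less_one)
    then show ?thesis by (simp only: power_mult half) simp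
  qed
  have "coprime (3::nat) (2 ^ n)" "(2::nat) ^ n \<noteq> 1" using n by simp_all
  then obtain s y :: nat where sy: "3 * s = 2 ^ n * y + 1"
    using coprime_bezout_strong[of 3 "2 ^ n"] by auto
  define S where "S = (\<Sum>i<s. (w ^ 3) ^ i)"
  have "(w ^ 3 - 1) * S = (w ^ 3) ^ s - 1" by (simp add: S_def power_diff_1_eq)
  also have "(w ^ 3) ^ s = w ^ (2 ^ n * y + 1)" by (simp only: sy[symmetric] power_mult)
  also have "\<dots> = w" by (simp add: power_mult full)
  finally have S: "(w ^ 3 - 1) * S = w - 1" .
  have d: "d_el n j = 1 + w + v" by (simp add: d_el_def w_def v_def)
  have "(w - 1) * (d_el n j * (w * S)) = (w - 1) * (w + w * w + w * v) * S"
    unfolding d by (simp add: algebra_simps)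
  also have "\<dots> = (w ^ 3 - 1) * S" unfolding wv by (simp add: algebra_simps power3_eq_cube)
  finally have "(w - 1) * (d_el n j * (w * S)) = (w - 1) * 1" using S by simp
  then have "d_el n j * (w * S) = 1" using w1 by (metis mult_left_cancel right_minus_eq)
  then have "inverse (d_el n j) = w * S" by (rule inverse_unique)
  moreover have "w * S \<in> ZA n"
    unfolding w_def S_def by (intro ZA_mult ZA_sum ZA_power ZA_alpha_powi)
  ultimately show ?thesis by (simp add: unitsA_def)
qed

section \<open>The groups \<open>E\<close> and \<open>F\<close>\<close>

lemma odd_int_pos_cases:
  assumes "odd (j::int)" "1 \<le> j"
  obtains b where "j = int b" "odd b"
  using assms that[of "nat j"] by (simp add: even_nat_iff)

lemma D_grp_eq:
  "D_grp n = generate (Un_grp n) ((\<lambda>b. d_el n (int b)) ` d_index n)"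
proof -
  have "{d_el n j | j. odd j \<and> 1 \<le> j \<and> j \<le> 2 ^ (n - 1) - 3} = (\<lambda>b. d_el n (int b)) ` d_index n"
  proof (intro equalityI subsetI)
    fix x assume "x \<in> {d_el n j | j. odd j \<and> 1 \<le> j \<and> j \<le> 2 ^ (n - 1) - 3}"
    then obtain j where j: "x = d_el n j" "odd j" "1 \<le> j" "j \<le> 2 ^ (n - 1) - 3" by blast
    then obtain b where b: "j = int b" "odd b" by (metis odd_int_pos_cases)
    have "int (b + 3) \<le> int (2 ^ (n - 1))" using j b by simp
    then have "b + 3 \<le> 2 ^ (n - 1)" by (simp only: of_nat_le_iff)
    then show "x \<in> (\<lambda>b. d_el n (int b)) ` d_index n"
      using j b by (auto simp: d_index_def)
  next
    fix x assume "x \<in> (\<lambda>b. d_el n (int b)) ` d_index n"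
    then obtain b where b: "x = d_el n (int b)" "odd b" "b + 3 \<le> 2 ^ (n - 1)"
      by (auto simp: d_index_def)
    have "int (b + 3) \<le> int (2 ^ (n - 1))" using b(3) by (simp only: of_nat_le_iff)
    moreover have "1 \<le> b" using b(2) by (cases b) auto
    ultimately show "x \<in> {d_el n j | j. odd j \<and> 1 \<le> j \<and> j \<le> 2 ^ (n - 1) - 3}"
      using b by (intro CollectI exI[of _ "int b"]) auto
  qed
  then show ?thesis by (simp add: D_grp_def)
qed

lemma d_el_image_units: "n \<ge> 1 \<Longrightarrow> (\<lambda>b. d_el n (int b)) ` d_index n \<subseteq> unitsA n"
  by (auto simp: d_index_def intro!: d_el_unit)

lemma D_grp_products:
  assumes "n \<ge> 1"
  shows "D_grp n = {(\<Prod>b\<in>d_index n. d_el n (int b) powi a b) | a. True}"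
  unfolding D_grp_eq by (rule generate_Un_grp_eq) (use d_el_image_units[OF assms] in auto)

lemma subgroup_D_grp: "n \<ge> 1 \<Longrightarrow> subgroup (D_grp n) (Un_grp n)"
  unfolding D_grp_eq
  by (intro group.generate_is_subgroup group_Un_grp)
     (use d_el_image_units in \<open>simp add: carrier_Un_grp\<close>)

lemma d_el_in_D: "b \<in> d_index n \<Longrightarrow> d_el n (int b) \<in> D_grp n"
  unfolding D_grp_eq by (auto intro: generate.incl)

lemma E_grp_eq: "E_grp n = {x \<in> D_grp n. even2 n (x - 1)}"
  by (auto simp: E_grp_def cong2_def even2_def carrier_Zalpha)

lemma subgroup_E_grp:
  assumes "n \<ge> 1"
  shows "subgroup (E_grp n) (Un_grp n)"
proof (rule subgroup_Un_grpI)
  note D = subgroup_Un_grpD[OF subgroup_D_grp[OF assms]]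
  show "E_grp n \<subseteq> unitsA n" using D(1) by (auto simp: E_grp_eq)
  show "1 \<in> E_grp n" using D(2) by (simp add: E_grp_eq)
  fix x assume x: "x \<in> E_grp n"
  have xu: "x \<noteq> 0" "x \<in> ZA n" "inverse x \<in> ZA n"
    using x D(1) by (auto simp: E_grp_eq unitsA_def)
  have "even2 n (- inverse x * (x - 1))"
    using x xu by (intro even2_mult) (auto simp: E_grp_eq)
  then show "inverse x \<in> E_grp n"
    using x D(4) xu by (simp add: E_grp_eq algebra_simps)
  fix y assume y: "y \<in> E_grp n"
  show "x * y \<in> E_grp n"
    using x y D(3) xu by (auto simp: E_grp_eq intro: even2_mult_minus_1)
qed

lemma odds_less_index:
  assumes "n \<ge> 3" "b \<in> odds (n - 1)"
  shows "b \<in> d_index n"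
proof -
  have two: "2 ^ (n - 1) = 2 * (2::nat) ^ (n - 2)" "(2::nat) ^ (n - 2) \<ge> 2"
  proof -
    have "n - 1 = Suc (n - 2)" using assms by simp
    then show "2 ^ (n - 1) = 2 * (2::nat) ^ (n - 2)" by simp
    show "(2::nat) ^ (n - 2) \<ge> 2"
      using assms power_increasing[of 1 "n - 2" "2::nat"] by simp
  qed
  have "n - 1 - 1 = n - 2" by simp
  then have "odd b" "b < 2 ^ (n - 2)" using assms by (auto simp: odds_def)
  then have "b + 3 \<le> 2 ^ (n - 1)" using two by linarith
  then show ?thesis using \<open>odd b\<close> by (simp add: d_index_def)
qed

lemma one_in_index: "n \<ge> 3 \<Longrightarrow> 1 \<in> d_index n"
  using power_increasing[of 2 "n - 1" "2::nat"] by (simp add: d_index_def)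

lemma odds_mono: "m \<le> m' \<Longrightarrow> odds m \<subseteq> odds m'"
  unfolding odds_def by (auto intro: less_le_trans power_increasing)

lemma odds_le:
  assumes "b \<in> odds m"
  shows "b \<le> 2 ^ m"
proof -
  have "b < 2 ^ (m - 1)" using assms by (simp add: odds_def)
  also have "(2::nat) ^ (m - 1) \<le> 2 ^ m" by (rule power_increasing) simp_all
  finally show ?thesis by simp
qed

lemma odds_level_index:
  assumes "n \<ge> 3" "b \<in> odds (n - 1 - k)"
  shows "b \<in> d_index n"
proof (rule odds_less_index[OF assms(1)])
  have "odds (n - 1 - k) \<subseteq> odds (n - 1)" by (rule odds_mono) simp
  then show "b \<in> odds (n - 1)" using assms(2) by blast
qed

text \<open>The larger index of the generator for \<open>(k, b)\<close> lies between \<open>2\<^bsup>n-2-k\<^esup>\<close> and \<open>2\<^bsup>n-1-k\<^esup>\<close>, the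
  smaller one below; so the larger indices determine the generators.\<close>
lemma reflect_in_index:
  assumes n: "n \<ge> 3" and k: "k \<le> n - 3" and b: "b \<in> odds (n - 1 - k)" and "k \<noteq> 0 \<or> b \<noteq> 1"
  shows "2 ^ (n - 1 - k) - b \<in> d_index n" "2 ^ (n - 2 - k) < 2 ^ (n - 1 - k) - b"
    "2 ^ (n - 1 - k) - b < 2 ^ (n - 1 - k)" "b < 2 ^ (n - 2 - k)"
proof -
  have e: "n - 1 - k = Suc (n - 2 - k)" "n - 1 - k - 1 = n - 2 - k" using n k by simp_all
  then have two: "2 ^ (n - 1 - k) = 2 * (2::nat) ^ (n - 2 - k)" by simp
  have b': "odd b" "b < 2 ^ (n - 2 - k)" using b unfolding odds_def e(2) by auto
  have "odd (2 ^ (n - 1 - k) - b)" using b' e two by simp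
  moreover have "2 ^ (n - 1 - k) - b + 3 \<le> 2 ^ (n - 1)"
  proof (cases "k = 0")
    case True
    then have "b \<ge> 3" using assms(4) b'(1) by (cases b rule: nat.exhaust) (auto elim!: oddE)
    then show ?thesis using True b' two by simp
  next
    case False
    then have "(2::nat) ^ (n - 1 - k) \<le> 2 ^ (n - 2)" using n k by (intro power_increasing) auto
    moreover have "2 ^ (n - 1) = 2 * (2::nat) ^ (n - 2)"
    proof -
      have "n - 1 = Suc (n - 2)" using n by simp
      then show ?thesis by simp
    qed
    moreover have "(2::nat) ^ (n - 2) \<ge> 2" using n power_increasing[of 1 "n - 2" "2::nat"] by simp
    moreover have "b > 0" using b' by (cases b) auto
    ultimately show ?thesis by linarith
  qed
  ultimately show "2 ^ (n - 1 - k) - b \<in> d_index n" by (simp add: d_index_def)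
  show "2 ^ (n - 2 - k) < 2 ^ (n - 1 - k) - b" using b' two by linarith
  have "b > 0" using b' by (cases b) auto
  then show "2 ^ (n - 1 - k) - b < 2 ^ (n - 1 - k)" using b' two by linarith
  show "b < 2 ^ (n - 2 - k)" by (rule b')
qed

lemma A_set_eq: "A_set n k = int ` odds (n - 1 - k)"
proof (intro equalityI subsetI)
  have e: "n - 1 - k - 1 = n - 2 - k" by simp
  {
    fix j assume "j \<in> A_set n k"
    then have j: "odd j" "1 \<le> j" "j \<le> 2 ^ (n - 2 - k) - 1" by (auto simp: A_set_def)
    then obtain b where b: "j = int b" "odd b" by (metis odd_int_pos_cases)
    have "int b < int (2 ^ (n - 2 - k))" using j b by simp
    then have "b < 2 ^ (n - 2 - k)" by (simp only: of_nat_less_iff)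
    then show "j \<in> int ` odds (n - 1 - k)" using b by (auto simp: odds_def)
  next
    fix j assume "j \<in> int ` odds (n - 1 - k)"
    then obtain b where b: "j = int b" "odd b" "b < 2 ^ (n - 2 - k)" unfolding odds_def e by auto
    have "int b < int (2 ^ (n - 2 - k))" using b(3) by (simp only: of_nat_less_iff)
    moreover have "1 \<le> b" using b(2) by (cases b) auto
    ultimately show "j \<in> A_set n k" using b by (auto simp: A_set_def)
  }
qed

lemma F_index_iff:
  "j \<in> F_index n k \<longleftrightarrow> (\<exists>b. j = int b \<and> b \<in> odds (n - 1 - k) \<and> (k \<noteq> 0 \<or> b \<noteq> 1))"
  by (auto simp: F_index_def A_set_eq)

lemma factor_index_iff:
  "i \<in> factor_index n \<longleftrightarrow> i = None \<or>
    (\<exists>k b. i = Some (k, int b) \<and> k \<le> n - 3 \<and> b \<in> odds (n - 1 - k) \<and> (k \<noteq> 0 \<or> b \<noteq> 1))"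
  unfolding factor_index_def by (auto simp: F_index_iff image_iff)

lemma finite_factor_index [simp]: "finite (factor_index n)"
proof -
  have "finite (F_index n k)" for k by (auto simp: F_index_def A_set_eq)
  then show ?thesis by (simp add: factor_index_def)
qed

lemma d_el_reflect_int:
  assumes "b \<le> 2 ^ m"
  shows "d_el n (2 ^ m - int b) = d_el n (int (2 ^ m - b))"
  using assms by (simp add: of_nat_diff)

lemma E_gen_Some:
  assumes "n \<ge> 3" "k \<le> n - 3" "b \<in> odds (n - 1 - k)"
  shows "E_gen n (Some (k, int b)) = (d_el n (int (2 ^ (n - 1 - k) - b)) / d_el n (int b)) ^ 2 ^ k"
proof -
  have "b \<le> 2 ^ (n - 1 - k)"
    using assms(3) by (rule odds_le)
  then have "d_el n (2 ^ (n - 1 - k) - int b) = d_el n (int (2 ^ (n - 1 - k) - b))"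
    by (rule d_el_reflect_int)
  then have "E_gen n (Some (k, int b)) = d_el n (int b) powi (- int (2 ^ k)) * d_el n (int (2 ^ (n - 1 - k) - b)) ^ 2 ^ k"
    by (simp only: E_gen.simps) simp
  then show ?thesis
    by (simp only: power_int_minus power_int_of_nat power_divide) (simp add: divide_inverse mult.commute)
qed

text \<open>Modulo 2 the \<open>2\<^sup>k\<close>-th powers of the two units of a generator are the \<open>d\<^sub>j\<close> whose indices
  \<open>2\<^sup>k b\<close> and \<open>2\<^bsup>n-1\<^esup> - 2\<^sup>k b\<close> are exchanged by reflection.\<close>
lemma E_gen_in_E:
  assumes n: "n \<ge> 3" and i: "i \<in> factor_index n"
  shows "E_gen n i \<in> E_grp n"
proof (cases i)
  case None
  have "1 \<in> d_index n" using n by (rule one_in_index)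
  then have "d_el n 1 ^ 2 ^ (n - 2) \<in> D_grp n"
    using d_el_in_D[of 1 n] subgroup_Un_grp_power[OF subgroup_D_grp] n by simp
  moreover have "even2 n (d_el n 1 ^ 2 ^ (n - 2) - 1)"
    using n by (intro d_el_power_top_even2) auto
  ultimately show ?thesis using None by (simp add: E_grp_eq)
next
  case (Some p)
  then obtain k b where kb: "i = Some (k, int b)" "k \<le> n - 3" "b \<in> odds (n - 1 - k)" "k \<noteq> 0 \<or> b \<noteq> 1"
    using i by (auto simp: factor_index_iff)
  define c where "c = 2 ^ (n - 1 - k) - b"
  have c: "c \<in> d_index n" unfolding c_def using reflect_in_index[OF n kb(2-4)] by simp
  have b: "b \<in> d_index n" using n kb(3) by (rule odds_level_index)
  have bc: "b \<le> 2 ^ (n - 1 - k)" using kb(3) by (rule odds_le)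
  note D = subgroup_D_grp[of n]
  have D': "(d_el n (int c) / d_el n (int b)) ^ 2 ^ k \<in> D_grp n"
    unfolding divide_inverse using n
    by (intro subgroup_Un_grp_power[OF D] subgroup_Un_grpD(3)[OF D] subgroup_Un_grpD(4)[OF D] d_el_in_D b c) auto
  have "2 ^ k * int c = 2 ^ (n - 1) - 2 ^ k * int b"
  proof -
    have "(2::int) ^ k * 2 ^ (n - 1 - k) = 2 ^ (n - 1)" using kb(2) n by (simp flip: power_add)
    then show ?thesis using bc by (simp add: c_def of_nat_diff algebra_simps)
  qed
  then have "even2 n (d_el n (2 ^ k * int c) - d_el n (2 ^ k * int b))"
    using d_el_reflect_even2[of n "2 ^ k * int b"] n by simp
  then have "even2 n ((d_el n (int c) ^ 2 ^ k - d_el n (2 ^ k * int c)) + (d_el n (2 ^ k * int c) - d_el n (2 ^ k * int b))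
      - (d_el n (int b) ^ 2 ^ k - d_el n (2 ^ k * int b)))"
    by (rule even2_diff[OF even2_add[OF d_el_power_even2] d_el_power_even2])
  then have e: "even2 n (d_el n (int c) ^ 2 ^ k - d_el n (int b) ^ 2 ^ k)" by simp
  have "inverse (d_el n (int b)) \<in> ZA n"
    using d_el_unit[of n "int b"] b n by (auto simp: unitsA_def d_index_def)
  then have "even2 n (inverse (d_el n (int b)) ^ 2 ^ k * (d_el n (int c) ^ 2 ^ k - d_el n (int b) ^ 2 ^ k))"
    by (intro even2_mult[OF e]) auto
  moreover have "inverse (d_el n (int b)) ^ 2 ^ k * d_el n (int b) ^ 2 ^ k = 1"
    by (simp flip: power_mult_distrib)
  moreover have "(d_el n (int c) / d_el n (int b)) ^ 2 ^ k = inverse (d_el n (int b)) ^ 2 ^ k * d_el n (int c) ^ 2 ^ k"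
    by (simp only: divide_inverse power_mult_distrib mult.commute)
  ultimately have "even2 n ((d_el n (int c) / d_el n (int b)) ^ 2 ^ k - 1)"
    by (simp only: right_diff_distrib)
  then show ?thesis using D' E_gen_Some[OF n kb(2,3)] kb(1) by (simp add: E_grp_eq c_def)
qed

lemma odds_fold:
  fixes f :: "nat \<Rightarrow> 'a::comm_monoid_mult"
  assumes m: "m \<ge> 3"
  shows "(\<Prod>b\<in>odds m. f b) = (\<Prod>b\<in>odds (m - 1). f b * f (2 ^ (m - 1) - b))"
proof -
  define L where "L = (2::nat) ^ (m - 2)"
  have two: "2 ^ (m - 1) = 2 * L" "m - 1 - 1 = m - 2"
  proof -
    have "m - 1 = Suc (m - 2)" using m by simp
    then show "2 ^ (m - 1) = 2 * L" by (simp add: L_def)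
  qed simp
  have ev: "even L" using m by (simp add: L_def)
  define Lo where "Lo = odds (m - 1)"
  have o: "odds m = {b. odd b \<and> b < 2 * L}" "Lo = {b. odd b \<and> b < L}"
    by (simp_all only: odds_def two L_def Lo_def)
  define g where "g b = 2 * L - b" for b
  have un: "odds m = Lo \<union> g ` Lo"
  proof (intro equalityI subsetI)
    fix x assume x: "x \<in> odds m"
    show "x \<in> Lo \<union> g ` Lo"
    proof (cases "x < L")
      case True
      then show ?thesis using x by (auto simp: o)
    next
      case False
      moreover have "x \<noteq> L" using x ev by (auto simp: o)
      ultimately have "g x \<in> Lo" "x = g (g x)" using x ev by (auto simp: o g_def)
      then show ?thesis by blast
    qed
  next
    fix x assume x: "x \<in> Lo \<union> g ` Lo"
    have "2 * L - y < 2 * L" if "odd y" "y < L" for y using that by (cases y) auto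
    then show "x \<in> odds m" using x ev by (auto simp: o g_def)
  qed
  have disj: "Lo \<inter> g ` Lo = {}" by (auto simp: o g_def)
  have inj: "inj_on g (Lo)" by (auto simp: inj_on_def o g_def)
  have "(\<Prod>b\<in>odds m. f b) = (\<Prod>b\<in>Lo. f b) * (\<Prod>b\<in>g ` Lo. f b)"
    unfolding un using disj by (intro prod.union_disjoint) (auto simp: Lo_def)
  also have "(\<Prod>b\<in>g ` Lo. f b) = (\<Prod>b\<in>Lo. f (g b))"
    using inj by (simp add: prod.reindex)
  finally show ?thesis unfolding prod.distrib g_def two(1) Lo_def .
qed

lemma odds_2: "odds 2 = {1}"
  unfolding odds_def by (auto simp: less_2_cases_iff)

text \<open>Modulo \<open>t\<^bsup>2^(m-2)\<^esup>\<close> the units with indices \<open>b\<close> and \<open>2\<^bsup>m-1\<^esup> - b\<close> agree, so a relation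
  can be folded onto the indices below \<open>2\<^bsup>m-2\<^esup>\<close>.\<close>
lemma relation_fold:
  fixes a :: "nat \<Rightarrow> nat"
  defines "a' \<equiv> \<lambda>m b. a b + a (2 ^ (m - 1) - b)"
  assumes m: "m \<ge> 3" and rel: "congX (2 ^ (m - 2)) (\<Prod>b\<in>odds m. uk b ^ a b) 1"
  shows "congX (2 ^ (m - 2)) (\<Prod>b\<in>odds (m - 1). uk b ^ a' m b) 1"
proof -
  have refl: "congX (2 ^ (m - 2)) (uk b) (uk (2 ^ (m - 1) - b))" if b: "b \<in> odds (m - 1)" for b
  proof -
    have le: "b \<le> 2 ^ (m - 1)"
      using b by (rule odds_le)
    have "odd b" using b by (simp add: odds_def)
    moreover have "odd (2 ^ (m - 1) - b)" using le \<open>odd b\<close> m by simp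
    moreover have "int b = (-1) * int (2 ^ (m - 1) - b) + 1 * 2 ^ (m - 1)"
      using le by (simp add: of_nat_diff)
    ultimately have "congX (2 ^ (m - 1 - 1)) (Dk b) (Dk (2 ^ (m - 1) - b))"
      using m by (intro Dk_cong[where s = "-1" and q = 1]) auto
    moreover have "m - 1 - 1 = m - 2" by simp
    ultimately show ?thesis unfolding uk_def by (intro congX_add) simp_all
  qed
  have "congX (2 ^ (m - 2)) (\<Prod>b\<in>odds (m - 1). uk b ^ a' m b)
    (\<Prod>b\<in>odds (m - 1). uk b ^ a b * uk (2 ^ (m - 1) - b) ^ a (2 ^ (m - 1) - b))"
    unfolding a'_def power_add by (intro congX_prod congX_mult congX_power congX_refl refl)
  also have "(\<Prod>b\<in>odds (m - 1). uk b ^ a b * uk (2 ^ (m - 1) - b) ^ a (2 ^ (m - 1) - b))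
    = (\<Prod>b\<in>odds m. uk b ^ a b)"
    using odds_fold[OF m, of "\<lambda>b. uk b ^ a b"] by simp
  finally show ?thesis using rel congX_trans by blast
qed

text \<open>The part of a product that is lost by folding consists of powers of quotients of the two units
  with reflected indices.\<close>
lemma product_fold:
  fixes a :: "nat \<Rightarrow> nat"
  defines "a' \<equiv> \<lambda>m b. a b + a (2 ^ (m - 1) - b)"
  assumes m: "m \<ge> 3" and S: "subgroup S (Un_grp n)"
    and gen: "\<And>b. b \<in> odds (m - 1) \<Longrightarrow> a (2 ^ (m - 1) - b) \<noteq> 0 \<Longrightarrow>
        (d_el n (int (2 ^ (m - 1) - b)) / d_el n (int b)) ^ N \<in> S"
    and base: "(\<Prod>b\<in>odds (m - 1). d_el n (int b) ^ (N * a' m b)) \<in> S"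
  shows "(\<Prod>b\<in>odds m. d_el n (int b) ^ (N * a b)) \<in> S"
proof -
  define r where "r b = (d_el n (int (2 ^ (m - 1) - b)) / d_el n (int b)) ^ N" for b
  have "(\<Prod>b\<in>odds m. d_el n (int b) ^ (N * a b)) =
    (\<Prod>b\<in>odds (m - 1). d_el n (int b) ^ (N * a b) *
       d_el n (int (2 ^ (m - 1) - b)) ^ (N * a (2 ^ (m - 1) - b)))"
    by (rule odds_fold[OF m])
  also have "\<dots> = (\<Prod>b\<in>odds (m - 1). d_el n (int b) ^ (N * a' m b) * r b ^ a (2 ^ (m - 1) - b))"
  proof (intro prod.cong refl)
    fix b
    show "d_el n (int b) ^ (N * a b) * d_el n (int (2 ^ (m - 1) - b)) ^ (N * a (2 ^ (m - 1) - b))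
      = d_el n (int b) ^ (N * a' m b) * r b ^ a (2 ^ (m - 1) - b)"
      by (simp add: a'_def r_def power_add distrib_left power_divide flip: power_mult)
  qed
  finally have eq: "(\<Prod>b\<in>odds m. d_el n (int b) ^ (N * a b)) =
    (\<Prod>b\<in>odds (m - 1). d_el n (int b) ^ (N * a' m b)) *
    (\<Prod>b\<in>odds (m - 1). r b ^ a (2 ^ (m - 1) - b))"
    by (simp add: prod.distrib)
  have "r b ^ a (2 ^ (m - 1) - b) \<in> S" if b: "b \<in> odds (m - 1)" for b
  proof (cases "a (2 ^ (m - 1) - b) = 0")
    case True
    then show ?thesis using subgroup_Un_grpD(2)[OF S] by simp
  next
    case False
    then have "r b \<in> S" unfolding r_def using gen b by blast
    then show ?thesis by (rule subgroup_Un_grp_power[OF S])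
  qed
  then have "(\<Prod>b\<in>odds (m - 1). r b ^ a (2 ^ (m - 1) - b)) \<in> S"
    by (rule subgroup_Un_grp_prod[OF S])
  with base show ?thesis unfolding eq by (rule subgroup_Un_grpD(3)[OF S])
qed

text \<open>Descent over the levels \<open>m = n - k\<close>.  A relation is folded onto the lower half of the indices
  at the expense of generators of level \<open>k\<close>.  The folded exponents are even, and half of them
  satisfy a relation of the next level because squaring is injective.\<close>
lemma relation_descent:
  assumes n: "n \<ge> 3" and S: "subgroup S (Un_grp n)"
    and top: "d_el n (int 1) ^ 2 ^ (n - 2) \<in> S"
    and gen: "\<And>m b. 3 \<le> m \<Longrightarrow> m \<le> n \<Longrightarrow> b \<in> odds (m - 1) \<Longrightarrow> m \<noteq> n \<or> b \<noteq> 1 \<Longrightarrow>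
        (d_el n (int (2 ^ (m - 1) - b)) / d_el n (int b)) ^ 2 ^ (n - m) \<in> S"
    and "3 \<le> m" "m \<le> n" "m = n \<Longrightarrow> a (2 ^ (n - 1) - 1) = 0"
    and "congX (2 ^ (m - 2)) (\<Prod>b\<in>odds m. uk b ^ a b) 1"
  shows "(\<Prod>b\<in>odds m. d_el n (int b) ^ (2 ^ (n - m) * a b)) \<in> S"
  using assms(5-8)
proof (induction m arbitrary: a rule: nat_induct_at_least)
  case base
  define a' where "a' b = a b + a (2 ^ (3 - 1) - b)" for b
  have o: "odds (3 - 1) = {1}" using odds_2 by simp
  have "congX (2 ^ (3 - 2)) (\<Prod>b\<in>odds (3 - 1). uk b ^ a' b) 1"
    unfolding a'_def by (rule relation_fold) (use base in simp_all)
  then have "even (a' 1)" using even_exponents[of "3 - 1" a' 1] o by simp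
  then obtain c where c: "a' 1 = 2 * c" by blast
  have "n - 2 = Suc (n - 3)" using n by simp
  then have "2 ^ (n - 3) * a' 1 = 2 ^ (n - 2) * c" unfolding c by simp
  then have "(\<Prod>b\<in>odds (3 - 1). d_el n (int b) ^ (2 ^ (n - 3) * a' b)) = (d_el n (int 1) ^ 2 ^ (n - 2)) ^ c"
    unfolding o by (simp flip: power_mult)
  then have *: "(\<Prod>b\<in>odds (3 - 1). d_el n (int b) ^ (2 ^ (n - 3) * a' b)) \<in> S"
    using subgroup_Un_grp_power[OF S top] by simp
  show ?case
  proof (rule product_fold[OF _ S])
    fix b assume b: "b \<in> odds (3 - 1)" and nz: "a (2 ^ (3 - 1) - b) \<noteq> 0"
    show "(d_el n (int (2 ^ (3 - 1) - b)) / d_el n (int b)) ^ 2 ^ (n - 3) \<in> S"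
    proof (rule gen)
      show "3 \<noteq> n \<or> b \<noteq> 1" using base(2) nz by auto
    qed (use b n in auto)
  qed (use * in \<open>simp_all add: a'_def\<close>)
next
  case (Suc m)
  define a' where "a' b = a b + a (2 ^ (Suc m - 1) - b)" for b
  have m3: "3 \<le> Suc m" "m \<ge> 2" using Suc.hyps by simp_all
  have rel: "congX (2 ^ (m - 1)) (\<Prod>b\<in>odds m. uk b ^ a' b) 1"
    using relation_fold[OF m3(1) Suc.prems(3)] by (simp add: a'_def)
  have ev: "even (a' b)" if "b \<in> odds m" for b
    by (rule even_exponents[OF m3(2) rel that])
  define h where "h b = a' b div 2" for b
  have h: "a' b = 2 * h b" if "b \<in> odds m" for b using ev[OF that] by (simp add: h_def)
  have "(\<Prod>b\<in>odds m. uk b ^ a' b) = (\<Prod>b\<in>odds m. (uk b ^ h b) ^ 2)"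
    by (intro prod.cong refl) (simp add: h mult.commute flip: power_mult)
  also have "\<dots> = (\<Prod>b\<in>odds m. uk b ^ h b) ^ 2" by (rule prod_power_distrib[symmetric])
  finally have sq: "(\<Prod>b\<in>odds m. uk b ^ a' b) = (\<Prod>b\<in>odds m. uk b ^ h b) ^ 2" .
  have "m - 1 = Suc (m - 2)" using Suc.hyps by simp
  then have "congX (2 * 2 ^ (m - 2)) ((\<Prod>b\<in>odds m. uk b ^ h b) ^ 2) 1"
    using rel unfolding sq by simp
  then have relh: "congX (2 ^ (m - 2)) (\<Prod>b\<in>odds m. uk b ^ h b) 1" by (rule congX_sqrt)
  have "(\<Prod>b\<in>odds m. d_el n (int b) ^ (2 ^ (n - m) * h b)) \<in> S"
    by (rule Suc.IH) (use Suc.prems relh in auto)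
  also have "(\<Prod>b\<in>odds m. d_el n (int b) ^ (2 ^ (n - m) * h b)) =
    (\<Prod>b\<in>odds m. d_el n (int b) ^ (2 ^ (n - Suc m) * a' b))"
  proof (intro prod.cong refl)
    fix b assume b: "b \<in> odds m"
    have "n - m = Suc (n - Suc m)" using Suc.prems by simp
    then have "2 ^ (n - m) * h b = 2 ^ (n - Suc m) * a' b" using h[OF b] by simp
    then show "d_el n (int b) ^ (2 ^ (n - m) * h b) = d_el n (int b) ^ (2 ^ (n - Suc m) * a' b)"
      by simp
  qed
  finally have *: "(\<Prod>b\<in>odds (Suc m - 1). d_el n (int b) ^ (2 ^ (n - Suc m) * a' b)) \<in> S" by simp
  show ?case
  proof (rule product_fold[OF m3(1) S])
    fix b assume b: "b \<in> odds (Suc m - 1)" and nz: "a (2 ^ (Suc m - 1) - b) \<noteq> 0"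
    show "(d_el n (int (2 ^ (Suc m - 1) - b)) / d_el n (int b)) ^ 2 ^ (n - Suc m) \<in> S"
    proof (rule gen)
      show "Suc m \<noteq> n \<or> b \<noteq> 1" using Suc.prems(2) nz by auto
    qed (use b Suc.prems m3 in auto)
  qed (use * in \<open>simp add: a'_def\<close>)
qed

definition F_gens :: "nat \<Rightarrow> complex set" where
  "F_gens n = generate (Un_grp n) (E_gen n ` factor_index n)"

lemma E_gen_units: "n \<ge> 3 \<Longrightarrow> E_gen n ` factor_index n \<subseteq> unitsA n"
  using E_gen_in_E[of n] subgroup_Un_grpD(1)[OF subgroup_E_grp[of n]] by auto

lemma subgroup_F_gens: "n \<ge> 3 \<Longrightarrow> subgroup (F_gens n) (Un_grp n)"
  unfolding F_gens_def
  by (intro group.generate_is_subgroup group_Un_grp) (simp add: carrier_Un_grp E_gen_units)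

text \<open>A product with nonnegative exponents is a polynomial in \<open>\<tau>\<close>, so the congruence modulo 2 becomes
  a relation between power series.\<close>
lemma natural_product_in_F_gens:
  fixes a :: "nat \<Rightarrow> nat"
  assumes n: "n \<ge> 3" and ev: "even2 n ((\<Prod>b\<in>d_index n. d_el n (int b) ^ a b) - 1)"
  shows "(\<Prod>b\<in>d_index n. d_el n (int b) ^ a b) \<in> F_gens n"
proof -
  define top where "top = (2::nat) ^ (n - 1) - 1"
  note top = odds_eq_insert[of n, folded top_def]
  define a' where "a' = a(top := 0)"
  have a': "(\<Prod>b\<in>odds n. x b ^ a' b) = (\<Prod>b\<in>d_index n. x b ^ a b)" for x :: "nat \<Rightarrow> 'a::comm_monoid_mult"
  proof -
    have "(\<Prod>b\<in>d_index n. x b ^ a' b) = (\<Prod>b\<in>d_index n. x b ^ a b)"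
      using top n by (intro prod.cong) (auto simp: a'_def)
    then show ?thesis using top n by (simp add: a'_def)
  qed
  define f where "f = (\<Prod>b\<in>d_index n. (1 + dick b) ^ a b) - 1"
  have "even2 n (ieval f (tau n))"
    using ev by (simp add: f_def d_el_tau)
  then have "congX (2 ^ (n - 2)) (ieval f fps_X) 0" by (rule congX_of_even2[rotated]) (use n in simp)
  then have "congX (2 ^ (n - 2)) (\<Prod>b\<in>d_index n. uk b ^ a b) 1"
    by (simp add: f_def congX_def uk_def Dk_def)
  then have rel: "congX (2 ^ (n - 2)) (\<Prod>b\<in>odds n. uk b ^ a' b) 1" by (simp only: a')
  have gens: "E_gen n i \<in> F_gens n" if "i \<in> factor_index n" for i
    unfolding F_gens_def using that by (intro generate.incl) auto
  have "(\<Prod>b\<in>odds n. d_el n (int b) ^ (2 ^ (n - n) * a' b)) \<in> F_gens n"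
  proof (rule relation_descent[OF n subgroup_F_gens[OF n]])
    show "d_el n (int 1) ^ 2 ^ (n - 2) \<in> F_gens n"
      using gens[of None] by (simp add: factor_index_iff)
    fix m b assume m: "3 \<le> m" "m \<le> n" and b: "b \<in> odds (m - 1)" and ne: "m \<noteq> n \<or> b \<noteq> 1"
    have e: "n - 1 - (n - m) = m - 1" "n - m \<le> n - 3" "n - m \<noteq> 0 \<or> b \<noteq> 1" using m ne by auto
    then have "Some (n - m, int b) \<in> factor_index n"
      using b by (auto simp: factor_index_iff)
    then have "E_gen n (Some (n - m, int b)) \<in> F_gens n" by (rule gens)
    then show "(d_el n (int (2 ^ (m - 1) - b)) / d_el n (int b)) ^ 2 ^ (n - m) \<in> F_gens n"
      using E_gen_Some[OF n e(2), of b] b unfolding e(1) by simp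
  next
    show "a' (2 ^ (n - 1) - 1) = 0" by (simp add: a'_def top_def)
  qed (use n rel in auto)
  then show ?thesis by (simp add: a')
qed

text \<open>Negative exponents are removed by multiplication with \<open>2\<^bsup>n-2\<^esup>\<close>-th powers of the \<open>d\<^sub>b\<close>; these are
  congruent to 1 modulo 2, hence in \<open>F\<close> by the case of nonnegative exponents.\<close>
lemma E_grp_eq_F_gens:
  assumes n: "n \<ge> 3"
  shows "E_grp n = F_gens n"
proof
  have E: "subgroup (E_grp n) (Un_grp n)" using n by (intro subgroup_E_grp) simp
  show "F_gens n \<subseteq> E_grp n"
    unfolding F_gens_def using E_gen_in_E[OF n]
    by (intro group.generate_subgroup_incl[OF group_Un_grp _ E]) auto
  note F = subgroup_F_gens[OF n]
  show "E_grp n \<subseteq> F_gens n"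
  proof
    fix x assume x: "x \<in> E_grp n"
    then obtain a where a: "x = (\<Prod>b\<in>d_index n. d_el n (int b) powi a b)"
      using n by (auto simp: E_grp_eq D_grp_products)
    define N where "N = (2::nat) ^ (n - 2)"
    define c where "c = (\<Sum>b\<in>d_index n. nat \<bar>a b\<bar>)"
    have c: "0 \<le> a b + int (N * c)" if "b \<in> d_index n" for b
    proof -
      have "nat \<bar>a b\<bar> \<le> c" unfolding c_def using that by (intro member_le_sum) auto
      also have "c \<le> N * c" by (simp add: N_def)
      finally show ?thesis by linarith
    qed
    have pw: "d_el n (int b) ^ N \<in> F_gens n" if b: "b \<in> d_index n" for b
    proof -
      have "(\<Prod>j\<in>d_index n. d_el n (int j) ^ (if j = b then N else 0)) =
        (\<Prod>j\<in>d_index n. if j = b then d_el n (int j) ^ N else 1)"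
        by (intro prod.cong) auto
      also have "\<dots> = d_el n (int b) ^ N" using b by simp
      finally have eq: "(\<Prod>j\<in>d_index n. d_el n (int j) ^ (if j = b then N else 0)) = d_el n (int b) ^ N" .
      have "even2 n (d_el n (int b) ^ N - 1)"
        unfolding N_def using n b by (intro d_el_power_top_even2) (auto simp: d_index_def)
      with natural_product_in_F_gens[OF n, of "\<lambda>j. if j = b then N else 0"] show ?thesis
        unfolding eq by blast
    qed
    define y where "y = (\<Prod>b\<in>d_index n. (d_el n (int b) ^ N) ^ c)"
    have y: "y \<in> F_gens n" unfolding y_def
      by (intro subgroup_Un_grp_prod[OF F] subgroup_Un_grp_power[OF F] pw)
    have "x * y = (\<Prod>b\<in>d_index n. d_el n (int b) ^ nat (a b + int (N * c)))"
      unfolding a y_def prod.distrib[symmetric]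
    proof (intro prod.cong refl)
      fix b assume b: "b \<in> d_index n"
      have "d_el n (int b) powi a b * (d_el n (int b) ^ N) ^ c = d_el n (int b) powi (a b + int (N * c))"
        by (simp add: power_int_add del: of_nat_mult flip: power_mult)
      also have "\<dots> = d_el n (int b) ^ nat (a b + int (N * c))"
        using c[OF b] by (simp add: power_int_def del: of_nat_mult)
      finally show "d_el n (int b) powi a b * (d_el n (int b) ^ N) ^ c = d_el n (int b) ^ nat (a b + int (N * c))" .
    qed
    moreover have "y \<in> E_grp n" using y \<open>F_gens n \<subseteq> E_grp n\<close> by blast
    then have "x * y \<in> E_grp n" by (rule subgroup_Un_grpD(3)[OF E x])
    ultimately have "x * y \<in> F_gens n"
      using natural_product_in_F_gens[OF n, of "\<lambda>b. nat (a b + int (N * c))"] by (simp add: E_grp_eq)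
    then have "x * y * inverse y \<in> F_gens n"
      using subgroup_Un_grpD(3,4)[OF F] y by blast
    moreover have "y \<noteq> 0" using y subgroup_Un_grpD(1)[OF F] by (auto simp: unitsA_def)
    ultimately show "x \<in> F_gens n" by (simp add: mult.assoc)
  qed
qed

lemma F_grp_eq_F_gens:
  assumes n: "n \<ge> 3"
  shows "F_grp n = F_gens n"
proof -
  interpret K: comm_group "Un_grp n" by (rule comm_group_Un_grp)
  note F = subgroup_F_gens[OF n]
  have gens: "E_gen n i \<in> F_gens n" if "i \<in> factor_index n" for i
    unfolding F_gens_def using that by (intro generate.incl) auto
  have q: "q_el n k j ^ 2 ^ k = E_gen n (Some (k, j))" for k j
    by (simp add: q_el_def power_mult_distrib power_int_minus power_inverse power_int_def nat_power_eq)
  have Fk: "Fk_grp n k = generate (Un_grp n) ((\<lambda>j. E_gen n (Some (k, j))) ` F_index n k)"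
    if "k \<le> n - 3" for k
    unfolding Fk_grp_def subgroup_prod_def q
  proof (rule K.generate_UN_cyc)
    show "(\<lambda>j. E_gen n (Some (k, j))) ` F_index n k \<subseteq> carrier (Un_grp n)"
      using E_gen_units[OF n] that
      by (auto simp: carrier_Un_grp factor_index_def simp del: E_gen.simps)
  qed
  have Fk_sub: "Fk_grp n k \<subseteq> F_gens n" if "k \<le> n - 3" for k
    unfolding Fk[OF that] by (rule K.generate_subgroup_incl[OF _ F])
      (use gens that in \<open>auto simp: factor_index_def simp del: E_gen.simps\<close>)
  show ?thesis
  proof
    have "subgroup_prod (Un_grp n) {0..n - 3} (Fk_grp n) \<subseteq> F_gens n"
      unfolding subgroup_prod_def
      by (intro K.generate_subgroup_incl[OF _ F] UN_least Fk_sub) simp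
    moreover have "cyc (Un_grp n) (d_el n 1 ^ 2 ^ (n - 2)) \<subseteq> F_gens n"
      unfolding cyc_def by (rule K.generate_subgroup_incl[OF _ F])
        (use gens[of None] in \<open>simp add: factor_index_def\<close>)
    ultimately show "F_grp n \<subseteq> F_gens n"
      unfolding F_grp_def by (intro K.generate_subgroup_incl[OF _ F]) auto
    have units: "subgroup (unitsA n) (Un_grp n)" using K.subgroup_self by (simp add: carrier_Un_grp)
    have sub: "cyc (Un_grp n) (d_el n 1 ^ 2 ^ (n - 2)) \<union> subgroup_prod (Un_grp n) {0..n - 3} (Fk_grp n) \<subseteq> unitsA n"
      using \<open>cyc (Un_grp n) (d_el n 1 ^ 2 ^ (n - 2)) \<subseteq> F_gens n\<close>
        \<open>subgroup_prod (Un_grp n) {0..n - 3} (Fk_grp n) \<subseteq> F_gens n\<close> subgroup_Un_grpD(1)[OF F] by blast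
    have Fs: "subgroup (F_grp n) (Un_grp n)"
      unfolding F_grp_def by (rule K.generate_is_subgroup) (use sub in \<open>simp add: carrier_Un_grp\<close>)
    have "E_gen n i \<in> F_grp n" if i: "i \<in> factor_index n" for i
    proof (cases i)
      case None
      have "d_el n 1 ^ 2 ^ (n - 2) \<in> cyc (Un_grp n) (d_el n 1 ^ 2 ^ (n - 2))"
        unfolding cyc_def by (rule generate.incl) simp
      then show ?thesis unfolding F_grp_def None by (auto intro: generate.incl)
    next
      case (Some p)
      then obtain k j where kj: "i = Some (k, j)" "k \<le> n - 3" "j \<in> F_index n k"
        using i by (auto simp: factor_index_def)
      have "E_gen n i \<in> Fk_grp n k" unfolding Fk[OF kj(2)] kj(1) using kj(3)
        by (intro generate.incl) auto
      then have "E_gen n i \<in> subgroup_prod (Un_grp n) {0..n - 3} (Fk_grp n)"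
        unfolding subgroup_prod_def using kj(2) by (intro generate.incl) auto
      then show ?thesis unfolding F_grp_def by (auto intro: generate.incl)
    qed
    then show "F_gens n \<subseteq> F_grp n"
      unfolding F_gens_def by (intro K.generate_subgroup_incl[OF _ Fs]) auto
  qed
qed

text \<open>The largest index of a unit occurring in a generator; with respect to it the exponents of the
  generators form a triangular matrix.\<close>
fun lead :: "nat \<Rightarrow> (nat \<times> int) option \<Rightarrow> nat" where
  "lead n None = 1"
| "lead n (Some (k, j)) = 2 ^ (n - 1 - k) - nat j"

text \<open>The exponent of \<open>d\<^sub>b\<close> in a generator.\<close>
fun expo :: "nat \<Rightarrow> (nat \<times> int) option \<Rightarrow> nat \<Rightarrow> int" where
  "expo n None b = (if b = 1 then 2 ^ (n - 2) else 0)"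
| "expo n (Some (k, j)) b =
    (if b = lead n (Some (k, j)) then 2 ^ k else 0) + (if b = nat j then - (2 ^ k) else 0)"

lemma lead_in_index: "n \<ge> 3 \<Longrightarrow> i \<in> factor_index n \<Longrightarrow> lead n i \<in> d_index n"
  using reflect_in_index(1) one_in_index
  by (auto simp: factor_index_iff)

lemma inj_lead:
  assumes n: "n \<ge> 3"
  shows "inj_on (lead n) (factor_index n)"
proof -
  have rng: "2 ^ (n - 2 - k) < lead n (Some (k, int b))" "lead n (Some (k, int b)) < 2 ^ (n - 1 - k)"
    if "k \<le> n - 3" "b \<in> odds (n - 1 - k)" "k \<noteq> 0 \<or> b \<noteq> 1" for k b
    using reflect_in_index(2,3)[OF n that] by simp_all
  have less: "lead n (Some (k', int b')) < lead n (Some (k, int b))"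
    if "k \<le> n - 3" "b \<in> odds (n - 1 - k)" "k \<noteq> 0 \<or> b \<noteq> 1"
      "k' \<le> n - 3" "b' \<in> odds (n - 1 - k')" "k' \<noteq> 0 \<or> b' \<noteq> 1" "k < k'" for k b k' b'
  proof -
    have "(2::nat) ^ (n - 1 - k') \<le> 2 ^ (n - 2 - k)" using that n by (intro power_increasing) auto
    with rng(1)[of k b] rng(2)[of k' b'] that show ?thesis by linarith
  qed
  show ?thesis
  proof (rule inj_onI)
    fix i i' assume i: "i \<in> factor_index n" "i' \<in> factor_index n" and eq: "lead n i = lead n i'"
    have gt1: "lead n i > 1" if "i \<in> factor_index n" "i \<noteq> None" for i
    proof -
      from that obtain k b where kb: "i = Some (k, int b)" "k \<le> n - 3" "b \<in> odds (n - 1 - k)" "k \<noteq> 0 \<or> b \<noteq> 1"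
        by (auto simp: factor_index_iff)
      have "(1::nat) \<le> 2 ^ (n - 2 - k)" by simp
      with rng(1)[OF kb(2-4)] show ?thesis unfolding kb(1) by linarith
    qed
    show "i = i'"
    proof (cases "i = None \<or> i' = None")
      case True
      then show ?thesis using gt1 i eq by (metis lead.simps(1) less_irrefl)
    next
      case False
      then obtain k b k' b' where
        kb: "i = Some (k, int b)" "k \<le> n - 3" "b \<in> odds (n - 1 - k)" "k \<noteq> 0 \<or> b \<noteq> 1" and
        kb': "i' = Some (k', int b')" "k' \<le> n - 3" "b' \<in> odds (n - 1 - k')" "k' \<noteq> 0 \<or> b' \<noteq> 1"
        using i by (auto simp: factor_index_iff)
      have "k = k'"
        using less[OF kb(2-4) kb'(2-4)] less[OF kb'(2-4) kb(2-4)] eq kb(1) kb'(1)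
        by (metis less_irrefl linorder_neqE_nat)
      moreover have "b = b'"
      proof -
        have "b < 2 ^ (n - 2 - k)" "b' < 2 ^ (n - 2 - k)"
          using reflect_in_index(4)[OF n] kb kb' \<open>k = k'\<close> by auto
        moreover have "(2::nat) ^ (n - 2 - k) \<le> 2 ^ (n - 1 - k)" by (intro power_increasing) auto
        moreover have "2 ^ (n - 1 - k) - b = 2 ^ (n - 1 - k) - b'" using eq kb(1) kb'(1) \<open>k = k'\<close> by simp
        ultimately show ?thesis by linarith
      qed
      ultimately show ?thesis using kb kb' by simp
    qed
  qed
qed

lemma expo_support:
  assumes n: "n \<ge> 3" and i: "i \<in> factor_index n" and b: "expo n i b \<noteq> 0"
  shows "b \<le> lead n i"
proof (cases i)
  case None
  then show ?thesis using b by (simp split: if_splits)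
next
  case (Some p)
  then obtain k c where kc: "i = Some (k, int c)" "k \<le> n - 3" "c \<in> odds (n - 1 - k)" "k \<noteq> 0 \<or> c \<noteq> 1"
    using i by (auto simp: factor_index_iff)
  have "c < lead n i" using reflect_in_index(2,4)[OF n kc(2-4)] kc(1) by simp
  then show ?thesis using b kc(1) by (auto split: if_splits)
qed

lemma expo_lead:
  assumes n: "n \<ge> 3" and i: "i \<in> factor_index n"
  shows "expo n i (lead n i) \<noteq> 0"
proof (cases i)
  case (Some p)
  then obtain k c where kc: "i = Some (k, int c)" "k \<le> n - 3" "c \<in> odds (n - 1 - k)" "k \<noteq> 0 \<or> c \<noteq> 1"
    using i by (auto simp: factor_index_iff)
  have "c < lead n i" using reflect_in_index(2,4)[OF n kc(2-4)] kc(1) by simp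
  then show ?thesis using kc(1) by auto
qed simp

lemma E_gen_expo:
  assumes n: "n \<ge> 3" and i: "i \<in> factor_index n"
  shows "E_gen n i = (\<Prod>b\<in>d_index n. d_el n (int b) powi expo n i b)"
proof -
  have delta: "(\<Prod>b\<in>d_index n. d_el n (int b) powi (if b = x then z else 0)) = d_el n (int x) powi z"
    if "x \<in> d_index n" for x z
  proof -
    have "(\<Prod>b\<in>d_index n. d_el n (int b) powi (if b = x then z else 0))
      = (\<Prod>b\<in>d_index n. if b = x then d_el n (int b) powi z else 1)"
      by (intro prod.cong) auto
    then show ?thesis using that by simp
  qed
  show ?thesis
  proof (cases i)
    case None
    have "1 \<in> d_index n" using lead_in_index[OF n i] None by simp
    from delta[OF this, of "2 ^ (n - 2)"] show ?thesis
      using None by (simp add: power_int_def nat_power_eq)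
  next
    case (Some p)
    then obtain k c where kc: "i = Some (k, int c)" "k \<le> n - 3" "c \<in> odds (n - 1 - k)" "k \<noteq> 0 \<or> c \<noteq> 1"
      using i by (auto simp: factor_index_iff)
    have c: "c \<in> d_index n" using n kc(3) by (rule odds_level_index)
    have l: "lead n i \<in> d_index n" using lead_in_index[OF n i] .
    have "(\<Prod>b\<in>d_index n. d_el n (int b) powi expo n i b) =
      d_el n (int (lead n i)) powi (2 ^ k) * d_el n (int c) powi (- (2 ^ k))"
      unfolding delta[OF l, symmetric] delta[OF c, symmetric] prod.distrib[symmetric]
      by (intro prod.cong refl) (simp add: kc(1) power_int_add)
    also have "\<dots> = (d_el n (int (lead n i)) / d_el n (int c)) ^ 2 ^ k"
    proof -
      have "z powi (2 ^ k) = z ^ 2 ^ k" for z :: complex by (simp add: power_int_def nat_power_eq)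
      then show ?thesis by (simp only: power_int_minus power_divide divide_inverse power_mult_distrib power_inverse)
    qed
    finally show ?thesis using E_gen_Some[OF n kc(2,3)] kc(1) by simp
  qed
qed

lemma prod_power_int: "(\<Prod>x\<in>A. f x) powi k = (\<Prod>x\<in>A. f x powi k)" for f :: "'b \<Rightarrow> 'a::field"
  by (induction A rule: infinite_finite_induct) (simp_all add: power_int_mult_distrib)

lemma power_int_sum: "x \<noteq> 0 \<Longrightarrow> x powi (\<Sum>i\<in>A. f i) = (\<Prod>i\<in>A. x powi f i)" for x :: "'a::field"
  by (induction A rule: infinite_finite_induct) (simp_all add: power_int_add)

text \<open>Among the generators that occur in a relation, only the one with the largest leading index
  contributes to the exponent of the unit with that index.\<close>
lemma E_gen_independent:
  fixes e :: "(nat \<times> int) option \<Rightarrow> int"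
  assumes n: "n \<ge> 3" and rel: "(\<Prod>i\<in>factor_index n. E_gen n i powi e i) = 1"
    and i: "i \<in> factor_index n"
  shows "e i = 0"
proof (rule ccontr)
  assume ei: "e i \<noteq> 0"
  have "(\<Prod>i\<in>factor_index n. E_gen n i powi e i) =
    (\<Prod>i\<in>factor_index n. \<Prod>b\<in>d_index n. d_el n (int b) powi (expo n i b * e i))"
    by (intro prod.cong refl) (simp add: E_gen_expo[OF n] power_int_mult prod_power_int)
  also have "\<dots> = (\<Prod>b\<in>d_index n. \<Prod>i\<in>factor_index n. d_el n (int b) powi (expo n i b * e i))"
    by (rule prod.swap)
  also have "\<dots> = (\<Prod>b\<in>d_index n. d_el n (int b) powi (\<Sum>i\<in>factor_index n. expo n i b * e i))"
    by (intro prod.cong refl) (simp add: power_int_sum)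
  finally have "(\<Prod>b\<in>d_index n. d_el n (int b) powi (\<Sum>i\<in>factor_index n. expo n i b * e i)) = 1"
    using rel by simp
  from d_el_independent[OF _ this] n
  have zero: "(\<Sum>i\<in>factor_index n. expo n i b * e i) = 0" if "b \<in> d_index n" for b using that by simp
  define T where "T = {i \<in> factor_index n. e i \<noteq> 0}"
  have T: "finite T" "T \<noteq> {}" using i ei by (auto simp: T_def)
  then have "Max (lead n ` T) \<in> lead n ` T" by (intro Max_in) auto
  then obtain i0 where i0: "i0 \<in> T" "lead n i0 = Max (lead n ` T)" by auto
  then have i0': "i0 \<in> factor_index n" "e i0 \<noteq> 0" by (auto simp: T_def)
  have others: "expo n i (lead n i0) * e i = 0" if "i \<in> factor_index n - {i0}" for i
  proof (rule ccontr)
    assume *: "expo n i (lead n i0) * e i \<noteq> 0"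
    then have "i \<in> T" using that by (auto simp: T_def)
    then have "lead n i \<le> lead n i0" unfolding i0(2) using T by simp
    moreover have "lead n i0 \<le> lead n i" using expo_support[OF n, of i] that * by auto
    ultimately have "i = i0" using inj_lead[OF n] that i0' by (auto dest: inj_onD)
    then show False using that by simp
  qed
  have "(\<Sum>i\<in>factor_index n. expo n i (lead n i0) * e i) = expo n i0 (lead n i0) * e i0"
    using i0'(1) others by (subst sum.remove[of _ i0]) (auto simp: sum.neutral)
  then show False using zero[OF lead_in_index[OF n i0'(1)]] expo_lead[OF n i0'(1)] i0'(2) by simp
qed

theorem E_grp_direct_product:
  assumes n: "n \<ge> 3"
  shows "is_internal_direct_product (Un_grp n) (factor_index n) (\<lambda>i. cyc (Un_grp n) (E_gen n i)) (E_grp n)"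
  unfolding E_grp_eq_F_gens[OF n] F_gens_def
  by (rule internal_direct_product_Un_grp) (use E_gen_units[OF n] E_gen_independent[OF n] in auto)

section \<open>The Galois group and the trace\<close>

text \<open>The field \<open>\<rat>(\<alpha>)\<close>, with denominators cleared so that only integer polynomials occur.\<close>
definition QA :: "nat \<Rightarrow> complex set" where
  "QA n = {ieval p (alpha n) / of_int k | p k. k \<noteq> 0}"

lemma QA_I: "k \<noteq> 0 \<Longrightarrow> x = ieval p (alpha n) / of_int k \<Longrightarrow> x \<in> QA n"
  by (auto simp: QA_def)

lemma QA_add: "x \<in> QA n \<Longrightarrow> y \<in> QA n \<Longrightarrow> x + y \<in> QA n"
proof -
  assume "x \<in> QA n" "y \<in> QA n"
  then obtain p k q l where "k \<noteq> 0" "x = ieval p (alpha n) / of_int k" "l \<noteq> 0" "y = ieval q (alpha n) / of_int l"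
    by (auto simp: QA_def)
  then have "k * l \<noteq> 0" "x + y = ieval (smult l p + smult k q) (alpha n) / of_int (k * l)"
    by (simp_all add: add_frac_eq algebra_simps)
  then show ?thesis by (rule QA_I)
qed

lemma QA_mult: "x \<in> QA n \<Longrightarrow> y \<in> QA n \<Longrightarrow> x * y \<in> QA n"
proof -
  assume "x \<in> QA n" "y \<in> QA n"
  then obtain p k q l where "k \<noteq> 0" "x = ieval p (alpha n) / of_int k" "l \<noteq> 0" "y = ieval q (alpha n) / of_int l"
    by (auto simp: QA_def)
  then have "k * l \<noteq> 0" "x * y = ieval (p * q) (alpha n) / of_int (k * l)" by simp_all
  then show ?thesis by (rule QA_I)
qed

lemma QA_uminus: "x \<in> QA n \<Longrightarrow> - x \<in> QA n"
proof -
  assume "x \<in> QA n"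
  then obtain p k where "k \<noteq> 0" "x = ieval p (alpha n) / of_int k" by (auto simp: QA_def)
  then have "k \<noteq> 0" "- x = ieval (- p) (alpha n) / of_int k" by simp_all
  then show ?thesis by (rule QA_I)
qed

lemma ZA_subset_QA: "ZA n \<subseteq> QA n"
  by (auto simp: ZA_def intro: QA_I[of 1])

lemma QA_inverse:
  assumes n: "n \<ge> 1" and x: "x \<in> QA n" "x \<noteq> 0"
  shows "inverse x \<in> QA n"
proof -
  obtain p k where pk: "k \<noteq> 0" "x = ieval p (alpha n) / of_int k" using x by (auto simp: QA_def)
  then have p0: "ieval p (alpha n) \<noteq> 0" using x by auto
  then have "\<not> Phi (n - 1) dvd p"
    using Phi_dvd_imp_conjugate_zero alpha_pow_half[OF n] by blast
  then obtain g r where gr: "Phi (n - 1) dvd p * g - [:r:]" "r \<noteq> 0" by (rule cofactor_nonzero)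
  have "ieval (p * g - [:r:]) (alpha n) = 0"
    using gr(1) alpha_pow_half[OF n] by (rule Phi_dvd_imp_conjugate_zero)
  then have "ieval p (alpha n) * ieval g (alpha n) = of_int r" by simp
  then have "ieval g (alpha n) / of_int r = inverse (ieval p (alpha n))"
    using gr(2) p0 by (simp add: field_simps)
  moreover have "inverse x = of_int k * inverse (ieval p (alpha n))"
    by (simp add: pk(2) divide_inverse mult.commute)
  ultimately have "inverse x = ieval (smult k g) (alpha n) / of_int r"
    by (simp only: ieval_smult times_divide_eq_right[symmetric])
  with gr(2) show ?thesis by (rule QA_I)
qed

lemma Qalpha_simps [simp]:
  "x \<otimes>\<^bsub>Qalpha n\<^esub> y = x * y" "\<one>\<^bsub>Qalpha n\<^esub> = 1" "x \<oplus>\<^bsub>Qalpha n\<^esub> y = x + y"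
  by (simp_all add: Qalpha_def ring_of_type_algebra_def)

lemma type_algebra_m_inv: "x \<noteq> 0 \<Longrightarrow> inv\<^bsub>ring_of_type_algebra\<^esub> x = inverse (x :: complex)"
proof -
  assume "x \<noteq> 0"
  interpret R: field "ring_of_type_algebra :: complex ring" by rule
  show ?thesis
    by (rule R.inv_unique'[symmetric]) (use \<open>x \<noteq> 0\<close> in \<open>simp_all add: ring_of_type_algebra_def\<close>)
qed

lemma carrier_Qalpha:
  assumes n: "n \<ge> 1"
  shows "carrier (Qalpha n) = QA n"
proof -
  let ?R = "ring_of_type_algebra :: complex ring"
  define G where "G = generate_field ?R {alpha n}"
  have "x \<in> QA n" if "x \<in> G" for x
    using that unfolding G_def
  proof (induction rule: generate_field.induct)
    case one
    then show ?case using ZA_subset_QA ZA_1 by (auto simp: ring_of_type_algebra_def)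
  next
    case (incl h)
    then show ?case using ZA_subset_QA ZA_alpha by auto
  next
    case (a_inv h)
    then show ?case unfolding type_algebra_a_inv by (intro QA_uminus)
  next
    case (m_inv h)
    have "h \<noteq> 0" using m_inv.hyps by (auto simp: ring_of_type_algebra_def)
    then show ?case using m_inv.IH n by (simp add: type_algebra_m_inv QA_inverse)
  next
    case (eng_add h1 h2)
    then show ?case using QA_add by (auto simp: ring_of_type_algebra_def)
  next
    case (eng_mult h1 h2)
    then show ?case using QA_mult by (auto simp: ring_of_type_algebra_def)
  qed
  moreover have "x \<in> G" if xQ: "x \<in> QA n" for x
  proof -
    have one: "1 \<in> G" using generate_field.one[of ?R "{alpha n}"]
      by (simp add: G_def ring_of_type_algebra_def)
    have um: "- x \<in> G" if "x \<in> G" for x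
      using generate_field.a_inv[of x ?R "{alpha n}"] that by (simp add: G_def)
    have add: "x + y \<in> G" and mult: "x * y \<in> G" if "x \<in> G" "y \<in> G" for x y
      using generate_field.eng_add[of x ?R "{alpha n}" y] generate_field.eng_mult[of x ?R "{alpha n}" y] that
      by (simp_all add: G_def ring_of_type_algebra_def)
    have inv: "inverse x \<in> G" if "x \<in> G" "x \<noteq> 0" for x
      using generate_field.m_inv[of x ?R "{alpha n}"] that
      by (simp add: G_def type_algebra_m_inv) (simp add: ring_of_type_algebra_def)
    have "alpha n \<in> G" using generate_field.incl[of "alpha n" "{alpha n}" ?R]
      by (simp add: G_def)
    then have "ieval p (alpha n) \<in> G" for p
      by (intro ieval_closed) (auto intro: one um add mult)
    moreover have int: "of_int k \<in> G" for k
      by (intro of_int_closed) (auto intro: one um add)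
    moreover obtain p k where "k \<noteq> 0" "x = ieval p (alpha n) / of_int k"
      using xQ by (auto simp: QA_def)
    ultimately show ?thesis using int inv mult by (simp add: divide_inverse)
  qed
  ultimately show ?thesis by (auto simp: Qalpha_def G_def)
qed

lemma odd_power_half:
  assumes "n \<ge> 1" "odd m"
  shows "(alpha n ^ m) ^ 2 ^ (n - 1) = -1"
proof -
  have "(alpha n ^ m) ^ 2 ^ (n - 1) = (alpha n ^ 2 ^ (n - 1)) ^ m"
    by (simp flip: power_mult add: mult.commute)
  then show ?thesis using assms by (simp only: alpha_pow_half) simp
qed

lemma conjugate_zero_iff:
  assumes "n \<ge> 1" "odd m"
  shows "ieval p (alpha n ^ m) = 0 \<longleftrightarrow> ieval p (alpha n) = 0"
  using Phi_dvd_if_root Phi_dvd_imp_conjugate_zero odd_power_half[OF assms] alpha_pow_half[OF assms(1)]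
  by blast

text \<open>The automorphism \<open>\<alpha> \<mapsto> \<alpha>\<^sup>m\<close>.  The chosen value does not depend on the fraction that
  represents \<open>x\<close>.\<close>
definition sig :: "nat \<Rightarrow> nat \<Rightarrow> complex \<Rightarrow> complex" where
  "sig n m = (\<lambda>x\<in>QA n. SOME y. \<exists>p k. k \<noteq> 0 \<and> x = ieval p (alpha n) / of_int k \<and> y = ieval p (alpha n ^ m) / of_int k)"

lemma sig_eval:
  assumes nm: "n \<ge> 1" "odd m" and k: "k \<noteq> 0"
  shows "sig n m (ieval p (alpha n) / of_int k) = ieval p (alpha n ^ m) / of_int k"
proof -
  define x where "x = ieval p (alpha n) / of_int k"
  let ?P = "\<lambda>y. \<exists>p k. k \<noteq> 0 \<and> x = ieval p (alpha n) / of_int k \<and> y = ieval p (alpha n ^ m) / of_int k"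
  have uniq: "y = ieval p (alpha n ^ m) / of_int k" if "?P y" for y
  proof -
    from that obtain q l where q: "l \<noteq> 0" "x = ieval q (alpha n) / of_int l" "y = ieval q (alpha n ^ m) / of_int l"
      by blast
    have "ieval (smult l p - smult k q) (alpha n) = 0"
      using q(1,2) k by (simp add: x_def frac_eq_eq mult.commute)
    then have "ieval (smult l p - smult k q) (alpha n ^ m) = 0"
      using conjugate_zero_iff[OF nm] by blast
    then show ?thesis using q(1,3) k by (simp add: frac_eq_eq mult.commute)
  qed
  have "?P (ieval p (alpha n ^ m) / of_int k)" using k by (auto simp: x_def)
  then have "?P (SOME y. ?P y)" by (rule someI)
  then have "(SOME y. ?P y) = ieval p (alpha n ^ m) / of_int k" by (rule uniq)
  moreover have "x \<in> QA n" using k by (auto simp: x_def intro: QA_I)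
  ultimately show ?thesis by (simp add: sig_def flip: x_def)
qed

lemma sig_ieval:
  assumes "n \<ge> 1" "odd m"
  shows "sig n m (ieval p (alpha n)) = ieval p (alpha n ^ m)"
  using sig_eval[OF assms, of 1 p] by simp

lemma sig_in_Gal:
  assumes n: "n \<ge> 1" and m: "odd m"
  shows "sig n m \<in> Gal n"
proof -
  note sig = sig_eval[OF n m]
  have closed: "ieval p (alpha n ^ m) / of_int k \<in> QA n" if "k \<noteq> 0" for p and k :: int
    using that by (intro QA_I[of k _ "p \<circ>\<^sub>p monom 1 m"]) simp_all
  have hom: "sig n m \<in> ring_hom (Qalpha n) (Qalpha n)"
  proof (rule ring_hom_memI)
    fix x assume "x \<in> carrier (Qalpha n)"
    then obtain p k where x: "k \<noteq> 0" "x = ieval p (alpha n) / of_int k"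
      by (auto simp: carrier_Qalpha[OF n] QA_def)
    then show "sig n m x \<in> carrier (Qalpha n)"
      using closed by (simp add: carrier_Qalpha[OF n] sig)
    fix y assume "y \<in> carrier (Qalpha n)"
    then obtain q l where y: "l \<noteq> 0" "y = ieval q (alpha n) / of_int l"
      by (auto simp: carrier_Qalpha[OF n] QA_def)
    have kl: "k * l \<noteq> 0" using x y by simp
    have "x * y = ieval (p * q) (alpha n) / of_int (k * l)" using x y by simp
    then have "sig n m (x * y) = ieval (p * q) (alpha n ^ m) / of_int (k * l)" using sig[OF kl] by metis
    then show "sig n m (x \<otimes>\<^bsub>Qalpha n\<^esub> y) = sig n m x \<otimes>\<^bsub>Qalpha n\<^esub> sig n m y"
      using x y by (simp add: sig)
    have "x + y = ieval (smult l p + smult k q) (alpha n) / of_int (k * l)"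
      using x y by (simp add: add_frac_eq algebra_simps)
    then have "sig n m (x + y) = ieval (smult l p + smult k q) (alpha n ^ m) / of_int (k * l)"
      using sig[OF kl] by metis
    then show "sig n m (x \<oplus>\<^bsub>Qalpha n\<^esub> y) = sig n m x \<oplus>\<^bsub>Qalpha n\<^esub> sig n m y"
      using x y by (simp add: sig add_frac_eq algebra_simps)
  next
    show "sig n m \<one>\<^bsub>Qalpha n\<^esub> = \<one>\<^bsub>Qalpha n\<^esub>" using sig_ieval[OF n m, of 1] by simp
  qed
  have inj: "inj_on (sig n m) (QA n)"
  proof (rule inj_onI)
    fix x y assume "x \<in> QA n" "y \<in> QA n" and eq: "sig n m x = sig n m y"
    then obtain p k q l where x: "k \<noteq> 0" "x = ieval p (alpha n) / of_int k"
      and y: "l \<noteq> 0" "y = ieval q (alpha n) / of_int l" by (auto simp: QA_def)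
    have "ieval p (alpha n ^ m) / of_int k = ieval q (alpha n ^ m) / of_int l"
      using eq x y by (simp add: sig)
    then have "ieval (smult l p - smult k q) (alpha n ^ m) = 0"
      using x(1) y(1) by (simp add: frac_eq_eq mult.commute)
    then have "ieval (smult l p - smult k q) (alpha n) = 0"
      using conjugate_zero_iff[OF n m] by blast
    then show "x = y" using x y by (simp add: frac_eq_eq mult.commute)
  qed
  have surj: "y \<in> sig n m ` QA n" if y: "y \<in> QA n" for y
  proof -
    from y obtain p k where pk: "k \<noteq> 0" "y = ieval p (alpha n) / of_int k" by (auto simp: QA_def)
    have "coprime m (2 ^ n)" using m by simp
    moreover have "(2::nat) ^ n \<noteq> 1" using n by simp
    ultimately obtain a b :: nat where ab: "m * a = 2 ^ n * b + 1"
      using coprime_bezout_strong[of m "2 ^ n"] by auto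
    have "(alpha n ^ m) ^ a = alpha n ^ (2 ^ n * b + 1)" by (simp only: ab[symmetric] power_mult)
    also have "\<dots> = alpha n" by (simp add: power_mult)
    finally have inv: "(alpha n ^ m) ^ a = alpha n" .
    have "sig n m (ieval (p \<circ>\<^sub>p monom 1 a) (alpha n) / of_int k) = y"
      using sig[OF pk(1), of "p \<circ>\<^sub>p monom 1 a"] inv pk by simp
    moreover have "ieval (p \<circ>\<^sub>p monom 1 a) (alpha n) / of_int k \<in> QA n" using pk(1) by (rule QA_I) (rule refl)
    ultimately show ?thesis by blast
  qed
  have "sig n m ` QA n \<subseteq> QA n"
    using ring_hom_closed[OF hom] by (auto simp: carrier_Qalpha[OF n])
  with inj surj have "bij_betw (sig n m) (QA n) (QA n)" by (auto simp: bij_betw_def)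
  moreover have "sig n m \<in> extensional (QA n)" by (simp add: sig_def)
  ultimately show ?thesis using hom
    by (simp add: Gal_def ring_iso_def carrier_Qalpha[OF n])
qed

lemma alpha_pow_cis: "alpha n ^ k = cis (2 * pi * real k / real (2 ^ n))"
  by (simp add: alpha_pow_int cis_conv_exp mult_ac)

lemma alpha_pow_bij: "bij_betw (\<lambda>k. alpha n ^ k) {..<2 ^ n} {z. z ^ 2 ^ n = 1}"
  using bij_betw_roots_unity[of "2 ^ n"] by (simp add: alpha_pow_cis)

definition odd_res :: "nat \<Rightarrow> nat set" where
  "odd_res n = {m. odd m \<and> m < 2 ^ n}"

lemma finite_odd_res [simp]: "finite (odd_res n)"
  by (rule finite_subset[of _ "{..<2 ^ n}"]) (auto simp: odd_res_def)

text \<open>The image of \<open>\<alpha>\<close> is again a root of the minimal polynomial and determines the automorphism.\<close>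
lemma Gal_imp_sig:
  assumes n: "n \<ge> 1" and h: "h \<in> Gal n"
  shows "\<exists>m\<in>odd_res n. h = sig n m"
proof -
  have hom: "h \<in> ring_hom (Qalpha n) (Qalpha n)" and ext: "h \<in> extensional (QA n)"
    using h by (auto simp: Gal_def ring_iso_def carrier_Qalpha[OF n])
  have add: "h (x + y) = h x + h y" and mult: "h (x * y) = h x * h y" if "x \<in> QA n" "y \<in> QA n" for x y
    using ring_hom_add[OF hom, of x y] ring_hom_mult[OF hom, of x y] that
    by (simp_all add: carrier_Qalpha[OF n])
  have one: "h 1 = 1" using ring_hom_one[OF hom] by simp
  have ZQ: "x \<in> QA n" if "x \<in> ZA n" for x using that ZA_subset_QA by blast
  have zero: "h 0 = 0" using add[of 0 0] ZQ by simp
  have neg: "h (- x) = - h x" if "x \<in> QA n" for x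
    using add[OF that QA_uminus[OF that]] zero by (simp add: eq_neg_iff_add_eq_0 add.commute)
  have nat: "h (of_nat k) = of_nat k" for k
  proof (induction k)
    case (Suc k)
    have "of_nat k \<in> ZA n" using ZA_of_int[of "int k" n] by simp
    then show ?case using Suc add[of 1 "of_nat k"] ZQ one by simp
  qed (simp add: zero)
  have int: "h (of_int k) = of_int k" for k
  proof (cases "k \<ge> 0")
    case True
    then show ?thesis using nat[of "nat k"] by simp
  next
    case False
    have "of_nat (nat (- k)) \<in> ZA n" using ZA_of_int[of "- k" n] False by simp
    then show ?thesis using False neg[of "of_nat (nat (- k))"] nat[of "nat (- k)"] ZQ by simp
  qed
  define b where "b = h (alpha n)"
  have ev: "h (ieval p (alpha n)) = ieval p b" for p
  proof (induction p)
    case (pCons a p)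
    have "ieval p (alpha n) \<in> ZA n" by (auto simp: ZA_def)
    then have "h (of_int a + alpha n * ieval p (alpha n)) = of_int a + b * ieval p b"
    proof (subst add)
      have "h (alpha n * ieval p (alpha n)) = b * ieval p b"
        using mult[OF ZQ ZQ, OF ZA_alpha \<open>ieval p (alpha n) \<in> ZA n\<close>] pCons by (simp add: b_def)
      then show "h (of_int a) + h (alpha n * ieval p (alpha n)) = of_int a + b * ieval p b"
        by (simp add: int)
    qed (use \<open>ieval p (alpha n) \<in> ZA n\<close> in \<open>auto intro!: ZQ\<close>)
    then show ?case by simp
  qed (simp add: zero)
  have "ieval (Phi (n - 1)) b = h (ieval (Phi (n - 1)) (alpha n))" by (simp only: ev)
  also have "\<dots> = 0" by (simp only: ieval_Phi alpha_pow_half[OF n]) (simp add: zero)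
  finally have bh: "b ^ 2 ^ (n - 1) = -1" by (simp add: eq_neg_iff_add_eq_0)
  have "(2::nat) ^ n = 2 ^ (n - 1) * 2" using n by (metis power_minus_mult less_le_trans zero_less_one)
  then have "b ^ 2 ^ n = 1" by (simp only: power_mult bh) simp
  then obtain m where m: "m < 2 ^ n" "b = alpha n ^ m"
    using alpha_pow_bij[of n] unfolding bij_betw_def by (metis (mono_tags, lifting) imageE lessThan_iff mem_Collect_eq)
  have "odd m"
  proof
    assume "even m"
    have "b ^ 2 ^ (n - 1) = (alpha n ^ 2 ^ (n - 1)) ^ m"
      unfolding m(2) by (simp flip: power_mult add: mult.commute)
    also have "\<dots> = 1" using \<open>even m\<close> by (simp only: alpha_pow_half[OF n]) simp
    finally show False using bh by simp
  qed
  have "h = sig n m"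
  proof (rule extensionalityI[OF ext])
    show "sig n m \<in> extensional (QA n)" by (simp add: sig_def)
    fix x assume "x \<in> QA n"
    then obtain p k where pk: "k \<noteq> 0" "x = ieval p (alpha n) / of_int k" by (auto simp: QA_def)
    have "h (of_int k * x) = of_int k * h x" using \<open>x \<in> QA n\<close> ZQ by (subst mult) (auto simp: int)
    moreover have "h (of_int k * x) = ieval p b" using pk ev[of p] by simp
    ultimately have "h x = ieval p b / of_int k" using pk(1) by (simp add: field_simps)
    then show "h x = sig n m x" using sig_eval[OF n \<open>odd m\<close> pk(1)] pk(2) m(2) by simp
  qed
  then show ?thesis using m(1) \<open>odd m\<close> by (auto simp: odd_res_def)
qed

lemma tr_ieval:
  assumes n: "n \<ge> 1"
  shows "tr n (ieval p (alpha n)) = (\<Sum>m\<in>odd_res n. ieval p (alpha n ^ m))"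
proof -
  have "inj_on (sig n) (odd_res n)"
  proof (rule inj_onI)
    fix m m' assume m: "m \<in> odd_res n" "m' \<in> odd_res n" and eq: "sig n m = sig n m'"
    have "alpha n ^ m = alpha n ^ m'"
      using sig_ieval[OF n, of m "monom 1 1"] sig_ieval[OF n, of m' "monom 1 1"] m eq
      by (simp add: odd_res_def)
    then show "m = m'" using alpha_pow_bij[of n] m by (auto simp: bij_betw_def odd_res_def dest: inj_onD)
  qed
  moreover have "Gal n = sig n ` odd_res n"
    using Gal_imp_sig[OF n] sig_in_Gal[OF n] by (auto simp: odd_res_def)
  ultimately have "tr n (ieval p (alpha n)) = (\<Sum>m\<in>odd_res n. sig n m (ieval p (alpha n)))"
    by (simp add: tr_def sum.reindex)
  also have "\<dots> = (\<Sum>m\<in>odd_res n. ieval p (alpha n ^ m))"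
    using n by (intro sum.cong refl) (auto simp: odd_res_def sig_ieval)
  finally show ?thesis .
qed

section \<open>Group rings of cyclic groups\<close>

lemma alpha_powi_eq_1_iff: "alpha n powi k = 1 \<longleftrightarrow> 2 ^ n dvd k"
proof
  assume "2 ^ n dvd k"
  then obtain q where "k = 0 + q * 2 ^ n" by (auto elim!: dvdE simp: mult.commute)
  then show "alpha n powi k = 1" using alpha_powi_period[of n 0 q] by simp
next
  assume *: "alpha n powi k = 1"
  define r where "r = nat (k mod 2 ^ n)"
  have "int r = k mod 2 ^ n" by (simp add: r_def)
  then have r: "k = int r + (k div 2 ^ n) * 2 ^ n" by (metis mod_div_mult_eq)
  have "r < 2 ^ n"
  proof -
    have "int r < int (2 ^ n)" by (simp add: r_def)
    then show ?thesis by (simp only: of_nat_less_iff)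
  qed
  moreover have "alpha n ^ r = alpha n ^ 0"
    using * alpha_powi_period[of n "int r" "k div 2 ^ n"] r by simp
  ultimately have "r = 0"
    using inj_onD[OF bij_betw_imp_inj_on[OF alpha_pow_bij], of n r 0] by simp
  then show "2 ^ n dvd k" using r by (metis add_0 dvd_triv_right of_nat_0)
qed

lemma alpha_orthogonality:
  "(\<Sum>j<2 ^ n. alpha n powi (k * int j)) = (if 2 ^ n dvd k then 2 ^ n else 0)"
proof -
  define z where "z = alpha n powi k"
  have zj: "alpha n powi (k * int j) = z ^ j" for j by (simp add: z_def power_int_mult)
  have z1: "z ^ 2 ^ n = 1" using zj[of "2 ^ n"] alpha_powi_eq_1_iff[of n "k * int (2 ^ n)"] by simp
  show ?thesis
  proof (cases "2 ^ n dvd k")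
    case True
    then have "z = 1" using alpha_powi_eq_1_iff[of n k] by (simp add: z_def)
    then show ?thesis using True by (simp add: zj)
  next
    case False
    then have "z \<noteq> 1" using alpha_powi_eq_1_iff[of n k] by (simp add: z_def)
    then have "(\<Sum>j<2 ^ n. z ^ j) = 0" using geometric_sum[of z "2 ^ n"] z1 by simp
    then show ?thesis using False by (simp add: zj)
  qed
qed

text \<open>The inverse discrete Fourier transform: the coefficients of the element of the group ring on
  which the character \<open>x \<mapsto> \<alpha>\<^sup>m\<close> takes the value \<open>c m\<close>.  It turns pointwise products into
  convolutions.\<close>
definition idft :: "nat \<Rightarrow> (nat \<Rightarrow> complex) \<Rightarrow> int \<Rightarrow> complex" where
  "idft n c i = (\<Sum>m<2 ^ n. c m * alpha n powi (- (int m * i))) / 2 ^ n"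

lemma idft_period: "idft n c (i + q * 2 ^ n) = idft n c i"
proof -
  have "alpha n powi (- (int m * (i + q * 2 ^ n))) = alpha n powi (- (int m * i))" for m
    using alpha_powi_period[of n "- (int m * i)" "- (int m * q)"] by (simp add: algebra_simps)
  then show ?thesis by (simp add: idft_def)
qed

lemma idft_cong:
  assumes "2 ^ n dvd i - j"
  shows "idft n c i = idft n c j"
proof -
  obtain q where "i - j = 2 ^ n * q" using assms by (auto elim: dvdE)
  then have "i = j + q * 2 ^ n" by (simp add: algebra_simps)
  then show ?thesis by (simp only: idft_period)
qed

lemma dvd_diff_small:
  assumes "a < 2 ^ n" "b < 2 ^ n"
  shows "(2::int) ^ n dvd int a - int b \<longleftrightarrow> a = b"
proof
  assume d: "(2::int) ^ n dvd int a - int b"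
  have "\<bar>int a - int b\<bar> < int (2 ^ n)"
    using assms by (simp only: abs_less_iff of_nat_less_iff[symmetric, where 'a = int]) linarith
  then have "\<bar>int a - int b\<bar> < 2 ^ n" by simp
  with d have "int a - int b = 0"
    using dvd_imp_le_int[of "int a - int b" "2 ^ n"] by force
  then show "a = b" by simp
qed simp

lemma idft_1: "idft n (\<lambda>_. 1) i = (if 2 ^ n dvd i then 1 else 0)"
  using alpha_orthogonality[of n "- i"] by (simp add: idft_def mult.commute)

lemma character_sum:
  fixes f :: "nat \<Rightarrow> complex" and m0 :: nat
  assumes "m0 < 2 ^ n" and "\<And>m. m < 2 ^ n \<Longrightarrow> 2 ^ n dvd k m \<longleftrightarrow> m = m0"
  shows "(\<Sum>j<2 ^ n. \<Sum>m<2 ^ n. f m * alpha n powi (k m * int j)) = f m0 * 2 ^ n"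
proof -
  have "(\<Sum>j<2 ^ n. \<Sum>m<2 ^ n. f m * alpha n powi (k m * int j))
    = (\<Sum>m<2 ^ n. f m * (\<Sum>j<2 ^ n. alpha n powi (k m * int j)))"
    by (subst sum.swap) (simp add: sum_distrib_left)
  also have "\<dots> = (\<Sum>m<2 ^ n. if m = m0 then f m0 * 2 ^ n else 0)"
    by (intro sum.cong refl) (use assms in \<open>auto simp: alpha_orthogonality\<close>)
  finally show ?thesis using assms(1) by simp
qed

lemma idft_convolution:
  "(\<Sum>j<2 ^ n. idft n c (int j) * idft n c' (i - int j)) = idft n (\<lambda>m. c m * c' m) i"
proof -
  let ?N = "2 ^ n :: nat"
  let ?a = "\<lambda>m m'. c m * c' m' * alpha n powi (- (int m' * i))"
  have "(\<Sum>j<?N. idft n c (int j) * idft n c' (i - int j)) =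
    (\<Sum>j<?N. \<Sum>m<?N. \<Sum>m'<?N. ?a m m' * alpha n powi ((int m' - int m) * int j)) / (2 ^ n * 2 ^ n)"
    unfolding idft_def times_divide_times_eq sum_divide_distrib[symmetric] sum_product
  proof (intro arg_cong2[of _ _ _ _ "(/)"] sum.cong refl)
    fix j m m' :: nat
    have "alpha n powi (- (int m * int j)) * alpha n powi (- (int m' * (i - int j)))
      = alpha n powi (- (int m' * i)) * alpha n powi ((int m' - int m) * int j)"
      by (simp flip: power_int_add add: algebra_simps)
    then show "c m * alpha n powi (- (int m * int j)) * (c' m' * alpha n powi (- (int m' * (i - int j))))
      = ?a m m' * alpha n powi ((int m' - int m) * int j)"
      by (simp add: mult_ac)
  qed
  also have "(\<Sum>j<?N. \<Sum>m<?N. \<Sum>m'<?N. ?a m m' * alpha n powi ((int m' - int m) * int j))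
    = (\<Sum>m<?N. \<Sum>j<?N. \<Sum>m'<?N. ?a m m' * alpha n powi ((int m' - int m) * int j))"
    by (rule sum.swap)
  also have "\<dots> = (\<Sum>m<?N. ?a m m * 2 ^ n)"
    by (intro sum.cong refl character_sum) (auto simp: dvd_diff_small)
  finally show ?thesis by (simp add: idft_def flip: sum_distrib_right)
qed

lemma dft_idft:
  assumes "m < 2 ^ n"
  shows "(\<Sum>j<2 ^ n. idft n c (int j) * alpha n powi (int m * int j)) = c m"
proof -
  have "(\<Sum>j<2 ^ n. idft n c (int j) * alpha n powi (int m * int j)) =
    (\<Sum>j<2 ^ n. \<Sum>m'<2 ^ n. c m' * alpha n powi ((int m - int m') * int j)) / 2 ^ n"
    unfolding idft_def sum_divide_distrib[symmetric] times_divide_eq_left sum_distrib_right mult.assoc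
    by (simp flip: power_int_add add: algebra_simps)
  also have "(\<Sum>j<2 ^ n. \<Sum>m'<2 ^ n. c m' * alpha n powi ((int m - int m') * int j)) = c m * 2 ^ n"
    using assms by (intro character_sum) (auto simp: dvd_diff_small)
  finally show ?thesis by simp
qed

lemma idft_surj:
  assumes "i < 2 ^ n"
  shows "idft n (\<lambda>m. \<Sum>j<2 ^ n. a j * alpha n powi (int m * int j)) (int i) = a i"
proof -
  have "(\<Sum>m<2 ^ n. (\<Sum>j<2 ^ n. a j * alpha n powi (int m * int j)) * alpha n powi (- (int m * int i)))
    = (\<Sum>m<2 ^ n. \<Sum>j<2 ^ n. a j * alpha n powi ((int j - int i) * int m))"
    unfolding sum_distrib_right mult.assoc by (simp flip: power_int_add add: algebra_simps)
  also have "\<dots> = a i * 2 ^ n"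
    using assms by (intro character_sum) (auto simp: dvd_diff_small)
  finally show ?thesis by (simp add: idft_def)
qed

text \<open>The values of the characters \<open>x \<mapsto> \<alpha>\<^sup>m\<close> on \<open>u(\<beta>)\<close> for \<open>\<beta> = p(\<alpha>)\<close>.\<close>
definition conjs :: "nat \<Rightarrow> int poly \<Rightarrow> nat \<Rightarrow> complex" where
  "conjs n p m = (if odd m then ieval p (alpha n ^ m) else 1)"

lemma gamma_eq_idft:
  assumes n: "n \<ge> 1" and j: "j < 2 ^ n"
  shows "gamma n (ieval p (alpha n)) j = idft n (conjs n p) (int j)"
proof -
  define q where "q = (p - 1) * monom 1 ((2 ^ n - 1) * j)"
  have root: "(alpha n ^ m) ^ 2 ^ n = 1" for m
    by (metis alpha_pow_full mult.commute power_mult power_one)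
  have pow: "(alpha n ^ m) ^ ((2 ^ n - 1) * j) = alpha n powi (- (int m * int j))" for m
  proof -
    have "(alpha n ^ m) ^ ((2 ^ n - 1) * j) = inverse (alpha n ^ m) ^ j"
      by (simp only: power_mult root_pow_inverse[OF root])
    also have "\<dots> = inverse (alpha n ^ (m * j))" by (simp add: power_inverse power_mult)
    also have "\<dots> = alpha n powi (- int (m * j))" by (simp only: power_int_minus power_int_of_nat)
    finally show ?thesis by simp
  qed
  have q: "ieval q (alpha n ^ m) = (ieval p (alpha n ^ m) - 1) * alpha n powi (- (int m * int j))" for m
    by (simp only: q_def ieval_mult ieval_diff ieval_1 ieval_monom pow) simp
  have "tr n ((ieval p (alpha n) - 1) * alpha n powi (- int j)) = tr n (ieval q (alpha n))"
    using q[of 1] by simp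
  also have "\<dots> = (\<Sum>m\<in>odd_res n. (ieval p (alpha n ^ m) - 1) * alpha n powi (- (int m * int j)))"
    by (simp only: tr_ieval[OF n] q)
  also have "\<dots> = (\<Sum>m<2 ^ n. (conjs n p m - 1) * alpha n powi (- (int m * int j)))"
    by (rule sum.mono_neutral_cong_left) (auto simp: odd_res_def conjs_def)
  finally have tr: "tr n ((ieval p (alpha n) - 1) * alpha n powi (- int j)) / 2 ^ n
      = idft n (conjs n p) (int j) - idft n (\<lambda>_. 1) (int j)"
    by (simp add: idft_def left_diff_distrib sum_subtractf diff_divide_distrib)
  have "2 ^ n dvd int j \<longleftrightarrow> j = 0" using dvd_diff_small[of j n 0] j by simp
  then show ?thesis using tr by (auto simp: gamma_def idft_1)
qed

lemma conjs_mult: "conjs n (p * q) = (\<lambda>m. conjs n p m * conjs n q m)"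
  by (auto simp: conjs_def)

lemma conjs_1: "conjs n 1 = (\<lambda>_. 1)"
  by (auto simp: conjs_def)

text \<open>The trace of \<open>\<alpha>\<^sup>s\<close> is divisible by \<open>2\<^bsup>n-1\<^esup>\<close>; with the factor 2 of \<open>\<beta> - 1 = 2 t\<close> this cancels the
  denominator \<open>2\<^sup>n\<close>.\<close>
lemma idft_conjs_Ints:
  assumes n: "n \<ge> 1"
  shows "idft n (conjs n (1 + 2 * t)) i \<in> \<int>"
proof -
  define S where "S s = (\<Sum>m\<in>odd_res n. alpha n powi (int m * s))" for s :: int
  have S: "\<exists>c::int. S s = of_int c * 2 ^ (n - 1)" for s
  proof -
    have n2: "(2::nat) ^ n = 2 * 2 ^ (n - 1)" using n by (metis mult.commute power_minus_mult less_le_trans zero_less_one)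
    have "{..<2 ^ n} = odd_res n \<union> (\<lambda>l. 2 * l) ` {..<2 ^ (n - 1)}"
      using n2 by (auto simp: odd_res_def image_iff elim!: evenE)
    moreover have "odd_res n \<inter> (\<lambda>l. 2 * l) ` {..<2 ^ (n - 1)} = {}" by (auto simp: odd_res_def)
    ultimately have "(\<Sum>m<2 ^ n. alpha n powi (s * int m)) =
      S s + (\<Sum>m\<in>(\<lambda>l. 2 * l) ` {..<2 ^ (n - 1)}. alpha n powi (s * int m))"
      by (simp add: S_def sum.union_disjoint mult.commute)
    also have "(\<Sum>m\<in>(\<lambda>l. 2 * l) ` {..<2 ^ (n - 1)}. alpha n powi (s * int m)) =
      (\<Sum>l<2 ^ (n - 1). alpha (n - 1) powi (s * int l))"
    proof -
      have "alpha n powi (s * int (2 * l)) = alpha (n - 1) powi (s * int l)" for l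
      proof -
        have "s * int (2 * l) = 2 * (s * int l)" by simp
        then have "alpha n powi (s * int (2 * l)) = (alpha n powi 2) powi (s * int l)"
          by (simp only: power_int_mult)
        then show ?thesis using alpha_square[OF n] by simp
      qed
      then show ?thesis by (subst sum.reindex) (auto simp: inj_on_def)
    qed
    finally have "S s = (if 2 ^ n dvd s then 2 ^ n else 0) - (if 2 ^ (n - 1) dvd s then 2 ^ (n - 1) else 0)"
      by (simp add: alpha_orthogonality algebra_simps)
    moreover have "(2::complex) ^ n = 2 * 2 ^ (n - 1)"
      using n by (metis mult.commute power_minus_mult less_le_trans zero_less_one)
    ultimately have "S s = of_int ((if 2 ^ n dvd s then 2 else 0) - (if 2 ^ (n - 1) dvd s then 1 else 0)) * 2 ^ (n - 1)"
      by (auto simp: algebra_simps)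
    then show ?thesis by blast
  qed
  have "(\<Sum>m<2 ^ n. (conjs n (1 + 2 * t) m - 1) * alpha n powi (- (int m * i)))
    = (\<Sum>m\<in>odd_res n. 2 * ieval t (alpha n ^ m) * alpha n powi (- (int m * i)))"
    by (rule sum.mono_neutral_cong_right) (auto simp: odd_res_def conjs_def)
  also have "\<dots> = (\<Sum>m\<in>odd_res n. \<Sum>k\<le>degree t. 2 * of_int (coeff t k) * alpha n powi (int m * (int k - i)))"
  proof (intro sum.cong refl)
    fix m
    have "(alpha n ^ m) ^ k * alpha n powi (- (int m * i)) = alpha n powi (int m * (int k - i))" for k
    proof -
      have "(alpha n ^ m) ^ k = alpha n powi (int m * int k)"
        by (simp only: power_int_mult power_int_of_nat)
      then show ?thesis by (simp flip: power_int_add add: algebra_simps)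
    qed
    then show "2 * ieval t (alpha n ^ m) * alpha n powi (- (int m * i)) =
      (\<Sum>k\<le>degree t. 2 * of_int (coeff t k) * alpha n powi (int m * (int k - i)))"
      by (simp add: ieval_altdef sum_distrib_left sum_distrib_right mult.assoc)
  qed
  also have "\<dots> = (\<Sum>k\<le>degree t. 2 * of_int (coeff t k) * S (int k - i))"
    by (subst sum.swap) (simp add: S_def sum_distrib_left)
  finally have eq: "(\<Sum>m<2 ^ n. (conjs n (1 + 2 * t) m - 1) * alpha n powi (- (int m * i)))
    = (\<Sum>k\<le>degree t. 2 * of_int (coeff t k) * S (int k - i))" .
  have "idft n (conjs n (1 + 2 * t)) i = idft n (\<lambda>_. 1) i +
    (\<Sum>m<2 ^ n. (conjs n (1 + 2 * t) m - 1) * alpha n powi (- (int m * i))) / 2 ^ n"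
    by (simp add: idft_def left_diff_distrib sum_subtractf diff_divide_distrib)
  also have "\<dots> = idft n (\<lambda>_. 1) i + (\<Sum>k\<le>degree t. 2 * of_int (coeff t k) * S (int k - i) / 2 ^ n)"
    by (simp only: eq sum_divide_distrib)
  also have "\<dots> \<in> \<int>"
  proof (intro Ints_add Ints_sum)
    show "idft n (\<lambda>_. 1) i \<in> \<int>" by (simp add: idft_1)
    fix k
    obtain c :: int where c: "S (int k - i) = of_int c * 2 ^ (n - 1)" using S by blast
    have "(2::complex) ^ n = 2 * 2 ^ (n - 1)"
      using n by (metis mult.commute power_minus_mult less_le_trans zero_less_one)
    then have "2 * of_int (coeff t k) * S (int k - i) / 2 ^ n = of_int (coeff t k * c)"
      by (simp add: c)
    then show "2 * of_int (coeff t k) * S (int k - i) / 2 ^ n \<in> \<int>" by (metis Ints_of_int)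
  qed
  finally show ?thesis .
qed

lemma group_ring_simps [simp]:
  "carrier (group_ring S G) = carrier G \<rightarrow>\<^sub>E S"
  "\<one>\<^bsub>group_ring S G\<^esub> = (\<lambda>g\<in>carrier G. if g = \<one>\<^bsub>G\<^esub> then 1 else 0)"
  "a \<otimes>\<^bsub>group_ring S G\<^esub> b = (\<lambda>g\<in>carrier G. \<Sum>h\<in>carrier G. a h * b (inv\<^bsub>G\<^esub> h \<otimes>\<^bsub>G\<^esub> g))"
  by (simp_all add: group_ring_def)

locale cyclic_2_group = group G for G :: "('g, 'm) monoid_scheme" (structure) +
  fixes x :: 'g and n :: nat
  assumes x [simp]: "x \<in> carrier G" and gen: "carrier G = generate G {x}"
    and ord: "Coset.order G = 2 ^ n"
begin

lemma finite_G: "finite (carrier G)"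
  using ord by (metis card_gt_0_iff Coset.order_def zero_less_numeral zero_less_power)

lemma pow_eq_iff: "x [^] (i::int) = x [^] (j::int) \<longleftrightarrow> 2 ^ n dvd i - j"
proof -
  have "group.ord G x = card (generate G {x})" by (rule generate_pow_card) simp
  then have "group.ord G x = 2 ^ n" using ord gen by (simp add: Coset.order_def)
  then show ?thesis by (simp add: int_pow_eq dvd_diff_commute)
qed

lemma pow_bij: "bij_betw (\<lambda>j. x [^] (int j)) {..<2 ^ n} (carrier G)"
proof -
  have inj: "inj_on (\<lambda>j. x [^] (int j)) {..<2 ^ n}"
    by (auto simp: inj_on_def pow_eq_iff dvd_diff_small)
  have "(\<lambda>j. x [^] (int j)) ` {..<2 ^ n} \<subseteq> carrier G" by auto
  moreover have "card ((\<lambda>j. x [^] (int j)) ` {..<2 ^ n}) = card (carrier G)"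
    using inj ord by (simp add: card_image Coset.order_def)
  ultimately have "(\<lambda>j. x [^] (int j)) ` {..<2 ^ n} = carrier G"
    using finite_G by (intro card_subset_eq)
  with inj show ?thesis by (simp add: bij_betw_def)
qed

lemma carrier_cases:
  assumes "g \<in> carrier G"
  obtains j where "j < 2 ^ n" "g = x [^] (int j)"
  using assms pow_bij by (auto simp: bij_betw_def)

definition logx :: "'g \<Rightarrow> int" where
  "logx g = (SOME i. x [^] i = g)"

lemma logx_cong: "2 ^ n dvd logx (x [^] (i::int)) - i"
proof -
  have "x [^] logx (x [^] i) = x [^] i" unfolding logx_def by (rule someI) (rule refl)
  then show ?thesis by (simp add: pow_eq_iff)
qed

text \<open>Every function on \<open>G\<close> arises in this way, and products in the group ring become pointwise
  products of the arguments; so the ring laws are inherited from the complex numbers.\<close>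
definition T :: "(nat \<Rightarrow> complex) \<Rightarrow> 'g \<Rightarrow> complex" where
  "T c = (\<lambda>g\<in>carrier G. idft n c (logx g))"

lemma T_pow: "T c (x [^] (i::int)) = idft n c i"
  using idft_cong[OF logx_cong] by (simp add: T_def)

lemma ext_eqI:
  assumes "a \<in> extensional (carrier G)" "b \<in> extensional (carrier G)"
    and "\<And>j. j < 2 ^ n \<Longrightarrow> a (x [^] (int j)) = b (x [^] (int j))"
  shows "a = b"
  by (rule extensionalityI[OF assms(1,2)]) (metis assms(3) carrier_cases)

lemma T_ext [simp]: "T c \<in> extensional (carrier G)"
  by (simp add: T_def)

lemma sum_carrier: "(\<Sum>g\<in>carrier G. f g) = (\<Sum>j<2 ^ n. f (x [^] (int j)))"
  using sum.reindex_bij_betw[OF pow_bij] by (rule sym)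

lemma T_mult: "T c \<otimes>\<^bsub>group_ring S G\<^esub> T c' = T (\<lambda>m. c m * c' m)"
proof (rule ext_eqI)
  fix i :: nat assume "i < 2 ^ n"
  have "(T c \<otimes>\<^bsub>group_ring S G\<^esub> T c') (x [^] (int i)) =
    (\<Sum>j<2 ^ n. T c (x [^] (int j)) * T c' (inv (x [^] (int j)) \<otimes> x [^] (int i)))"
    by (simp add: sum_carrier)
  also have "\<dots> = (\<Sum>j<2 ^ n. idft n c (int j) * idft n c' (int i - int j))"
  proof (intro sum.cong refl)
    fix j
    have "inv (x [^] (int j)) \<otimes> x [^] (int i) = x [^] (int i - int j)"
      by (simp add: int_pow_neg[symmetric] int_pow_mult[symmetric] del: int_pow_neg)
    then show "T c (x [^] (int j)) * T c' (inv (x [^] (int j)) \<otimes> x [^] (int i))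
      = idft n c (int j) * idft n c' (int i - int j)" by (simp add: T_pow)
  qed
  finally show "(T c \<otimes>\<^bsub>group_ring S G\<^esub> T c') (x [^] (int i)) = T (\<lambda>m. c m * c' m) (x [^] (int i))"
    by (simp only: idft_convolution T_pow)
qed simp_all

lemma T_one: "T (\<lambda>_. 1) = \<one>\<^bsub>group_ring S G\<^esub>"
proof (rule ext_eqI)
  fix i :: nat assume "i < 2 ^ n"
  have "x [^] (int i) = \<one> \<longleftrightarrow> 2 ^ n dvd int i" using pow_eq_iff[of "int i" 0] by simp
  then show "T (\<lambda>_. 1) (x [^] (int i)) = \<one>\<^bsub>group_ring S G\<^esub> (x [^] (int i))"
    by (simp only: T_pow idft_1) simp
qed simp_all

lemma T_surj:
  assumes "a \<in> extensional (carrier G)"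
  obtains c where "a = T c"
proof
  let ?c = "\<lambda>m. \<Sum>j<2 ^ n. a (x [^] (int j)) * alpha n powi (int m * int j)"
  show "a = T ?c"
    by (rule ext_eqI) (use assms in \<open>auto simp: T_pow idft_surj\<close>)
qed

lemma T_at:
  assumes "m < 2 ^ n"
  shows "(\<Sum>j<2 ^ n. T c (x [^] (int j)) * alpha n powi (int m * int j)) = c m"
  unfolding T_pow using assms by (rule dft_idft)

lemma T_sum: "(\<Sum>g\<in>carrier G. T c g) = c 0"
  using T_at[of 0 c] by (simp add: sum_carrier)

lemma group_ring_comm_monoid: "comm_monoid (group_ring \<int> G)"
proof (rule comm_monoidI)
  let ?R = "group_ring \<int> G"
  fix a b assume ab: "a \<in> carrier ?R" "b \<in> carrier ?R"
  have e: "a \<in> extensional (carrier G)" "b \<in> extensional (carrier G)" using ab by (auto simp: PiE_def)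
  obtain c where a: "a = T c" using e(1) by (rule T_surj)
  obtain c' where b: "b = T c'" using e(2) by (rule T_surj)
  show "a \<otimes>\<^bsub>?R\<^esub> b \<in> carrier ?R"
    unfolding group_ring_simps using ab by (auto intro!: Ints_sum Ints_mult)
  show "a \<otimes>\<^bsub>?R\<^esub> b = b \<otimes>\<^bsub>?R\<^esub> a"
    unfolding a b T_mult by (simp add: mult.commute)
  show "\<one>\<^bsub>?R\<^esub> \<otimes>\<^bsub>?R\<^esub> a = a" unfolding a T_one[symmetric] T_mult by simp
  fix d assume d: "d \<in> carrier ?R"
  then have "d \<in> extensional (carrier G)" by (auto simp: PiE_def)
  then obtain c'' where d: "d = T c''" by (rule T_surj)
  show "a \<otimes>\<^bsub>?R\<^esub> b \<otimes>\<^bsub>?R\<^esub> d = a \<otimes>\<^bsub>?R\<^esub> (b \<otimes>\<^bsub>?R\<^esub> d)"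
    unfolding a b d T_mult by (simp add: mult.assoc)
qed auto

lemma V_ZG_carrier:
  "carrier (V_ZG G) = {a \<in> Units (group_ring \<int> G). (\<Sum>g\<in>carrier G. a g) = 1}"
  by (simp add: V_ZG_def)

lemma V_ZG_simps [simp]:
  "a \<otimes>\<^bsub>V_ZG G\<^esub> b = a \<otimes>\<^bsub>group_ring \<int> G\<^esub> b" "\<one>\<^bsub>V_ZG G\<^esub> = \<one>\<^bsub>group_ring \<int> G\<^esub>"
  by (simp_all add: V_ZG_def units_of_def)

lemma V_ZG_comm_group: "comm_group (V_ZG G)"
proof -
  interpret R: comm_monoid "group_ring \<int> G" by (rule group_ring_comm_monoid)
  have T: "\<exists>c. a = T c" if "a \<in> carrier (group_ring \<int> G)" for a
  proof -
    have "a \<in> extensional (carrier G)" using that by (auto simp: PiE_def)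
    then show ?thesis using T_surj by metis
  qed
  have aug: "(\<Sum>g\<in>carrier G. (a \<otimes>\<^bsub>group_ring \<int> G\<^esub> b) g) = (\<Sum>g\<in>carrier G. a g) * (\<Sum>g\<in>carrier G. b g)"
    if ab: "a \<in> carrier (group_ring \<int> G)" "b \<in> carrier (group_ring \<int> G)" for a b
  proof -
    obtain c c' where "a = T c" "b = T c'" using T ab by metis
    then show ?thesis by (simp only: T_mult T_sum)
  qed
  have aug1: "(\<Sum>g\<in>carrier G. \<one>\<^bsub>group_ring \<int> G\<^esub> g) = 1"
    unfolding T_one[symmetric] T_sum by simp
  show ?thesis
  proof (rule comm_groupI)
    fix a assume a: "a \<in> carrier (V_ZG G)"
    then have aU: "a \<in> Units (group_ring \<int> G)" "(\<Sum>g\<in>carrier G. a g) = 1" by (auto simp: V_ZG_carrier)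
    note aC = R.Units_closed[OF aU(1)]
    let ?b = "inv\<^bsub>group_ring \<int> G\<^esub> a"
    have b: "?b \<in> Units (group_ring \<int> G)" "?b \<otimes>\<^bsub>group_ring \<int> G\<^esub> a = \<one>\<^bsub>group_ring \<int> G\<^esub>"
      using aU(1) by (rule R.Units_inv_Units, rule R.Units_l_inv)
    have "(\<Sum>g\<in>carrier G. ?b g) * (\<Sum>g\<in>carrier G. a g) = 1"
      using aug[OF R.Units_closed[OF b(1)] aC] aug1 by (simp only: b(2))
    then have "?b \<in> carrier (V_ZG G)" using b(1) aU(2) by (simp add: V_ZG_carrier)
    then show "\<exists>b\<in>carrier (V_ZG G). b \<otimes>\<^bsub>V_ZG G\<^esub> a = \<one>\<^bsub>V_ZG G\<^esub>"
      using b(2) unfolding V_ZG_simps by blast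
    show "\<one>\<^bsub>V_ZG G\<^esub> \<otimes>\<^bsub>V_ZG G\<^esub> a = a" unfolding V_ZG_simps using aC by (rule R.l_one)
    fix b assume "b \<in> carrier (V_ZG G)"
    then have bU: "b \<in> Units (group_ring \<int> G)" "(\<Sum>g\<in>carrier G. b g) = 1" by (auto simp: V_ZG_carrier)
    note bC = R.Units_closed[OF bU(1)]
    show "a \<otimes>\<^bsub>V_ZG G\<^esub> b = b \<otimes>\<^bsub>V_ZG G\<^esub> a" unfolding V_ZG_simps using aC bC by (rule R.m_comm)
    have "(\<Sum>g\<in>carrier G. (a \<otimes>\<^bsub>group_ring \<int> G\<^esub> b) g) = 1" unfolding aug[OF aC bC] aU(2) bU(2) by simp
    moreover have "a \<otimes>\<^bsub>group_ring \<int> G\<^esub> b \<in> Units (group_ring \<int> G)" using aU(1) bU(1) by (rule R.Units_m_closed)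
    ultimately show "a \<otimes>\<^bsub>V_ZG G\<^esub> b \<in> carrier (V_ZG G)"
      unfolding V_ZG_simps V_ZG_carrier by blast
    fix c assume "c \<in> carrier (V_ZG G)"
    then have "c \<in> Units (group_ring \<int> G)" by (auto simp: V_ZG_carrier)
    then have cC: "c \<in> carrier (group_ring \<int> G)" by (rule R.Units_closed)
    show "a \<otimes>\<^bsub>V_ZG G\<^esub> b \<otimes>\<^bsub>V_ZG G\<^esub> c = a \<otimes>\<^bsub>V_ZG G\<^esub> (b \<otimes>\<^bsub>V_ZG G\<^esub> c)"
      unfolding V_ZG_simps using aC bC cC by (rule R.m_assoc)
  next
    show "\<one>\<^bsub>V_ZG G\<^esub> \<in> carrier (V_ZG G)"
      unfolding V_ZG_simps V_ZG_carrier using aug1 R.Units_one_closed by blast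
  qed
qed

abbreviation u :: "complex \<Rightarrow> 'g \<Rightarrow> complex" where
  "u \<equiv> u_chi1 G x n"

lemma u_eq_T:
  assumes n: "n \<ge> 1"
  shows "u (ieval p (alpha n)) = T (conjs n p)"
proof (rule ext_eqI)
  fix i :: nat assume i: "i < 2 ^ n"
  have "{j. j < 2 ^ n \<and> x [^] j = x [^] (int i)} = {i}"
  proof -
    have "x [^] j = x [^] (int i) \<longleftrightarrow> j = i" if "j < 2 ^ n" for j :: nat
      using pow_eq_iff[of "int j" "int i"] dvd_diff_small[OF that i] by (simp add: int_pow_int)
    then show ?thesis using i by auto
  qed
  then have "u (ieval p (alpha n)) (x [^] (int i)) = gamma n (ieval p (alpha n)) i"
    by (simp add: u_chi1_def)
  then show "u (ieval p (alpha n)) (x [^] (int i)) = T (conjs n p) (x [^] (int i))"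
    by (simp add: gamma_eq_idft[OF n i] T_pow del: ieval_int)
qed (simp_all add: u_chi1_def)

lemma u_mult:
  assumes "n \<ge> 1" "b \<in> ZA n" "c \<in> ZA n"
  shows "u b \<otimes>\<^bsub>group_ring S G\<^esub> u c = u (b * c)"
proof -
  obtain p q where "b = ieval p (alpha n)" "c = ieval q (alpha n)"
    using assms(2,3) by (auto simp: ZA_def)
  then show ?thesis
    using u_eq_T[OF assms(1), of p] u_eq_T[OF assms(1), of q] u_eq_T[OF assms(1), of "p * q"]
    by (simp only: T_mult conjs_mult ieval_mult)
qed

lemma u_1:
  assumes "n \<ge> 1"
  shows "u 1 = \<one>\<^bsub>group_ring S G\<^esub>"
  using u_eq_T[OF assms, of 1] by (simp only: conjs_1 ieval_1 T_one[of S])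

lemma u_inj:
  assumes n: "n \<ge> 1" and "b \<in> ZA n" "c \<in> ZA n" "u b = u c"
  shows "b = c"
proof -
  obtain p q where pq: "b = ieval p (alpha n)" "c = ieval q (alpha n)"
    using assms(2,3) by (auto simp: ZA_def)
  have "T (conjs n p) = T (conjs n q)" using assms(4) unfolding pq u_eq_T[OF n] .
  moreover have "1 < (2::nat) ^ n" using n one_less_power[of "2::nat" n] by simp
  ultimately have "conjs n p 1 = conjs n q 1" using T_at[of 1] by metis
  then show ?thesis by (simp add: conjs_def pq)
qed

lemma u_E_in_V:
  assumes n: "n \<ge> 1" and b: "b \<in> E_grp n"
  shows "u b \<in> carrier (V_ZG G)"
proof -
  note E = subgroup_Un_grpD[OF subgroup_E_grp[OF n]]
  have int: "u c \<in> carrier (group_ring \<int> G) \<and> (\<Sum>g\<in>carrier G. u c g) = 1" if c: "c \<in> E_grp n" for c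
  proof -
    obtain t where t: "c = ieval (1 + 2 * t) (alpha n)"
    proof -
      obtain y where "y \<in> ZA n" "c - 1 = 2 * y" using c by (auto simp: E_grp_eq even2_def)
      moreover from this obtain t where "y = ieval t (alpha n)" by (auto simp: ZA_def)
      ultimately have "c = ieval (1 + 2 * t) (alpha n)" by (simp add: algebra_simps)
      then show thesis by (rule that)
    qed
    have u: "u c = T (conjs n (1 + 2 * t))" unfolding t by (rule u_eq_T[OF n])
    show ?thesis
    proof
      have "T (conjs n (1 + 2 * t)) g \<in> \<int>" if "g \<in> carrier G" for g
        using that idft_conjs_Ints[OF n] by (simp add: T_def)
      then show "u c \<in> carrier (group_ring \<int> G)" unfolding u by (auto simp: PiE_def)
      show "(\<Sum>g\<in>carrier G. u c g) = 1" unfolding u T_sum by (simp add: conjs_def)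
    qed
  qed
  have bu: "b \<in> unitsA n" "inverse b \<in> unitsA n" using E(1) b E(4) by auto
  then have "u (inverse b) \<otimes>\<^bsub>group_ring \<int> G\<^esub> u b = \<one>\<^bsub>group_ring \<int> G\<^esub>"
    "u b \<otimes>\<^bsub>group_ring \<int> G\<^esub> u (inverse b) = \<one>\<^bsub>group_ring \<int> G\<^esub>"
    using u_1[OF n, of \<int>] by (simp_all only: u_mult[OF n] unitsA_def mem_Collect_eq) simp_all
  then have "u b \<in> Units (group_ring \<int> G)"
    using int[OF b] int[OF E(4)[OF b]] unfolding Units_def by blast
  then show ?thesis using int[OF b] by (simp only: V_ZG_carrier) simp
qed

lemma V_gen_eq:
  assumes n: "n \<ge> 3" and i: "i \<in> factor_index n"
  shows "V_gen G x n i = u (E_gen n i)"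
proof (cases i)
  case (Some p)
  then obtain k b where kb: "i = Some (k, int b)" "b \<in> odds (n - 1 - k)"
    using i by (auto simp: factor_index_iff)
  have "d_el n (int b) \<in> unitsA n" using kb(2) n by (intro d_el_unit) (auto simp: odds_def)
  then have "d_el n (int b) powi (- (2 ^ k)) \<in> ZA n"
    by (auto simp: unitsA_def power_int_def)
  then show ?thesis using n unfolding kb(1) V_gen.simps E_gen.simps
    by (intro u_mult) auto
qed simp

text \<open>On \<open>E\<close> the map \<open>u\<close> is an injective homomorphism into the normalized units, and it takes the
  generators of \<open>E\<close> to those of \<open>V1\<close>.\<close>
theorem V1_direct_product:
  assumes n: "n \<ge> 3"
  shows "is_internal_direct_product (V_ZG G) (factor_index n) (\<lambda>i. cyc (V_ZG G) (V_gen G x n i)) (V1 G x n)"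
proof -
  have n1: "n \<ge> 1" using n by simp
  interpret U: comm_group "Un_grp n" by (rule comm_group_Un_grp)
  interpret V: comm_group "V_ZG G" by (rule V_ZG_comm_group)
  note E = subgroup_E_grp[OF n1]
  let ?E = "(Un_grp n)\<lparr>carrier := E_grp n\<rparr>"
  have EZ: "b \<in> ZA n" if "b \<in> E_grp n" for b
    using that subgroup_Un_grpD(1)[OF E] by (auto simp: unitsA_def)
  interpret u: group_hom ?E "V_ZG G" u
  proof (rule group_hom.intro)
    show "Group.group ?E" using E by (rule U.subgroup_imp_group)
    show "Group.group (V_ZG G)" by (rule V.is_group)
    show "group_hom_axioms ?E (V_ZG G) u"
    proof
      show "u \<in> hom ?E (V_ZG G)"
        using u_E_in_V[OF n1] u_mult[OF n1, of _ _ \<int>] EZ by (intro homI) (simp_all del: group_ring_simps)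
    qed
  qed
  have gens: "E_gen n ` factor_index n \<subseteq> E_grp n" using E_gen_in_E[OF n] by auto
  have img: "generate (V_ZG G) (V_gen G x n ` J) = u ` generate (Un_grp n) (E_gen n ` J)"
    if J: "J \<subseteq> factor_index n" for J
  proof -
    have sub: "E_gen n ` J \<subseteq> E_grp n" using gens J by blast
    have "V_gen G x n ` J = u ` (E_gen n ` J)"
      using V_gen_eq[OF n] J by (auto simp: image_image simp del: V_gen.simps E_gen.simps intro!: image_cong)
    then have "generate (V_ZG G) (V_gen G x n ` J) = u ` generate ?E (E_gen n ` J)"
      using u.generate_img[of "E_gen n ` J"] sub by simp
    then show ?thesis using U.generate_consistent[OF sub E] by simp
  qed
  have genE: "generate (Un_grp n) (E_gen n ` J) \<subseteq> E_grp n" if "J \<subseteq> factor_index n" for J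
    using gens that by (intro U.generate_subgroup_incl[OF _ E]) auto
  have V1: "V1 G x n = generate (V_ZG G) (V_gen G x n ` factor_index n)"
  proof -
    have "u b \<in> W1 G x n" if "b \<in> E_grp n" for b
      using u_E_in_V[OF n1 that] subgroup_Un_grpD(1)[OF E] that
      unfolding W1_def carrier_Un_grp by blast
    then have "V1 G x n = u ` E_grp n" by (auto simp: V1_def)
    then show ?thesis using img[of "factor_index n"] by (simp add: E_grp_eq_F_gens[OF n] F_gens_def)
  qed
  show ?thesis unfolding V1
  proof (rule V.internal_direct_product_of_cyclics)
    show "V_gen G x n ` factor_index n \<subseteq> carrier (V_ZG G)"
      using V_gen_eq[OF n] u_E_in_V[OF n1] E_gen_in_E[OF n] by auto
    fix i z assume i: "i \<in> factor_index n" and z1: "z \<in> cyc (V_ZG G) (V_gen G x n i)"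
      and z2: "z \<in> generate (V_ZG G) (V_gen G x n ` (factor_index n - {i}))"
    from z1 img[of "{i}"] i obtain s where s: "s \<in> cyc (Un_grp n) (E_gen n i)" "z = u s"
      by (auto simp: cyc_def simp del: V_gen.simps E_gen.simps)
    from z2 img[of "factor_index n - {i}"] obtain t where
      t: "t \<in> generate (Un_grp n) (E_gen n ` (factor_index n - {i}))" "z = u t" by auto
    have "s \<in> E_grp n" using genE[of "{i}"] i s(1) by (auto simp: cyc_def simp del: E_gen.simps)
    moreover have "t \<in> E_grp n" using genE[of "factor_index n - {i}"] t(1) by auto
    ultimately have "s = t" using u_inj[OF n1] EZ s(2) t(2) by metis
    have "subgroup_prod (Un_grp n) (factor_index n - {i}) (\<lambda>i. cyc (Un_grp n) (E_gen n i))
        = generate (Un_grp n) (E_gen n ` (factor_index n - {i}))"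
      unfolding subgroup_prod_def
      by (rule U.generate_UN_cyc) (use E_gen_units[OF n] in \<open>auto simp: carrier_Un_grp simp del: E_gen.simps\<close>)
    moreover have "cyc (Un_grp n) (E_gen n i) \<inter>
        subgroup_prod (Un_grp n) (factor_index n - {i}) (\<lambda>i. cyc (Un_grp n) (E_gen n i)) = {1}"
      using E_grp_direct_product[OF n] i unfolding is_internal_direct_product_def by simp
    ultimately have "s = 1" using s(1) t(1) \<open>s = t\<close> by blast
    then show "z = \<one>\<^bsub>V_ZG G\<^esub>" using s(2) u_1[OF n1, of \<int>] by simp
  qed
qed

end

section \<open>Lists of generators\<close>

definition factor_list :: "nat \<Rightarrow> (nat \<times> int) option list" where
  "factor_list n = None # map (\<lambda>l. Some (0, 2 * l + 1)) [1..2 ^ (n - 3) - 1] @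
     concat (map (\<lambda>k. map (\<lambda>l. Some (k, 2 * l + 1)) [0..2 ^ (n - 3 - k) - 1]) [1..<n - 2])"

lemma F_index_eq:
  assumes "k \<le> n - 3" "n \<ge> 3"
  shows "F_index n k = (\<lambda>l. 2 * l + 1) ` {(if k = 0 then 1 else 0)..2 ^ (n - 3 - k) - 1}"
proof -
  have "n - 2 - k = Suc (n - 3 - k)" using assms by simp
  then have two: "(2::int) ^ (n - 2 - k) = 2 * 2 ^ (n - 3 - k)" by simp
  define M where "M = (2::int) ^ (n - 3 - k) - 1"
  have A: "A_set n k = (\<lambda>l. 2 * l + 1) ` {0..M}"
    unfolding A_set_def two M_def by (auto simp: image_iff elim!: oddE)
  have "M \<ge> 0" by (simp add: M_def)
  then have "{0..M} = insert 0 {1..M}" by auto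
  then have B: "(\<lambda>l. 2 * l + 1) ` {0..M} - {1} = (\<lambda>l. 2 * l + 1) ` {1..M}" by auto
  have "F_index n k = (if k = 0 then A_set n k - {1} else A_set n k)" by (simp add: F_index_def)
  then show ?thesis unfolding A M_def[symmetric] B by (cases "k = 0") (simp_all only: simp_thms if_True if_False)
qed

lemma set_factor_list:
  assumes n: "n \<ge> 3"
  shows "set (factor_list n) = factor_index n"
proof -
  have "(SIGMA k:{0..n - 3}. F_index n k) = Pair 0 ` F_index n 0 \<union> (SIGMA k:{1..<n - 2}. F_index n k)"
  proof (rule Set.set_eqI)
    fix p :: "nat \<times> int"
    obtain k j where "p = (k, j)" by force
    then show "p \<in> (SIGMA k:{0..n - 3}. F_index n k) \<longleftrightarrow>
        p \<in> Pair 0 ` F_index n 0 \<union> (SIGMA k:{1..<n - 2}. F_index n k)"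
      using n by (cases "k = 0") auto
  qed
  moreover have "F_index n k = (\<lambda>l. 2 * l + 1) ` {0..2 ^ (n - 3 - k) - 1}" if "k \<in> {1..<n - 2}" for k
    using F_index_eq[of k n] that n by auto
  moreover have "F_index n 0 = (\<lambda>l. 2 * l + 1) ` {1..2 ^ (n - 3) - 1}"
    using F_index_eq[of 0 n] n by simp
  ultimately show ?thesis
    by (auto simp: factor_index_def factor_list_def image_iff)
qed

lemma distinct_factor_list: "distinct (factor_list n)"
proof -
  define f where "f k = map (\<lambda>l. Some (k, 2 * l + 1)) [0..(2::int) ^ (n - 3 - k) - 1]" for k :: nat
  have "hd (f k) = Some (k, 1)" for k
    by (subst f_def, subst upto_rec1) simp_all
  then have "inj f" by (metis Pair_inject injI option.inject)
  then have "distinct (map f [1..<n - 2])" by (auto simp: distinct_map intro: inj_on_subset)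
  then have "distinct (removeAll [] (map f [1..<n - 2]))" by (rule distinct_removeAll)
  then have "distinct (concat (map f [1..<n - 2]))"
    by (auto simp: distinct_concat_iff f_def distinct_map inj_on_def)
  then show ?thesis
    unfolding factor_list_def f_def by (auto simp: distinct_map inj_on_def)
qed

lemma E_grp_product_of_list:
  assumes n: "n \<ge> 3"
  shows "is_direct_product_of_cyclics (Un_grp n) (map (E_gen n) (factor_list n)) (E_grp n)"
proof -
  have "bij_betw ((!) (factor_list n)) {..<length (factor_list n)} (factor_index n)"
    using bij_betw_nth[OF distinct_factor_list refl] set_factor_list[OF n] by metis
  then show ?thesis
    unfolding is_direct_product_of_cyclics_def length_map
    by (rule internal_direct_product_reindex[OF E_grp_direct_product[OF n]]) simp
qed

theorem mainTheorem1:
  fixes n :: nat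
  assumes "n \<in> {4, 5, 6, 7}"
  shows
    "E_grp n = F_grp n \<and>
     is_internal_direct_product (Un_grp n) (factor_index n) (\<lambda>i. cyc (Un_grp n) (E_gen n i)) (E_grp n) \<and>
     (\<forall>(G :: ('g, 'm) monoid_scheme) x.
        group G \<and> x \<in> carrier G \<and> carrier G = generate G {x} \<and> Coset.order G = 2 ^ n \<longrightarrow>
        is_internal_direct_product (V_ZG G) (factor_index n)
          (\<lambda>i. cyc (V_ZG G) (V_gen G x n i)) (V1 G x n)) \<and>
     (n = 4 \<longrightarrow> is_direct_product_of_cyclics (Un_grp n)
        [d_el n 1 ^ 4,
         d_el n 3 powi (-1) * d_el n 5,
         d_el n 1 powi (-2) * d_el n 3 ^ 2] (E_grp n)) \<and>
     (n = 5 \<longrightarrow> is_direct_product_of_cyclics (Un_grp n)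
        [d_el n 1 ^ 8,
         d_el n 3 powi (-1) * d_el n 13,
         d_el n 5 powi (-1) * d_el n 11,
         d_el n 7 powi (-1) * d_el n 9,
         d_el n 1 powi (-2) * d_el n 7 ^ 2,
         d_el n 3 powi (-2) * d_el n 5 ^ 2,
         d_el n 1 powi (-4) * d_el n 3 ^ 4] (E_grp n)) \<and>
     (n = 6 \<longrightarrow> is_direct_product_of_cyclics (Un_grp n)
        ([d_el n 1 ^ 16] @
         map (\<lambda>l. d_el n (2 * l + 1) powi (-1) * d_el n (32 - (2 * l + 1))) [1..7] @
         [d_el n 1 powi (-2) * d_el n 15 ^ 2,
          d_el n 3 powi (-2) * d_el n 13 ^ 2,
          d_el n 5 powi (-2) * d_el n 11 ^ 2,
          d_el n 7 powi (-2) * d_el n 9 ^ 2,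
          d_el n 1 powi (-4) * d_el n 7 ^ 4,
          d_el n 3 powi (-4) * d_el n 5 ^ 4,
          d_el n 1 powi (-8) * d_el n 3 ^ 8]) (E_grp n)) \<and>
     (n = 7 \<longrightarrow> is_direct_product_of_cyclics (Un_grp n)
        ([d_el n 1 ^ 32] @
         map (\<lambda>l. d_el n (2 * l + 1) powi (-1) * d_el n (64 - (2 * l + 1))) [1..15] @
         map (\<lambda>l. d_el n (2 * l + 1) powi (-2) * d_el n (32 - (2 * l + 1)) ^ 2) [0..7] @
         [d_el n 1 powi (-4) * d_el n 15 ^ 4,
          d_el n 3 powi (-4) * d_el n 13 ^ 4,
          d_el n 5 powi (-4) * d_el n 11 ^ 4,
          d_el n 7 powi (-4) * d_el n 9 ^ 4,
          d_el n 1 powi (-8) * d_el n 7 ^ 8,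
          d_el n 3 powi (-8) * d_el n 5 ^ 8,
          d_el n 1 powi (-16) * d_el n 3 ^ 16]) (E_grp n))"
proof -
  have n: "n \<ge> 3" using assms by auto
  have V: "is_internal_direct_product (V_ZG G) (factor_index n) (\<lambda>i. cyc (V_ZG G) (V_gen G x n i)) (V1 G x n)"
    if "group G \<and> x \<in> carrier G \<and> carrier G = generate G {x} \<and> Coset.order G = 2 ^ n"
    for G :: "('g, 'm) monoid_scheme" and x
  proof -
    interpret cyclic_2_group G x n
      using that by (auto simp: cyclic_2_group_def cyclic_2_group_axioms_def)
    show ?thesis by (rule V1_direct_product[OF n])
  qed
  note L = E_grp_product_of_list[OF n]
  show ?thesis
  proof (intro conjI allI impI)
    show "E_grp n = F_grp n" using E_grp_eq_F_gens[OF n] F_grp_eq_F_gens[OF n] by simp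
    show "is_internal_direct_product (Un_grp n) (factor_index n) (\<lambda>i. cyc (Un_grp n) (E_gen n i)) (E_grp n)"
      by (rule E_grp_direct_product[OF n])
  next
    fix G :: "('g, 'm) monoid_scheme" and x
    assume "group G \<and> x \<in> carrier G \<and> carrier G = generate G {x} \<and> Coset.order G = 2 ^ n"
    then show "is_internal_direct_product (V_ZG G) (factor_index n) (\<lambda>i. cyc (V_ZG G) (V_gen G x n i)) (V1 G x n)"
      by (rule V)
  qed (use L in \<open>simp_all add: factor_list_def upto.simps upt_rec\<close>)
qed

end
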